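(* Let $u\in C^{1}(\mathbb{T}_\ell)$. Assume that for all $x'\in\mathbb{T}_\ell'$ $$m(x')<M(x'),$$ and that $$\mathcal{L}^d\left(\left\{(x',y)\in\mathbb{T}_\ell:\ \partial_y u(x',y)=0\ \text{ and }\ m(x')<u(x',y)<M(x')\right\}\right)=0 .$$ If $$\int_{\mathbb{T}_\ell}|\nabla u|^2\,dx=\int_{\mathbb{T}_\ell}|\nabla u^{s}|^2\,dx,$$ where $u^s$ is the Steiner symmetrization of $u$ with respect to $\{y=0\}$, then there exists $\beta\in I_\ell$ such that $u(x',y)=u^s(x',y-\beta)$ for all $(x',y)\in\mathbb{T}_\ell$.
   Context: Let $d\ge 2$, $\ell>0$, and let $I_\ell:=[-\ell,\ell]$ with endpoints identified. Set $\mathbb{T}_\ell:=I_\ell\times\dots\times I_\ell$ ($d$ factors) and $\mathbb{T}_\ell':=I_\ell\times\dots\times I_\ell$ ($d-1$ factors). Points $x\in\mathbb{T}_\ell$ are written $x=(x',y)$ with $x'\in\mathbb{T}_\ell'$, $y\in I_\ell$; operations on $I_\ell$ are modulo $2\ell$. $C^1(\mathbb{T}_\ell)$ is the space of continuously differentiable functions that are $2\ell$-periodic in each variable. $\mathcal{L}^k$ is $k$-dimensional Lebesgue measure. For $x'\in\mathbb{T}_\ell'$, $$m(x'):=\min\{u(x',y): y\in I_\ell\},\qquad M(x'):=\max\{u(x',y): y\in I_\ell\}.$$ Steiner symmetrization with respect to $\{y=0\}$: for a set $C\subseteq\mathbb{T}_\ell$ with measurable slices $C(x'):=\{y\in I_\ell:(x',y)\in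 C\}$, let $C'$ be the set of $x'\in\mathbb{T}_\ell'$ with $C(x')\neq\emptyset$ and $$C^s:=\bigcup_{x'\in C'}\left\{(x',y)\in\mathbb{T}_\ell:\ 0\le |y|\le \tfrac12\mathcal{L}^1(C(x'))\right\}.$$ For $u:\mathbb{T}_\ell\to\mathbb{R}$ and $t\in\mathbb{R}$ let $\Omega_t:=\{x\in\mathbb{T}_\ell: u(x)>t\}$, and define $u^s(x):=\sup\{t\in\mathbb{R}: x\in(\Omega_t)^s\}$. *)

theory Defs
  imports "HOL-Analysis.Analysis"
begin

text \<open>
  A function on the torus obtained from \<open>[-l, l]\<close> in every coordinate by identifying endpoints is
  represented by its \<open>2 * l\<close>-periodic extension to the whole Euclidean space, and a subset of the
  torus by the corresponding periodic set. The set \<open>cell l\<close> is the cube over which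
  integrals and measures on the torus are taken.
\<close>

definition cell :: "real \<Rightarrow> 'a::euclidean_space set" where
  "cell l = cbox (- (l *\<^sub>R One)) (l *\<^sub>R One)"

definition torus_periodic :: "real \<Rightarrow> ('a::euclidean_space \<Rightarrow> 'b) \<Rightarrow> bool" where
  "torus_periodic l f \<longleftrightarrow> (\<forall>x. \<forall>b\<in>Basis. f (x + (2 * l) *\<^sub>R b) = f x)"

definition C1_torus :: "real \<Rightarrow> ('a::euclidean_space \<Rightarrow> real) \<Rightarrow> bool" where
  "C1_torus l f \<longleftrightarrow>
     torus_periodic l f \<and> (\<exists>D. (\<forall>x. GDERIV f x :> D x) \<and> continuous_on UNIV D)"

text \<open>
  The pointwise gradient, with value \<open>0\<close> where the function is not differentiable. For a Lipschitz
  function the exceptional set is null (Rademacher) and this is a representative of the weak gradient.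
\<close>

definition grad :: "('a::real_inner \<Rightarrow> real) \<Rightarrow> 'a \<Rightarrow> 'a" where
  "grad f x = (if \<exists>D. GDERIV f x :> D then (THE D. GDERIV f x :> D) else 0)"

definition dirichlet :: "real \<Rightarrow> ('a::euclidean_space \<Rightarrow> real) \<Rightarrow> ennreal" where
  "dirichlet l f = (\<integral>\<^sup>+ x \<in> cell l. ennreal ((norm (grad f x))\<^sup>2) \<partial>lebesgue)"

text \<open>
  For \<open>l > 0\<close>, the representative modulo \<open>2 * l\<close> lying in \<open>[-l, l)\<close>. Which of the two endpoints is
  chosen is immaterial below, since only its absolute value is used.
\<close>

definition circle_rep :: "real \<Rightarrow> real \<Rightarrow> real" where
  "circle_rep l y = y - 2 * l * of_int (round (y / (2 * l)))"

definition slice :: "real \<Rightarrow> ('a \<times> real) set \<Rightarrow> 'a \<Rightarrow> real set" where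
  "slice l C x' = {y \<in> {-l..l}. (x', y) \<in> C}"

definition steiner_set :: "real \<Rightarrow> ('a \<times> real) set \<Rightarrow> ('a \<times> real) set" where
  "steiner_set l C =
     {(x', y). slice l C x' \<noteq> {} \<and> \<bar>circle_rep l y\<bar> \<le> measure lebesgue (slice l C x') / 2}"

definition superlevel :: "('a \<Rightarrow> real) \<Rightarrow> real \<Rightarrow> 'a set" where
  "superlevel u t = {x. u x > t}"

text \<open>
  For bounded \<open>u\<close> and \<open>l > 0\<close> the set below is nonempty and bounded above, so the real supremum
  is the genuine one.
\<close>

definition steiner :: "real \<Rightarrow> ('a \<times> real \<Rightarrow> real) \<Rightarrow> 'a \<times> real \<Rightarrow> real" where
  "steiner l u x = Sup {t. x \<in> steiner_set l (superlevel u t)}"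

text \<open>
  For continuous \<open>u\<close> the infimum and supremum over the compact interval are attained, i.e. they
  are the minimum and maximum.
\<close>

definition slice_min :: "real \<Rightarrow> ('a \<times> real \<Rightarrow> real) \<Rightarrow> 'a \<Rightarrow> real" where
  "slice_min l u x' = (INF y\<in>{-l..l}. u (x', y))"

definition slice_max :: "real \<Rightarrow> ('a \<times> real \<Rightarrow> real) \<Rightarrow> 'a \<Rightarrow> real" where
  "slice_max l u x' = (SUP y\<in>{-l..l}. u (x', y))"

end

(*
  The energy of u and the energy of its symmetrization v are compared slice by slice in x'. In the
  directions of x', difference quotients decrease in L^2 under rearrangement (layer cake), and in
  the direction of y the values of v on a uniform partition give step functions whose energy is at
  most that of the slice, by Cauchy-Schwarz on each band between two consecutive levels. Fatou's
  lemma then yields the inequality for every x' at all points where v happens to be differentiable,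
  so no differentiability or measurability of the gradient of v is needed. The bands
  give a definite gain if some level is crossed a third time, or if the slopes at the two points of a
  level differ. So equality forces almost every slice to be unimodal with equal slopes on both
  arcs, and since critical points between the extremal levels are null, a change of variables shows that the
  slice is symmetric about a centre c(x'). By compactness this holds for all x'. A nonconstant slice has
  only one centre modulo 2l, and differentiating u(x', c + s) = u(x', c - s) at a regular s shows that c is
  differentiable. Hence v(x', z) = u(x', c(x') + z) is differentiable, and reflecting z yields
  that the energy of u exceeds that of v by the integral of |grad c|^2 (d_y u)^2. So grad c = 0 almost
  everywhere, and then everywhere because its formula is continuous.
*)

theory Submission
  imports Defs
begin

section \<open>The rearrangement of a slice\<close>

text \<open>Bands of positive height replace single levels because a band needs only the
  intermediate value theorem and a bound on its measure, with no regular values and no derivative of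
  the distribution function. The price is that a defect of a slice must yield a surplus that does
  not shrink when the partition is refined. Hence a defect is recorded for all subbands of a fixed
  interval of levels, with a fixed factor \<rho> > 1: 3/2 for three crossings instead of two, and 1
  + \<kappa>/4 for unequal slopes, because one multiplier \<omega> cannot be close to both slopes.
  Critical points must be null since equal slopes only match the regular parts of the two inverses
  of a slice; otherwise an inverse could also vary in a singular way, and the arcs could differ. For
  the final identity, let w be the horizontal gradient of \<open>v\<close> and p its vertical
  derivative at z. The horizontal gradient of \<open>u\<close> is w - p grad c at c + z and w + p
  grad c at c - z, so the parallelogram law computes the excess. The centre is a point of a circle.
  No global real-valued continuous choice is made: derivatives are taken of local branches, and
  constancy is proved for cos and sin of pi c / l.\<close>

definition dist_fun :: "real \<Rightarrow> (real \<Rightarrow> real) \<Rightarrow> real \<Rightarrow> real" where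
  "dist_fun l g t = measure lebesgue {z \<in> {-l..l}. t < g z}"

definition rad :: "real \<Rightarrow> (real \<Rightarrow> real) \<Rightarrow> real \<Rightarrow> real" where
  "rad l g r = Sup {t. (\<exists>z\<in>{-l..l}. t < g z) \<and> r \<le> dist_fun l g t / 2}"

lemma abs_circle_rep_le: assumes l: "l > 0" shows "\<bar>circle_rep l y\<bar> \<le> l"
proof -
  have "\<bar>y / (2*l) - of_int (round (y/(2*l)))\<bar> \<le> 1/2"
    using of_int_round_abs_le[of "y/(2*l)"] by (simp add: abs_minus_commute)
  hence "\<bar>2*l\<bar> * \<bar>y / (2*l) - of_int (round (y/(2*l)))\<bar> \<le> l" using l by simp
  moreover have "2*l * (y / (2*l) - of_int (round (y/(2*l)))) = circle_rep l y"
    using l by (simp add: circle_rep_def right_diff_distrib)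
  ultimately show ?thesis unfolding abs_mult[symmetric] by simp
qed

lemma abs_circle_rep: assumes l: "l > 0" and y: "\<bar>y\<bar> \<le> l" shows "\<bar>circle_rep l y\<bar> = \<bar>y\<bar>"
proof -
  have b: "\<bar>y/(2*l)\<bar> \<le> 1/2" using assms by (simp add: abs_divide field_simps)
  consider "y = l" | "y < l" using y by linarith
  then show ?thesis
  proof cases
    case 1
    \<comment> \<open>Rounding a half upwards sends the endpoint l to -l, so only absolute values
      agree.\<close>
    have "round (1/2::real) = 1" by (simp add: round_def)
    then show ?thesis using l 1 by (simp add: circle_rep_def)
  next
    case 2
    have "y/(2*l) < 1/2" "y/(2*l) \<ge> -1/2" using 2 l b by (auto simp: field_simps)
    hence "round (y/(2*l)) = 0" unfolding round_def by (intro floor_unique) auto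
    then show ?thesis by (simp add: circle_rep_def)
  qed
qed

lemma circle_rep_eq: "\<exists>k::int. y = circle_rep l y + 2 * l * of_int k"
  by (rule exI[of _ "round (y/(2*l))"]) (simp add: circle_rep_def)

lemma periodic_int:
  fixes f :: "real \<Rightarrow> 'b"
  assumes "\<And>y. f (y + T) = f y"
  shows "f (y + T * of_int k) = f y"
proof (induction k rule: int_induct[of _ 0])
  case (step1 i)
  then show ?case using assms[of "y + T * of_int i"] by (simp add: algebra_simps)
next
  case (step2 i)
  then show ?case using assms[of "y + T * of_int (i - 1)"] by (simp add: algebra_simps)
qed simp

lemma periodic_circle_rep:
  fixes f :: "real \<Rightarrow> 'b"
  assumes "\<And>y. f (y + 2 * l) = f y"
  shows "f (c + circle_rep l z) = f (c + z)"
proof -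
  obtain k :: int where k: "z = circle_rep l z + 2 * l * of_int k" using circle_rep_eq by blast
  have "f (c + circle_rep l z + 2 * l * of_int k) = f (c + circle_rep l z)" 
    by (rule periodic_int[of f]) (rule assms)
  then show ?thesis using k by (metis add.assoc)
qed

lemma steiner_eq_rad: "steiner l u (x, y) = rad l (\<lambda>z. u (x, z)) \<bar>circle_rep l y\<bar>"
proof -
  have "{z \<in> {-l..l}. t < u (x, z)} = slice l (superlevel u t) x" for t
    by (auto simp: slice_def superlevel_def)
  then show ?thesis
    by (auto simp: steiner_def steiner_set_def rad_def dist_fun_def slice_def superlevel_def intro!: arg_cong[where f=Sup])
qed

section \<open>Level sets and radial profile of a continuous slice\<close>

locale slice_fun =
  fixes l :: real and g :: "real \<Rightarrow> real"
  assumes l: "l > 0" and cont: "continuous_on UNIV g"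
begin

definition mn where "mn = (INF y\<in>{-l..l}. g y)"
definition mx where "mx = (SUP y\<in>{-l..l}. g y)"

lemma compact_range: "compact (g ` {-l..l})" by (intro compact_continuous_image continuous_on_subset[OF cont]) auto
lemma bdd_range: "bdd_above (g ` {-l..l})" "bdd_below (g ` {-l..l})"
  using compact_imp_bounded[OF compact_range] by (auto dest: bounded_imp_bdd_above bounded_imp_bdd_below)
lemma le_mx: "y \<in> {-l..l} \<Longrightarrow> g y \<le> mx" unfolding mx_def by (rule cSUP_upper[OF _ bdd_range(1)])
lemma mn_le: "y \<in> {-l..l} \<Longrightarrow> mn \<le> g y" unfolding mn_def by (rule cINF_lower[OF bdd_range(2)])
lemma mx_attained: obtains y where "y \<in> {-l..l}" "g y = mx"
proof -
  have "\<exists>s\<in>g ` {-l..l}. \<forall>t\<in>g ` {-l..l}. t \<le> s" using l by (intro compact_attains_sup compact_range) auto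
  then obtain y where y: "y \<in> {-l..l}" "\<forall>z\<in>{-l..l}. g z \<le> g y" by auto
  hence "mx \<le> g y" unfolding mx_def using l by (intro cSUP_least) auto
  with le_mx[OF y(1)] have "g y = mx" by simp
  with y(1) show ?thesis using that by blast
qed
lemma mn_attained: obtains y where "y \<in> {-l..l}" "g y = mn"
proof -
  have "\<exists>s\<in>g ` {-l..l}. \<forall>t\<in>g ` {-l..l}. s \<le> t" using l by (intro compact_attains_inf compact_range) auto
  then obtain y where y: "y \<in> {-l..l}" "\<forall>z\<in>{-l..l}. g y \<le> g z" by auto
  hence "g y \<le> mn" unfolding mn_def using l by (intro cINF_greatest) auto
  with mn_le[OF y(1)] have "g y = mn" by simp
  with y(1) show ?thesis using that by blast
qed
lemma mn_le_mx: "mn \<le> mx" using mn_attained mn_le le_mx by metis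

lemma g_borel[measurable]: "g \<in> borel_measurable borel" using cont by (rule borel_measurable_continuous_onI)

abbreviation "mu \<equiv> dist_fun l g"

lemma mu_lborel: "mu t = measure lborel {z \<in> {-l..l}. t < g z}"
  unfolding dist_fun_def by (rule measure_completion) measurable

lemma emeasure_sub: "A \<in> sets lborel \<Longrightarrow> emeasure lborel {z \<in> {-l..l}. z \<in> A} \<noteq> \<infinity>"
proof -
  assume "A \<in> sets lborel"
  have "emeasure lborel {z \<in> {-l..l}. z \<in> A} \<le> emeasure lborel {-l..l}" by (rule emeasure_mono) auto
  also have "\<dots> < \<infinity>" using l by simp
  finally show ?thesis by simp
qed

lemma superlevel_fmeasurable[simp]: "{z \<in> {-l..l}. t < g z} \<in> fmeasurable lborel" "{z \<in> {-l..l}. t \<le> g z} \<in> fmeasurable lborel"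
  using emeasure_sub[of "{z. t < g z}"] emeasure_sub[of "{z. t \<le> g z}"]
  by (auto simp: fmeasurable_def less_top)

lemma mu_mono: "s \<le> t \<Longrightarrow> mu t \<le> mu s" unfolding mu_lborel
  by (rule measure_mono_fmeasurable[OF _ fmeasurableD[OF superlevel_fmeasurable(1)] superlevel_fmeasurable(1)]) auto

lemma Icc_fmeasurable: "{a..b::real} \<in> fmeasurable lborel"
  by (cases "a \<le> b") (auto simp: fmeasurable_def)

lemma mu_nonneg: "0 \<le> mu t" by (simp add: dist_fun_def)

text \<open>Continuity of measure from below. It allows \<open>rad_gtI\<close> to raise a level
  slightly while keeping a strict inequality for the measure.\<close>

lemma mu_right_cont: "(\<lambda>n. mu (s + 1 / Suc n)) \<longlonglongrightarrow> mu s"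
proof -
  let ?A = "\<lambda>n. {z \<in> {-l..l}. s + 1 / Suc n < g z}"
  have U: "(\<Union>n. ?A n) = {z \<in> {-l..l}. s < g z}"
  proof safe
    fix x n assume "s + 1 / Suc n < g x" then show "s < g x"
      by (smt (verit) divide_pos_pos of_nat_0_less_iff zero_less_Suc)
  next
    fix x assume x: "s < g x" "x \<in> {-l..l}"
    then obtain n where "inverse (of_nat (Suc n)) < g x - s" using reals_Archimedean[of "g x - s"] by auto
    then show "x \<in> (\<Union>n. ?A n)" using x by (auto simp: inverse_eq_divide intro!: exI[of _ n])
  qed
  have "(\<lambda>n. measure lborel (?A n)) \<longlonglongrightarrow> measure lborel (\<Union>n. ?A n)"
  proof (rule Lim_measure_incseq)
    show "range ?A \<subseteq> sets lborel" by auto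
    show "incseq ?A"
    proof (rule incseq_SucI, safe)
      fix n z assume "s + 1 / (Suc n) < g z"
      moreover have "1 / real (Suc (Suc n)) \<le> 1 / Suc n" by (simp add: field_simps)
      ultimately show "s + 1 / (Suc (Suc n)) < g z" by simp
    qed
    show "emeasure lborel (\<Union>n. ?A n) \<noteq> \<infinity>" unfolding U using emeasure_sub[of "{z. s < g z}"] by auto
  qed
  then show ?thesis unfolding U mu_lborel .
qed

lemma measure_ge_lim: "(\<lambda>n. mu (s - 1 / Suc n)) \<longlonglongrightarrow> measure lborel {z \<in> {-l..l}. s \<le> g z}"
proof -
  let ?A = "\<lambda>n. {z \<in> {-l..l}. s - 1 / Suc n < g z}"
  have U: "(\<Inter>n. ?A n) = {z \<in> {-l..l}. s \<le> g z}"
  proof safe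
    fix x assume x: "x \<in> (\<Inter>n. ?A n)"
    show "s \<le> g x"
    proof (rule ccontr)
      assume "\<not> s \<le> g x"
      then obtain n where "inverse (of_nat (Suc n)) < s - g x" using reals_Archimedean[of "s - g x"] by auto
      moreover have "s - 1 / Suc n < g x" using x by auto
      ultimately show False by (simp add: inverse_eq_divide)
    qed
  next
    fix x n assume x: "s \<le> g x" 
    have "0 < 1 / real (Suc n)" by simp
    then show "s - 1 / Suc n < g x" using x by linarith
  qed auto
  have "(\<lambda>n. measure lborel (?A n)) \<longlonglongrightarrow> measure lborel (\<Inter>n. ?A n)"
  proof (rule Lim_measure_decseq)
    show "range ?A \<subseteq> sets lborel" by auto
    show "decseq ?A"
    proof (rule decseq_SucI, safe)
      fix n z assume "s - 1 / (Suc (Suc n)) < g z"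
      moreover have "1 / real (Suc (Suc n)) \<le> 1 / Suc n" by (simp add: field_simps)
      ultimately show "s - 1 / (Suc n) < g z" by simp
    qed
    show "emeasure lborel (?A n) \<noteq> \<infinity>" for n using emeasure_sub[of "{z. s - 1 / Suc n < g z}"] by auto
  qed
  then show ?thesis unfolding U mu_lborel .
qed

definition cand where "cand r = {t. (\<exists>z\<in>{-l..l}. t < g z) \<and> r \<le> mu t / 2}"
lemma rad_cand: "rad l g r = Sup (cand r)" by (simp add: rad_def cand_def)

lemma mu_full: assumes "t < mn" shows "mu t = 2 * l"
proof -
  have "{z \<in> {-l..l}. t < g z} = {-l..l}" using assms mn_le by fastforce
  thus ?thesis using l by (simp add: mu_lborel)
qed

lemma in_cand: "r \<le> l \<Longrightarrow> t < mn \<Longrightarrow> t \<in> cand r"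
  unfolding cand_def using mu_full[of t] mn_le l by (auto intro!: bexI[of _ 0] less_le_trans[of _ mn])

lemma cand_bdd: "bdd_above (cand r)" 
  by (rule bdd_aboveI[of _ mx]) (auto simp: cand_def dest: le_mx intro: less_imp_le less_le_trans)

lemma cand_ne: "r \<le> l \<Longrightarrow> cand r \<noteq> {}" using in_cand[of r "mn - 1"] by auto

lemma rad_le_mx: "r \<le> l \<Longrightarrow> rad l g r \<le> mx"
  unfolding rad_cand by (rule cSup_least[OF cand_ne]) (auto simp: cand_def dest: le_mx intro: less_imp_le less_le_trans)

lemma mn_le_rad: assumes "r \<le> l" shows "mn \<le> rad l g r"
proof (rule field_le_epsilon)
  fix e :: real assume "e > 0"
  then have "mn - e \<le> rad l g r" unfolding rad_cand by (intro cSup_upper in_cand cand_bdd) (use assms in auto)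
  then show "mn \<le> rad l g r + e" by simp
qed

lemma rad_antimono: "r \<le> s \<Longrightarrow> s \<le> l \<Longrightarrow> rad l g s \<le> rad l g r"
  unfolding rad_cand by (rule cSup_subset_mono[OF cand_ne cand_bdd]) (auto simp: cand_def)

text \<open>With \<open>rad_gtI\<close> this is the Galois connection between \<open>rad\<close> and
  \<open>mu\<close>, up to the boundary case of equality, which costs only null sets later
  on.\<close>

lemma rad_gtD: assumes "s < rad l g r" "r \<le> l" shows "r \<le> mu s / 2"
proof -
  obtain t where "t \<in> cand r" "s < t" using assms less_cSup_iff[OF cand_ne cand_bdd] unfolding rad_cand by metis
  then show ?thesis using mu_mono[of s t] by (auto simp: cand_def)
qed

lemma rad_gtI: assumes "r < mu s / 2" "0 \<le> r" shows "s < rad l g r"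
proof -
  have "(\<lambda>n. mu (s + 1 / Suc n) / 2) \<longlonglongrightarrow> mu s / 2" by (intro tendsto_intros mu_right_cont) simp
  then have "eventually (\<lambda>n. mu (s + 1 / Suc n) / 2 > r) sequentially" using assms(1) by (rule order_tendstoD)
  then obtain n where n: "mu (s + 1 / Suc n) / 2 > r" by (auto dest: eventually_happens)
  have "s + 1 / Suc n \<in> cand r"
  proof -
    have "{z \<in> {-l..l}. s + 1 / Suc n < g z} \<noteq> {}"
    proof
      assume *: "{z \<in> {-l..l}. s + 1 / Suc n < g z} = {}"
      show False using n assms(2) unfolding mu_lborel * by simp
    qed
    then show ?thesis using n by (auto simp: cand_def)
  qed
  then have "s + 1 / Suc n \<le> rad l g r" unfolding rad_cand by (rule cSup_upper[OF _ cand_bdd])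
  moreover have "0 < 1 / real (Suc n)" by simp
  ultimately show ?thesis by linarith
qed

text \<open>Together with \<open>measure_ge_rad\<close> this brackets the radius: the open
  superlevel set at the value \<open>rad l g r\<close> has measure at most 2r, the closed one at
  least 2r. Plateaus of g account for the difference.\<close>

lemma mu_rad_le: "0 \<le> r \<Longrightarrow> mu (rad l g r) \<le> 2 * r"
  using rad_gtI[of r "rad l g r"] by fastforce

lemma measure_ge_rad: assumes "0 \<le> r" "r \<le> l" shows "2 * r \<le> measure lborel {z \<in> {-l..l}. rad l g r \<le> g z}"
proof (rule LIMSEQ_le_const[OF measure_ge_lim], intro exI allI impI)
  fix n :: nat
  have "0 < 1 / real (Suc n)" by simp
  then have "rad l g r - 1 / Suc n < rad l g r" by linarith
  from rad_gtD[OF this assms(2)] show "2 * r \<le> mu (rad l g r - 1 / Suc n)" by simp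
qed

text \<open>At radius 0 the measure condition is void, so the value is decided by nonemptiness of
  the superlevel set alone.\<close>

lemma rad_0: "rad l g 0 = mx"
proof (rule antisym[OF rad_le_mx])
  obtain y where y: "y \<in> {-l..l}" "g y = mx" by (rule mx_attained)
  show "mx \<le> rad l g 0"
  proof (rule field_le_epsilon)
    fix e :: real assume "e > 0"
    then have "mx - e \<in> cand 0" using y by (auto simp: cand_def mu_nonneg intro!: bexI[of _ y])
    then have "mx - e \<le> rad l g 0" unfolding rad_cand by (intro cSup_upper cand_bdd)
    then show "mx \<le> rad l g 0 + e" by simp
  qed
qed (use l in simp)

lemma rad_l: "rad l g l = mn"
proof (rule antisym[OF _ mn_le_rad])
  obtain y where y: "y \<in> {-l..l}" "g y = mn" by (rule mn_attained)
  show "rad l g l \<le> mn"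
  proof (rule ccontr)
    assume "\<not> rad l g l \<le> mn"
    then obtain s where s: "mn < s" "s < rad l g l" by (meson dense not_le)
    have f: "mu s \<ge> 2 * l" using rad_gtD[OF s(2)] by simp
    have "open {z. g z < s}" by (rule open_Collect_less[OF cont]) auto
    then obtain e where e: "e > 0" "ball y e \<subseteq> {z. g z < s}" using y s by (metis mem_Collect_eq openE)
    \<comment> \<open>The neighbourhood of the minimum point is clipped to the interval; half of it
      survives even if that point is an endpoint, and this is a set of positive measure on which g <
      s.\<close>
    define a where "a = max (-l) (y - e/2)"
    define b where "b = min l (y + e/2)"
    have ab: "a < b" "-l \<le> a" "b \<le> l" using y e l by (auto simp: a_def b_def)
    have sub: "{a..b} \<subseteq> {z. g z < s}" using e by (auto simp: a_def b_def dist_real_def subset_iff)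
    have "{z \<in> {-l..l}. s < g z} \<subseteq> {-l..l} - {a..b}" using sub by force
    then have "mu s \<le> measure lborel ({-l..l} - {a..b})" unfolding mu_lborel
      by (rule measure_mono_fmeasurable[OF _ fmeasurableD[OF superlevel_fmeasurable(1)] fmeasurable_Diff[OF Icc_fmeasurable]]) auto
    also have "\<dots> = 2 * l - (b - a)" using ab l by (subst measure_Diff) (auto)
    finally show False using f ab by simp
  qed
qed simp

text \<open>Monotone functions are Borel. The radius is clamped at l because beyond it the set in
  \<open>rad\<close> is empty and its supremum carries no information.\<close>

lemma rad_borel[measurable]: "(\<lambda>y. rad l g (min \<bar>y\<bar> l)) \<in> borel_measurable borel"
proof -
  have "mono (\<lambda>r. - rad l g (min r l))" by (auto intro!: monoI rad_antimono)
  from borel_measurable_mono[OF this] have [measurable]: "(\<lambda>r. - rad l g (min r l)) \<in> borel_measurable borel" .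
  have "(\<lambda>y. - (- rad l g (min \<bar>y\<bar> l))) \<in> borel_measurable borel" by measurable
  then show ?thesis by simp
qed

end

section \<open>Rearrangement decreases the distance in L2\<close>

text \<open>The right side is the area of the triangle b \<le> t \<le> s < a. In this form a squared
  distance becomes an integral of measures of sets described by levels only.\<close>

lemma layer_cake:
  fixes a b :: real
  shows "(\<integral>\<^sup>+s. \<integral>\<^sup>+t. (if b \<le> t \<and> t \<le> s \<and> s < a then 1 else 0) \<partial>lborel \<partial>lborel) = ennreal ((max 0 (a - b))\<^sup>2 / 2)"
proof -
  have inner: "(\<integral>\<^sup>+t. (if b \<le> t \<and> t \<le> s \<and> s < a then 1 else 0) \<partial>lborel) = ennreal (s - b) * indicator {b..<a} s" for s
  proof (cases "b \<le> s \<and> s < a")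
    case True
    have "(\<integral>\<^sup>+t. (if b \<le> t \<and> t \<le> s \<and> s < a then 1 else 0) \<partial>lborel) = (\<integral>\<^sup>+t. indicator {b..s} t \<partial>lborel)"
      using True by (intro nn_integral_cong) (auto simp: indicator_def)
    then show ?thesis using True by simp
  next
    case False
    then have "(\<lambda>t. (if b \<le> t \<and> t \<le> s \<and> s < a then 1 else 0)) = (\<lambda>t. 0 :: ennreal)" by auto
    then show ?thesis using False by auto
  qed
  show ?thesis
  proof (cases "b \<le> a")
    case True
    have "(\<integral>\<^sup>+s. ennreal (s - b) * indicator {b..<a} s \<partial>lborel) = (\<integral>\<^sup>+s. ennreal (s - b) * indicator {b..a} s \<partial>lborel)"
      using AE_lborel_singleton[of a] by (intro nn_integral_cong_AE) (auto elim!: eventually_mono simp: indicator_def)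
    also have "\<dots> = ennreal ((a - b)^2/2 - (b - b)^2/2)"
      using True by (intro nn_integral_FTC_Icc) (auto intro!: derivative_eq_intros)
    finally show ?thesis using True by (simp add: inner max_def)
  next
    case False then show ?thesis by (simp add: inner max_def)
  qed
qed

lemma nn_integral_layer_cake:
  fixes f h :: "real \<Rightarrow> real"
  assumes [measurable]: "f \<in> borel_measurable borel" "h \<in> borel_measurable borel" "A \<in> sets borel"
  shows "(\<integral>\<^sup>+y\<in>A. ennreal ((max 0 (f y - h y))\<^sup>2 / 2) \<partial>lborel)
    = (\<integral>\<^sup>+s. \<integral>\<^sup>+t. emeasure lborel {y \<in> A. h y \<le> t \<and> t \<le> s \<and> s < f y} \<partial>lborel \<partial>lborel)"
proof -
  let ?P = "\<lambda>y s t. (if y \<in> A \<and> h y \<le> t \<and> t \<le> s \<and> s < f y then 1 else 0) :: ennreal"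
  have "(\<integral>\<^sup>+y\<in>A. ennreal ((max 0 (f y - h y))\<^sup>2 / 2) \<partial>lborel) = (\<integral>\<^sup>+y. \<integral>\<^sup>+s. \<integral>\<^sup>+t. ?P y s t \<partial>lborel \<partial>lborel \<partial>lborel)"
    unfolding layer_cake[symmetric] by (intro nn_integral_cong) (auto simp: indicator_def)
  also have "\<dots> = (\<integral>\<^sup>+s. \<integral>\<^sup>+y. \<integral>\<^sup>+t. ?P y s t \<partial>lborel \<partial>lborel \<partial>lborel)"
    by (rule lborel_pair.Fubini'[symmetric]) measurable
  also have "\<dots> = (\<integral>\<^sup>+s. \<integral>\<^sup>+t. \<integral>\<^sup>+y. ?P y s t \<partial>lborel \<partial>lborel \<partial>lborel)"
    by (rule nn_integral_cong, rule lborel_pair.Fubini'[symmetric]) measurable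
  also have "\<dots> = (\<integral>\<^sup>+s. \<integral>\<^sup>+t. \<integral>\<^sup>+y. indicator {y \<in> A. h y \<le> t \<and> t \<le> s \<and> s < f y} y \<partial>lborel \<partial>lborel \<partial>lborel)"
    by (intro nn_integral_cong) (auto simp: indicator_def)
  also have "\<dots> = (\<integral>\<^sup>+s. \<integral>\<^sup>+t. emeasure lborel {y \<in> A. h y \<le> t \<and> t \<le> s \<and> s < f y} \<partial>lborel \<partial>lborel)"
    by (intro nn_integral_cong nn_integral_indicator) auto
  finally show ?thesis .
qed

lemma emeasure_annulus: fixes a b :: real assumes "0 \<le> a" shows "emeasure lborel {y. a \<le> \<bar>y\<bar> \<and> \<bar>y\<bar> \<le> b} \<le> ennreal (2 * (b - a))"
proof (cases "a \<le> b")
  case True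
  have "{y. a \<le> \<bar>y\<bar> \<and> \<bar>y\<bar> \<le> b} \<subseteq> {a..b} \<union> {-b.. -a}" by auto
  then have "emeasure lborel {y. a \<le> \<bar>y\<bar> \<and> \<bar>y\<bar> \<le> b} \<le> emeasure lborel ({a..b} \<union> {-b.. -a})" by (rule emeasure_mono) auto
  also have "\<dots> \<le> emeasure lborel {a..b} + emeasure lborel {-b.. -a}" by (rule emeasure_subadditive) auto
  also have "\<dots> = ennreal (2 * (b - a))" using True by (simp flip: ennreal_plus)
  finally show ?thesis .
next
  case False
  then have e: "{y. a \<le> \<bar>y\<bar> \<and> \<bar>y\<bar> \<le> b} = {}" by auto
  show ?thesis unfolding e by simp
qed

context fixes l and g1 g2 assumes S1: "slice_fun l g1" and S2: "slice_fun l g2" begin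
interpretation g1: slice_fun l g1 by (rule S1)
interpretation g2: slice_fun l g2 by (rule S2)

text \<open>For t \<le> s the right set is the part of {g1 > s} outside {g2 > t}, so its measure is
  at least the difference of the two measures. For the rearranged functions the superlevel sets are
  nested and centred, and the left set lies in an annulus whose measure is at most that difference,
  or 0 if the difference is negative.\<close>

lemma rad_level_le:
  "emeasure lborel {y \<in> {-l..l}. rad l g2 (min \<bar>y\<bar> l) \<le> t \<and> t \<le> s \<and> s < rad l g1 (min \<bar>y\<bar> l)}
    \<le> emeasure lborel {y \<in> {-l..l}. g2 y \<le> t \<and> t \<le> s \<and> s < g1 y}"
proof (cases "t \<le> s")
  case True
  have "{y \<in> {-l..l}. rad l g2 (min \<bar>y\<bar> l) \<le> t \<and> t \<le> s \<and> s < rad l g1 (min \<bar>y\<bar> l)}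
    \<subseteq> {y. g2.mu t / 2 \<le> \<bar>y\<bar> \<and> \<bar>y\<bar> \<le> g1.mu s / 2}"
  proof safe
    fix y assume y: "y \<in> {-l..l}" "rad l g2 (min \<bar>y\<bar> l) \<le> t" "s < rad l g1 (min \<bar>y\<bar> l)"
    have m: "min \<bar>y\<bar> l = \<bar>y\<bar>" using y(1) by auto
    show "g2.mu t / 2 \<le> \<bar>y\<bar>" using y g2.rad_gtI[of "\<bar>y\<bar>" t] unfolding m by linarith
    show "\<bar>y\<bar> \<le> g1.mu s / 2" using g1.rad_gtD[of s "\<bar>y\<bar>"] y unfolding m by auto
  qed
  then have "emeasure lborel {y \<in> {-l..l}. rad l g2 (min \<bar>y\<bar> l) \<le> t \<and> t \<le> s \<and> s < rad l g1 (min \<bar>y\<bar> l)}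
     \<le> emeasure lborel {y. g2.mu t / 2 \<le> \<bar>y\<bar> \<and> \<bar>y\<bar> \<le> g1.mu s / 2}" by (rule emeasure_mono) measurable
  also have "\<dots> \<le> ennreal (2 * (g1.mu s / 2 - g2.mu t / 2))"
    by (rule emeasure_annulus) (simp add: g2.mu_nonneg)
  also have "\<dots> = ennreal (g1.mu s) - ennreal (g2.mu t)" by (simp add: ennreal_minus g2.mu_nonneg)
  also have "\<dots> \<le> emeasure lborel {y \<in> {-l..l}. g2 y \<le> t \<and> t \<le> s \<and> s < g1 y}"
  proof -
    have "ennreal (g1.mu s) = emeasure lborel {z \<in> {-l..l}. s < g1 z}" 
      unfolding g1.mu_lborel using g1.superlevel_fmeasurable(1) by (subst emeasure_eq_measure2) (auto simp: fmeasurable_def)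
    also have "\<dots> \<le> emeasure lborel ({y \<in> {-l..l}. g2 y \<le> t \<and> t \<le> s \<and> s < g1 y} \<union> {z \<in> {-l..l}. t < g2 z})"
      using True by (intro emeasure_mono) auto
    also have "\<dots> \<le> emeasure lborel {y \<in> {-l..l}. g2 y \<le> t \<and> t \<le> s \<and> s < g1 y} + emeasure lborel {z \<in> {-l..l}. t < g2 z}"
      by (rule emeasure_subadditive) auto
    also have "emeasure lborel {z \<in> {-l..l}. t < g2 z} = ennreal (g2.mu t)"
      unfolding g2.mu_lborel using g2.superlevel_fmeasurable(1) by (subst emeasure_eq_measure2) (auto simp: fmeasurable_def)
    finally show ?thesis by (simp add: ennreal_minus_le_iff add.commute)
  qed
  finally show ?thesis .
next
  case False
  then show ?thesis by simp
qed

end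

lemma sq_split: "ennreal ((a - b)\<^sup>2) = 2 * ennreal ((max 0 (a - b))\<^sup>2 / 2) + 2 * ennreal ((max 0 (b - a))\<^sup>2 / 2)"
proof -
  have "2 * ennreal ((max 0 (a - b))\<^sup>2 / 2) + 2 * ennreal ((max 0 (b - a))\<^sup>2 / 2)
    = ennreal (2 * ((max 0 (a - b))\<^sup>2 / 2) + 2 * ((max 0 (b - a))\<^sup>2 / 2))"
    by (simp flip: ennreal_plus ennreal_mult' ennreal_numeral)
  also have "2 * ((max 0 (a - b))\<^sup>2 / 2) + 2 * ((max 0 (b - a))\<^sup>2 / 2) = (a - b)\<^sup>2"
    by (auto simp: max_def power2_commute)
  finally show ?thesis ..
qed

lemma nn_integral_sq_split:
  fixes f h :: "real \<Rightarrow> real"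
  assumes [measurable]: "f \<in> borel_measurable borel" "h \<in> borel_measurable borel" "A \<in> sets borel"
  shows "(\<integral>\<^sup>+y\<in>A. ennreal ((f y - h y)\<^sup>2) \<partial>lborel)
    = 2 * (\<integral>\<^sup>+y\<in>A. ennreal ((max 0 (f y - h y))\<^sup>2 / 2) \<partial>lborel) + 2 * (\<integral>\<^sup>+y\<in>A. ennreal ((max 0 (h y - f y))\<^sup>2 / 2) \<partial>lborel)"
proof -
  have "(\<integral>\<^sup>+y\<in>A. ennreal ((f y - h y)\<^sup>2) \<partial>lborel)
    = (\<integral>\<^sup>+y. 2 * (ennreal ((max 0 (f y - h y))\<^sup>2 / 2) * indicator A y) + 2 * (ennreal ((max 0 (h y - f y))\<^sup>2 / 2) * indicator A y) \<partial>lborel)"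
    unfolding sq_split by (intro nn_integral_cong) (auto simp: indicator_def)
  also have "\<dots> = (\<integral>\<^sup>+y. 2 * (ennreal ((max 0 (f y - h y))\<^sup>2 / 2) * indicator A y) \<partial>lborel) + (\<integral>\<^sup>+y. 2 * (ennreal ((max 0 (h y - f y))\<^sup>2 / 2) * indicator A y) \<partial>lborel)"
    by (rule nn_integral_add) measurable
  finally show ?thesis by (simp add: nn_integral_cmult)
qed

text \<open>Both signs of the difference are treated separately by the layer cake, where
  \<open>rad_level_le\<close> compares the integrands for each pair of levels. It is used for the
  slices over two nearby points, whose difference quotients give the horizontal derivatives.\<close>

lemma rad_nonexp:
  assumes S1: "slice_fun l g1" and S2: "slice_fun l g2"
  shows "(\<integral>\<^sup>+y\<in>{-l..l}. ennreal ((rad l g1 (min \<bar>y\<bar> l) - rad l g2 (min \<bar>y\<bar> l))\<^sup>2) \<partial>lborel)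
   \<le> (\<integral>\<^sup>+y\<in>{-l..l}. ennreal ((g1 y - g2 y)\<^sup>2) \<partial>lborel)"
proof -
  note [measurable] = slice_fun.rad_borel[OF S1] slice_fun.rad_borel[OF S2] slice_fun.g_borel[OF S1] slice_fun.g_borel[OF S2]
  show ?thesis
    unfolding nn_integral_sq_split[OF slice_fun.g_borel[OF S1] slice_fun.g_borel[OF S2], of "{-l..l}", simplified]
      nn_integral_sq_split[OF slice_fun.rad_borel[OF S1] slice_fun.rad_borel[OF S2], of "{-l..l}", simplified]
    by (subst (1 2 3 4) nn_integral_layer_cake) 
       (measurable, intro add_mono mult_left_mono nn_integral_mono rad_level_le S1 S2, simp_all)
qed

section \<open>Band estimates on the circle\<close>

text \<open>The piece from a to b is cut off and translated by one period to the other end; a shift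
  by at most one period is enough for this.\<close>

lemma nn_integral_window:
  fixes f :: "real \<Rightarrow> ennreal"
  assumes [measurable]: "f \<in> borel_measurable borel" and per: "\<And>x. f (x + 2 * l) = f x" and ab: "a \<le> b" "b \<le> a + 2 * l"
  shows "(\<integral>\<^sup>+x\<in>{a..a + 2 * l}. f x \<partial>lborel) = (\<integral>\<^sup>+x\<in>{b..b + 2 * l}. f x \<partial>lborel)"
proof -
  have "(\<integral>\<^sup>+x\<in>{a..a + 2 * l}. f x \<partial>lborel) = (\<integral>\<^sup>+x. f x * indicator {b..a + 2 * l} x + f x * indicator {a..<b} x \<partial>lborel)"
    using ab by (intro nn_integral_cong) (auto simp: indicator_def)
  also have "\<dots> = (\<integral>\<^sup>+x\<in>{b..a + 2 * l}. f x \<partial>lborel) + (\<integral>\<^sup>+x\<in>{a..<b}. f x \<partial>lborel)"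
    by (rule nn_integral_add) measurable
  also have "(\<integral>\<^sup>+x\<in>{a..<b}. f x \<partial>lborel) = (\<integral>\<^sup>+x\<in>{a<..b}. f x \<partial>lborel)"
    using AE_lborel_singleton[of a] AE_lborel_singleton[of b]
    by (intro nn_integral_cong_AE) (auto elim!: eventually_elim2 simp: indicator_def)
  also have "\<dots> = (\<integral>\<^sup>+x. f (2 * l + 1 * x) * indicator {a + 2 * l<..b + 2 * l} (2 * l + 1 * x) \<partial>lborel)"
    using per by (intro nn_integral_cong) (auto simp: indicator_def add.commute)
  also have "\<dots> = (\<integral>\<^sup>+x\<in>{a + 2 * l<..b + 2 * l}. f x \<partial>lborel)"
    by (subst nn_integral_real_affine[where c=1 and t="2 * l"]) auto
  also have "(\<integral>\<^sup>+x\<in>{b..a + 2 * l}. f x \<partial>lborel) + \<dots> = (\<integral>\<^sup>+x. f x * indicator {b..a + 2 * l} x + f x * indicator {a + 2 * l<..b + 2 * l} x \<partial>lborel)"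
    by (rule nn_integral_add[symmetric]) measurable
  also have "\<dots> = (\<integral>\<^sup>+x\<in>{b..b + 2 * l}. f x \<partial>lborel)"
    using ab by (intro nn_integral_cong) (auto simp: indicator_def)
  finally show ?thesis .
qed

text \<open>Choose p as the last point of the interval with value at most \<alpha>, then q as the
  first point after p with value at least \<beta>.\<close>

lemma crossing_up:
  fixes g :: "real \<Rightarrow> real"
  assumes c: "continuous_on UNIV g" and x: "x < z" "g x \<le> \<alpha>" "\<beta> \<le> g z" and ab: "\<alpha> < \<beta>"
  shows "\<exists>p q. x \<le> p \<and> p < q \<and> q \<le> z \<and> g p = \<alpha> \<and> g q = \<beta> \<and> (\<forall>y. p < y \<longrightarrow> y < q \<longrightarrow> \<alpha> < g y \<and> g y < \<beta>)"
proof -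
  have cc: "continuous_on S g" for S using c by (rule continuous_on_subset) auto
  have "closed {y. g y \<le> \<alpha>}" by (rule closed_Collect_le[OF c]) auto
  then have "compact ({x..z} \<inter> {y. g y \<le> \<alpha>})" by auto
  then obtain p where p: "p \<in> {x..z}" "g p \<le> \<alpha>" "\<And>y. y \<in> {x..z} \<Longrightarrow> g y \<le> \<alpha> \<Longrightarrow> y \<le> p"
    using compact_attains_sup[of "{x..z} \<inter> {y. g y \<le> \<alpha>}"] x by fastforce
  have gp: "g p = \<alpha>"
  proof -
    obtain y where "p \<le> y" "y \<le> z" "g y = \<alpha>" using IVT'[of g p \<alpha> z] p x ab cc by auto
    then show ?thesis using p(1) p(3)[of y] by auto
  qed
  have "closed {y. \<beta> \<le> g y}" by (rule closed_Collect_le[OF _ c]) auto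
  then have "compact ({p..z} \<inter> {y. \<beta> \<le> g y})" by auto
  then obtain q where q: "q \<in> {p..z}" "\<beta> \<le> g q" "\<And>y. y \<in> {p..z} \<Longrightarrow> \<beta> \<le> g y \<Longrightarrow> q \<le> y"
    using compact_attains_inf[of "{p..z} \<inter> {y. \<beta> \<le> g y}"] x p by fastforce
  have gq: "g q = \<beta>"
  proof -
    obtain y where "p \<le> y" "y \<le> q" "g y = \<beta>" using IVT'[of g p \<beta> q] p q x ab cc by auto
    then show ?thesis using q(1) q(3)[of y] by auto
  qed
  have "p < q" using gp gq ab q(1) by (metis atLeastAtMost_iff less_irrefl order_le_less)
  moreover have "\<alpha> < g y \<and> g y < \<beta>" if "p < y" "y < q" for y
    using p(3)[of y] q(3)[of y] that p(1) q(1) by force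
  ultimately show ?thesis using p(1) q(1) gp gq by (intro exI[of _ p] exI[of _ q]) auto
qed

lemma crossing:
  fixes g :: "real \<Rightarrow> real"
  assumes c: "continuous_on UNIV g" and x: "x \<in> {p..q}" "z \<in> {p..q}" "g x \<le> \<alpha>" "\<beta> \<le> g z" and ab: "\<alpha> < \<beta>"
  shows "\<exists>p' q'. p \<le> p' \<and> p' < q' \<and> q' \<le> q \<and> \<bar>g q' - g p'\<bar> = \<beta> - \<alpha> \<and> (\<forall>y. p' < y \<longrightarrow> y < q' \<longrightarrow> \<alpha> < g y \<and> g y < \<beta>)"
proof (cases "x < z")
  case True
  from crossing_up[OF c this x(3,4) ab] obtain p' q' where
    "x \<le> p'" "p' < q'" "q' \<le> z" "g p' = \<alpha>" "g q' = \<beta>" "\<forall>y. p' < y \<longrightarrow> y < q' \<longrightarrow> \<alpha> < g y \<and> g y < \<beta>" by blast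
  then show ?thesis using x ab by (intro exI[of _ p'] exI[of _ q']) auto
next
  case False
  have "z < x" using False x ab by (metis less_le_trans not_less_iff_gr_or_eq order_less_le_trans)
  moreover have "continuous_on UNIV (\<lambda>y. - g y)" using c by (intro continuous_intros)
  ultimately obtain p' q' where "z \<le> p' \<and> p' < q' \<and> q' \<le> x \<and> - g p' = -\<beta> \<and> - g q' = -\<alpha> \<and> (\<forall>y. p' < y \<longrightarrow> y < q' \<longrightarrow> -\<beta> < - g y \<and> - g y < -\<alpha>)"
    using crossing_up[of "\<lambda>y. - g y" z x "-\<beta>" "-\<alpha>"] x ab by auto
  then show ?thesis using x ab by (intro exI[of _ p'] exI[of _ q']) auto
qed

locale periodic_C1 = slice_fun +
  fixes g' :: "real \<Rightarrow> real"
  assumes der: "\<And>y. (g has_real_derivative g' y) (at y)" and cont': "continuous_on UNIV g'"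
    and per: "\<And>y. g (y + 2 * l) = g y"
begin

lemma g'_borel[measurable]: "g' \<in> borel_measurable borel" using cont' by (rule borel_measurable_continuous_onI)

text \<open>A single crossing of the band suffices: between its ends the fundamental theorem of
  calculus gives the variation, and the values there stay inside the band.\<close>

lemma variation_ge:
  assumes "x \<in> {p..q}" "z \<in> {p..q}" "g x \<le> \<alpha>" "\<beta> \<le> g z"
  shows "ennreal (\<beta> - \<alpha>) \<le> (\<integral>\<^sup>+y\<in>{y\<in>{p<..<q}. \<alpha> < g y \<and> g y < \<beta>}. ennreal \<bar>g' y\<bar> \<partial>lborel)"
proof (cases "\<alpha> < \<beta>")
  case True
  obtain p' q' where pq: "p \<le> p'" "p' < q'" "q' \<le> q" "\<bar>g q' - g p'\<bar> = \<beta> - \<alpha>" "\<And>y. p' < y \<Longrightarrow> y < q' \<Longrightarrow> \<alpha> < g y \<and> g y < \<beta>"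
    using crossing[OF cont assms True] by blast
  have i: "(g' has_integral (g q' - g p')) {p'..q'}"
    using pq der by (intro fundamental_theorem_of_calculus) (auto simp flip: has_real_derivative_iff_has_vector_derivative intro: DERIV_subset)
  have j: "(\<lambda>y. \<bar>g' y\<bar>) integrable_on {p'..q'}"
    by (intro integrable_continuous_interval continuous_intros continuous_on_subset[OF cont']) auto
  have "\<bar>g q' - g p'\<bar> \<le> integral {p'..q'} (\<lambda>y. \<bar>g' y\<bar>)"
    using integral_norm_bound_integral[of g' "{p'..q'}" "\<lambda>y. \<bar>g' y\<bar>"] i j by (auto simp: has_integral_integrable_integral)
  then have "ennreal (\<beta> - \<alpha>) \<le> ennreal (integral {p'..q'} (\<lambda>y. \<bar>g' y\<bar>))" using pq by (simp add: ennreal_leI)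
  also have "\<dots> = (\<integral>\<^sup>+y. ennreal (indicat_real {p'..q'} y * \<bar>g' y\<bar>) \<partial>lborel)"
    using j by (intro nn_integral_has_integral_lebesgue[symmetric]) (auto simp: has_integral_integrable_integral)
  also have "\<dots> \<le> (\<integral>\<^sup>+y\<in>{y\<in>{p<..<q}. \<alpha> < g y \<and> g y < \<beta>}. ennreal \<bar>g' y\<bar> \<partial>lborel)"
    using AE_lborel_singleton[of p'] AE_lborel_singleton[of q'] pq
    by (intro nn_integral_mono_AE) (auto elim!: eventually_elim2 simp: indicator_def)
  finally show ?thesis .
qed (simp add: ennreal_neg)

end

lemma nn_integral_disjoint3:
  fixes f :: "'a \<Rightarrow> ennreal"
  assumes [measurable]: "f \<in> borel_measurable M" "A \<in> sets M" "B \<in> sets M" "C \<in> sets M"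
    and d: "A \<inter> B = {}" "A \<inter> C = {}" "B \<inter> C = {}" "A \<union> B \<union> C \<subseteq> D"
  shows "(\<integral>\<^sup>+y\<in>A. f y \<partial>M) + (\<integral>\<^sup>+y\<in>B. f y \<partial>M) + (\<integral>\<^sup>+y\<in>C. f y \<partial>M) \<le> (\<integral>\<^sup>+y\<in>D. f y \<partial>M)"
proof -
  have "(\<integral>\<^sup>+y\<in>A. f y \<partial>M) + (\<integral>\<^sup>+y\<in>B. f y \<partial>M) + (\<integral>\<^sup>+y\<in>C. f y \<partial>M)
     = (\<integral>\<^sup>+y. f y * indicator A y + f y * indicator B y + f y * indicator C y \<partial>M)"
    by (simp add: nn_integral_add)
  also have "\<dots> \<le> (\<integral>\<^sup>+y\<in>D. f y \<partial>M)"
    using d by (intro nn_integral_mono) (auto simp: indicator_def)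
  finally show ?thesis .
qed

context periodic_C1 begin

lemma per_int: "g (y + 2 * l * of_int k) = g y"
  by (rule periodic_int[of g]) (rule per)

lemma g_circle: "g (circle_rep l y) = g y"
  using circle_rep_eq[of y l] per_int by metis

lemma mem_W: "circle_rep l y \<in> {-l..l}" using abs_circle_rep_le[OF l, of y] by auto

lemma g_le_mx: "g y \<le> mx" and mn_le_g: "mn \<le> g y"
  using le_mx[OF mem_W] mn_le[OF mem_W] by (simp_all add: g_circle)

lemma per': "g' (y + 2 * l) = g' y"
proof -
  have "((\<lambda>x. g (x + 2 * l)) has_real_derivative g' (y + 2 * l)) (at y)"
    using der[of "y + 2 * l"] by (simp add: DERIV_shift)
  then show ?thesis using der[of y] unfolding per by (rule DERIV_unique)
qed

definition band where "band S \<alpha> \<beta> = {y \<in> S. \<alpha> < g y \<and> g y < \<beta>}"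

lemma band_sets[measurable]: "S \<in> sets borel \<Longrightarrow> band S \<alpha> \<beta> \<in> sets borel"
proof -
  assume [measurable]: "S \<in> sets borel"
  have "{y. \<alpha> < g y \<and> g y < \<beta>} \<in> sets borel" by measurable
  moreover have "band S \<alpha> \<beta> = S \<inter> {y. \<alpha> < g y \<and> g y < \<beta>}" by (auto simp: band_def)
  ultimately show ?thesis by auto
qed

lemma band_window:
  assumes [measurable]: "(\<lambda>y. F (g' y)) \<in> borel_measurable borel" and a: "a \<in> {-l..l}"
  shows "(\<integral>\<^sup>+y\<in>band {-l..l} \<alpha> \<beta>. F (g' y) \<partial>lborel) = (\<integral>\<^sup>+y\<in>band {a..a + 2 * l} \<alpha> \<beta>. F (g' y) \<partial>lborel)"
proof -
  let ?f = "\<lambda>y. F (g' y) * indicator {y. \<alpha> < g y \<and> g y < \<beta>} y"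
  have "(\<integral>\<^sup>+x\<in>{-l..-l + 2 * l}. ?f x \<partial>lborel) = (\<integral>\<^sup>+x\<in>{a..a + 2 * l}. ?f x \<partial>lborel)"
    using a l by (intro nn_integral_window) (auto simp: per per' indicator_def)
  moreover have "?f x * indicator S x = F (g' x) * indicator (band S \<alpha> \<beta>) x" for x S
    by (auto simp: band_def indicator_def)
  ultimately show ?thesis by simp
qed

abbreviation penalised where
  "penalised T \<alpha> \<beta> \<omega> \<equiv> (\<integral>\<^sup>+y\<in>band T \<alpha> \<beta>. ennreal ((g' y)\<^sup>2 + \<omega>\<^sup>2) \<partial>lborel)"

text \<open>
  Optimised over \<open>\<omega>\<close>, the inequality says that the energy of the band between two levels times its
  measure is at least \<open>4 * \<rho> ^ 2 * (\<beta> - \<alpha>) ^ 2\<close>. The form with a multiplier \<open>\<omega>\<close> is linear, hence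
  additive over bands. It always holds with \<open>\<rho> = 1\<close>, since every level is crossed on both arcs
  from the maximum to the minimum.
\<close>

definition gain where
  "gain a b \<rho> \<longleftrightarrow> (\<forall>\<alpha> \<beta> \<omega>. a \<le> \<alpha> \<longrightarrow> \<alpha> \<le> \<beta> \<longrightarrow> \<beta> \<le> b \<longrightarrow> 0 \<le> \<omega> \<longrightarrow>
     ennreal (4 * \<rho> * \<omega> * (\<beta> - \<alpha>)) \<le> penalised {-l..l} \<alpha> \<beta> \<omega>)"

text \<open>The pointwise inequality \<open>pt\<close> is integrated over the band and combined with
  the variation of one crossing. By the arithmetic-geometric inequality \<kappa> = 2 is always
  allowed; a larger \<kappa> is possible where the slopes stay away from \<omega>.\<close>

lemma interval_energy:
  assumes xz: "x \<in> {p..q}" "z \<in> {p..q}" "g x \<le> \<alpha>" "\<beta> \<le> g z" and \<omega>: "0 \<le> \<omega>" "0 \<le> \<kappa>"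
    and pt: "\<And>y. p < y \<Longrightarrow> y < q \<Longrightarrow> \<kappa> * \<omega> * \<bar>g' y\<bar> \<le> (g' y)\<^sup>2 + \<omega>\<^sup>2"
  shows "ennreal (\<kappa> * \<omega> * (\<beta> - \<alpha>)) \<le> penalised {p<..<q} \<alpha> \<beta> \<omega>"
proof -
  have "ennreal (\<kappa> * \<omega> * (\<beta> - \<alpha>)) = ennreal (\<kappa> * \<omega>) * ennreal (\<beta> - \<alpha>)"
    using \<omega> by (simp add: ennreal_mult')
  also have "\<dots> \<le> ennreal (\<kappa> * \<omega>) * (\<integral>\<^sup>+y\<in>band {p<..<q} \<alpha> \<beta>. ennreal \<bar>g' y\<bar> \<partial>lborel)"
    unfolding band_def by (intro mult_left_mono variation_ge[OF xz]) simp
  also have "\<dots> = (\<integral>\<^sup>+y. ennreal (\<kappa> * \<omega>) * (ennreal \<bar>g' y\<bar> * indicator (band {p<..<q} \<alpha> \<beta>) y) \<partial>lborel)"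
    by (rule nn_integral_cmult[symmetric]) measurable
  also have "\<dots> \<le> penalised {p<..<q} \<alpha> \<beta> \<omega>"
    using \<omega> pt by (intro nn_integral_mono)
      (auto simp: indicator_def band_def simp del: ennreal_plus simp flip: ennreal_mult' intro!: ennreal_leI)
  finally show ?thesis .
qed

lemma amgm: "2 * \<omega> * \<bar>x::real\<bar> \<le> x\<^sup>2 + \<omega>\<^sup>2"
  using zero_le_power2[of "\<bar>x\<bar> - \<omega>"] by (simp add: power2_diff algebra_simps)

text \<open>The intervals are placed in the period that starts at a, since arcs between extrema may
  wrap around the endpoints of [-l, l]. With only two crossings the third interval is taken empty
  and its constant 0.\<close>

lemma three_intervals:
  assumes a: "a \<in> {-l..l}" and J: "a \<le> p1" "q1 \<le> a + 2 * l" "a \<le> p2" "q2 \<le> a + 2 * l" "a \<le> p3" "q3 \<le> a + 2 * l"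
      "{p1<..<q1} \<inter> {p2<..<q2} = {}" "{p1<..<q1} \<inter> {p3<..<q3} = {}" "{p2<..<q2} \<inter> {p3<..<q3} = {}"
    and k: "0 \<le> k1" "0 \<le> k2" "0 \<le> k3"
    and e: "ennreal k1 \<le> penalised {p1<..<q1} \<alpha> \<beta> \<omega>"
      "ennreal k2 \<le> penalised {p2<..<q2} \<alpha> \<beta> \<omega>"
      "ennreal k3 \<le> penalised {p3<..<q3} \<alpha> \<beta> \<omega>"
  shows "ennreal (k1 + k2 + k3) \<le> penalised {-l..l} \<alpha> \<beta> \<omega>"
proof -
  have "ennreal (k1 + k2 + k3) = ennreal k1 + ennreal k2 + ennreal k3" using k by simp
  also have "\<dots> \<le> penalised {p1<..<q1} \<alpha> \<beta> \<omega>
      + penalised {p2<..<q2} \<alpha> \<beta> \<omega>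
      + penalised {p3<..<q3} \<alpha> \<beta> \<omega>"
    by (intro add_mono e)
  also have "\<dots> \<le> penalised {a..a + 2 * l} \<alpha> \<beta> \<omega>"
    using J by (intro nn_integral_disjoint3) (auto simp: band_def disjoint_iff)
  also have "\<dots> = penalised {-l..l} \<alpha> \<beta> \<omega>"
    using a by (intro band_window[symmetric]) auto
  finally show ?thesis .
qed

lemma min_after_max:
  assumes "a \<in> {-l..l}" "g a = mx"
  obtains p where "p \<in> {a..a + 2 * l}" "g p = mn"
proof -
  obtain y where y: "y \<in> {-l..l}" "g y = mn" by (rule mn_attained)
  show ?thesis
  proof (cases "a \<le> y")
    case True then show ?thesis using y assms l that[of y] by auto
  next
    case False then show ?thesis using y assms l that[of "y + 2 * l"] per by auto
  qed
qed

lemma gain_base: "gain mn mx 1"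
  unfolding gain_def
proof safe
  fix \<alpha> \<beta> \<omega> :: real assume *: "mn \<le> \<alpha>" "\<alpha> \<le> \<beta>" "\<beta> \<le> mx" "0 \<le> \<omega>"
  obtain a where a: "a \<in> {-l..l}" "g a = mx" by (rule mx_attained)
  obtain p where p: "p \<in> {a..a + 2 * l}" "g p = mn" using min_after_max a by blast
  \<comment> \<open>Each of the two arcs contributes 2 by the arithmetic-geometric inequality; this
    is the origin of the constant 4 in \<open>gain\<close>.\<close>
  have "ennreal (2 * \<omega> * (\<beta> - \<alpha>) + 2 * \<omega> * (\<beta> - \<alpha>) + 0) \<le> penalised {-l..l} \<alpha> \<beta> \<omega>"
  proof (rule three_intervals[where a = a and ?p1.0 = a and ?q1.0 = p and ?p2.0 = p and ?q2.0 = "a + 2 * l" and ?p3.0 = a and ?q3.0 = a])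
    show "ennreal (2 * \<omega> * (\<beta> - \<alpha>)) \<le> penalised {a<..<p} \<alpha> \<beta> \<omega>"
      by (rule interval_energy[of p _ _ a]) (use a p * amgm in auto)
    show "ennreal (2 * \<omega> * (\<beta> - \<alpha>)) \<le> penalised {p<..<a+2*l} \<alpha> \<beta> \<omega>"
      by (rule interval_energy[of p _ _ "a + 2 * l"]) (use a p * amgm per in auto)
  qed (use a p l * in auto)
  then show "ennreal (4 * 1 * \<omega> * (\<beta> - \<alpha>)) \<le> penalised {-l..l} \<alpha> \<beta> \<omega>" by (simp add: mult.assoc)
qed

text \<open>Four points with alternating values force three crossings of every band between the
  higher valley and the lower peak. Three times 2 is 4 * (3/2).\<close>

lemma gain_three:
  assumes a: "a \<in> {-l..l}" and J: "a \<le> y0" "y0 \<le> y1" "y1 \<le> y2" "y2 \<le> y3" "y3 \<le> a + 2 * l"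
    and v: "(g y0 \<le> g y1 \<and> g y2 \<le> g y1 \<and> g y2 \<le> g y3 \<and> \<alpha>0 = Max {g y0, g y2} \<and> \<beta>0 = Min {g y1, g y3}) \<or>
      (g y1 \<le> g y0 \<and> g y1 \<le> g y2 \<and> g y3 \<le> g y2 \<and> \<alpha>0 = Max {g y1, g y3} \<and> \<beta>0 = Min {g y0, g y2})"
  shows "gain \<alpha>0 \<beta>0 (3/2)"
  unfolding gain_def
proof safe
  fix \<alpha> \<beta> \<omega> :: real assume *: "\<alpha>0 \<le> \<alpha>" "\<alpha> \<le> \<beta>" "\<beta> \<le> \<beta>0" "0 \<le> \<omega>"
  have "ennreal (2 * \<omega> * (\<beta> - \<alpha>) + 2 * \<omega> * (\<beta> - \<alpha>) + 2 * \<omega> * (\<beta> - \<alpha>)) \<le> penalised {-l..l} \<alpha> \<beta> \<omega>"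
  proof (rule three_intervals[where a = a and ?p1.0 = y0 and ?q1.0 = y1 and ?p2.0 = y1 and ?q2.0 = y2 and ?p3.0 = y2 and ?q3.0 = y3])
    show "ennreal (2 * \<omega> * (\<beta> - \<alpha>)) \<le> penalised {y0<..<y1} \<alpha> \<beta> \<omega>"
      using v J * amgm interval_energy[of y0 y0 y1 y1 \<alpha> \<beta> \<omega> 2] interval_energy[of y1 y0 y1 y0 \<alpha> \<beta> \<omega> 2] by auto
    show "ennreal (2 * \<omega> * (\<beta> - \<alpha>)) \<le> penalised {y1<..<y2} \<alpha> \<beta> \<omega>"
      using v J * amgm interval_energy[of y1 y1 y2 y2 \<alpha> \<beta> \<omega> 2] interval_energy[of y2 y1 y2 y1 \<alpha> \<beta> \<omega> 2] by auto
    show "ennreal (2 * \<omega> * (\<beta> - \<alpha>)) \<le> penalised {y2<..<y3} \<alpha> \<beta> \<omega>"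
      using v J * amgm interval_energy[of y2 y2 y3 y3 \<alpha> \<beta> \<omega> 2] interval_energy[of y3 y2 y3 y2 \<alpha> \<beta> \<omega> 2] by auto
  qed (use a J * in auto)
  then show "ennreal (4 * (3/2) * \<omega> * (\<beta> - \<alpha>)) \<le> penalised {-l..l} \<alpha> \<beta> \<omega>" by (simp add: mult.assoc)
qed

end

text \<open>The number \<omega> lies on one side of the midpoint c of c1 and c2, hence is separated
  by a fixed ratio from all speeds below c1 or from all speeds above c2, and then the
  arithmetic-geometric inequality is strict by a fixed amount. The constant \<kappa> is independent
  of \<omega>; only the alternative depends on it.\<close>

lemma speed_gap:
  fixes c1 c2 :: real
  assumes "0 < c1" "c1 < c2"
  obtains \<kappa> where "\<kappa> > 0"
    "\<And>\<omega>. 0 \<le> \<omega> \<Longrightarrow> (\<forall>x. 0 \<le> x \<longrightarrow> x \<le> c1 \<longrightarrow> (2 + \<kappa>) * \<omega> * x \<le> x\<^sup>2 + \<omega>\<^sup>2) \<or> (\<forall>x. c2 \<le> x \<longrightarrow> (2 + \<kappa>) * \<omega> * x \<le> x\<^sup>2 + \<omega>\<^sup>2)"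
proof -
  define c where "c = (c1 + c2) / 2"
  define t where "t = min (1 - c1 / c) (1 - c / c2)"
  have c: "c1 < c" "c < c2" "0 < c" using assms by (auto simp: c_def)
  have t: "0 < t" "t \<le> 1 - c1 / c" "t \<le> 1 - c / c2" using c assms by (auto simp: t_def)
  have c': "c1 \<le> (1 - t) * c" "c \<le> (1 - t) * c2" "t < 1"
  proof -
    show "c1 \<le> (1 - t) * c" using t(2) c by (simp add: field_simps)
    show "c \<le> (1 - t) * c2" using t(3) c assms by (simp add: field_simps)
    have "0 < c1 / c" using c assms by simp
    then show "t < 1" using t(2) by linarith
  qed
  \<comment> \<open>A relative gap t gives (hi - lo)^2 \<ge> t^2 hi^2 \<ge> t^2 lo hi, which is
    where the choice \<kappa> = t^2 comes from.\<close>
  have key: "(2 + t\<^sup>2) * lo * hi \<le> lo\<^sup>2 + hi\<^sup>2" if "0 \<le> lo" "lo \<le> (1 - t) * hi" "0 \<le> hi" for lo hi :: real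
  proof -
    have "lo \<le> hi" using that t c' by (smt (verit) mult_left_le_one_le)
    have "t * hi \<le> hi - lo" using that by (simp add: algebra_simps)
    then have "(t * hi)\<^sup>2 \<le> (hi - lo)\<^sup>2" using that t by (intro power_mono) auto
    moreover have "t\<^sup>2 * (lo * hi) \<le> t\<^sup>2 * (hi * hi)" using \<open>lo \<le> hi\<close> that by (intro mult_left_mono mult_right_mono) auto
    ultimately show ?thesis by (simp add: power2_eq_square algebra_simps)
  qed
  show ?thesis
  proof (rule that[of "t\<^sup>2"])
    show "0 < t\<^sup>2" using t by simp
    fix \<omega> :: real assume \<omega>: "0 \<le> \<omega>"
    show "(\<forall>x. 0 \<le> x \<longrightarrow> x \<le> c1 \<longrightarrow> (2 + t\<^sup>2) * \<omega> * x \<le> x\<^sup>2 + \<omega>\<^sup>2) \<or> (\<forall>x. c2 \<le> x \<longrightarrow> (2 + t\<^sup>2) * \<omega> * x \<le> x\<^sup>2 + \<omega>\<^sup>2)"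
    proof (cases "c \<le> \<omega>")
      case True
      then have "(1 - t) * c \<le> (1 - t) * \<omega>" using c' by (intro mult_left_mono) auto
      have "(2 + t\<^sup>2) * \<omega> * x \<le> x\<^sup>2 + \<omega>\<^sup>2" if "0 \<le> x" "x \<le> c1" for x
      proof -
        have "x \<le> (1 - t) * \<omega>" using that c' \<open>(1 - t) * c \<le> (1 - t) * \<omega>\<close> by linarith
        from key[OF that(1) this \<omega>] show ?thesis by (simp add: mult_ac)
      qed
      then show ?thesis by blast
    next
      case False
      have "(2 + t\<^sup>2) * \<omega> * x \<le> \<omega>\<^sup>2 + x\<^sup>2" if "c2 \<le> x" for x
      proof (rule key)
        have "(1 - t) * c2 \<le> (1 - t) * x" using that c' by (intro mult_left_mono) auto
        then show "\<omega> \<le> (1 - t) * x" using False c' by linarith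
      qed (use \<omega> that c in auto)
      then show ?thesis by (simp add: add.commute)
    qed
  qed
qed

lemma finite_pos_lower_bound:
  fixes A :: "real set"
  assumes "finite A" "\<forall>x\<in>A. 0 < x"
  shows "\<exists>e>0. \<forall>x\<in>A. e \<le> x"
  using assms
proof (induction A)
  case (insert x A)
  then obtain e where "e > 0" "\<forall>x\<in>A. e \<le> x" by auto
  then show ?case using insert.prems by (intro exI[of _ "min e x"]) auto
qed (auto intro: exI[of _ 1])

context periodic_C1 begin

text \<open>Near y1 all speeds are below c1 and near y2 all are above c2, and both neighbourhoods
  cross a common band next to the level g y1. By \<open>speed_gap\<close> one of the two crossings
  gains \<kappa>, whatever \<omega> is. The condition \<open>nc\<close> is there because g' may
  vanish at y1, so that a crossing near y1 is not automatic.\<close>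

lemma gain_mismatch:
  assumes a: "a \<in> {-l..l}" and y1: "y1 \<in> {a<..<a + 2 * l}" and y2: "y2 \<in> {a<..<a + 2 * l}"
    and eq: "g y1 = g y2" and lt: "\<bar>g' y1\<bar> < \<bar>g' y2\<bar>"
    and nc: "\<And>e. e > 0 \<Longrightarrow> \<exists>y. \<bar>y - y1\<bar> < e \<and> g y \<noteq> g y1"
  shows "\<exists>\<alpha> \<beta> \<rho>. mn \<le> \<alpha> \<and> \<alpha> < \<beta> \<and> \<beta> \<le> mx \<and> 1 < \<rho> \<and> gain \<alpha> \<beta> \<rho>"
proof -
  \<comment> \<open>Points at one and two thirds between the slopes, so that all inequalities are
    strict and c1 > 0 even if g' vanishes at y1.\<close>
  define c1 where "c1 = (2 * \<bar>g' y1\<bar> + \<bar>g' y2\<bar>) / 3"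
  define c2 where "c2 = (\<bar>g' y1\<bar> + 2 * \<bar>g' y2\<bar>) / 3"
  have c: "0 < c1" "c1 < c2" "\<bar>g' y1\<bar> < c1" "c2 < \<bar>g' y2\<bar>" using lt by (auto simp: c1_def c2_def)
  obtain \<kappa> where \<kappa>: "\<kappa> > 0" "\<And>\<omega>. 0 \<le> \<omega> \<Longrightarrow> (\<forall>x. 0 \<le> x \<longrightarrow> x \<le> c1 \<longrightarrow> (2 + \<kappa>) * \<omega> * x \<le> x\<^sup>2 + \<omega>\<^sup>2) \<or> (\<forall>x. c2 \<le> x \<longrightarrow> (2 + \<kappa>) * \<omega> * x \<le> x\<^sup>2 + \<omega>\<^sup>2)"
    using speed_gap[OF c(1,2)] by blast
  have "y1 \<noteq> y2" using lt by auto
  have "open {y. \<bar>g' y\<bar> < c1}" "open {y. c2 < \<bar>g' y\<bar>}"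
    by (intro open_Collect_less continuous_intros cont')+
  then obtain e1 e2 where e: "e1 > 0" "ball y1 e1 \<subseteq> {y. \<bar>g' y\<bar> < c1}" "e2 > 0" "ball y2 e2 \<subseteq> {y. c2 < \<bar>g' y\<bar>}"
    using c by (metis mem_Collect_eq openE)
  have "\<forall>x\<in>{e1, e2, \<bar>y1 - y2\<bar> / 2, y1 - a, a + 2 * l - y1, y2 - a, a + 2 * l - y2}. 0 < x"
    using e(1,3) \<open>y1 \<noteq> y2\<close> y1 y2 by simp
  from finite_pos_lower_bound[OF _ this] obtain e where e0: "e > 0" and
    "\<forall>x\<in>{e1, e2, \<bar>y1 - y2\<bar> / 2, y1 - a, a + 2 * l - y1, y2 - a, a + 2 * l - y2}. e \<le> x"
    by blast
  then have el: "e \<le> e1" "e \<le> e2" "e \<le> \<bar>y1 - y2\<bar> / 2" "e \<le> y1 - a" "e \<le> a + 2 * l - y1" "e \<le> y2 - a" "e \<le> a + 2 * l - y2"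
    by blast+
  have s1: "\<bar>g' y\<bar> < c1" if "\<bar>y - y1\<bar> < e" for y
    using subsetD[OF e(2), of y] that el(1) by (simp add: dist_real_def abs_minus_commute)
  have s2: "c2 < \<bar>g' y\<bar>" if "\<bar>y - y2\<bar> < e" for y
    using subsetD[OF e(4), of y] that el(2) by (simp add: dist_real_def abs_minus_commute)
  obtain y where y: "\<bar>y - y1\<bar> < e" "g y \<noteq> g y1" using nc[OF e0] by blast
  have up: "\<exists>z. \<bar>z - y2\<bar> < e \<and> g y2 < g z" and down: "\<exists>z. \<bar>z - y2\<bar> < e \<and> g z < g y2"
  proof -
    have "g' y2 > 0 \<or> g' y2 < 0" using lt by auto
    then have "(\<exists>z. \<bar>z - y2\<bar> < e \<and> g y2 < g z) \<and> (\<exists>z. \<bar>z - y2\<bar> < e \<and> g z < g y2)"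
    proof
      assume p: "g' y2 > 0"
      obtain d where d: "d > 0" "\<And>h. 0 < h \<Longrightarrow> h < d \<Longrightarrow> g y2 < g (y2 + h)" using DERIV_pos_inc_right[OF der p] by blast
      obtain d' where d': "d' > 0" "\<And>h. 0 < h \<Longrightarrow> h < d' \<Longrightarrow> g (y2 - h) < g y2" using DERIV_pos_inc_left[OF der p] by blast
      show ?thesis using d(2)[of "min d e / 2"] d'(2)[of "min d' e / 2"] d d' e0
        by (intro conjI exI[of _ "y2 + min d e / 2"] exI[of _ "y2 - min d' e / 2"]) auto
    next
      assume p: "g' y2 < 0"
      obtain d where d: "d > 0" "\<And>h. 0 < h \<Longrightarrow> h < d \<Longrightarrow> g y2 > g (y2 + h)" using DERIV_neg_dec_right[OF der p] by blast
      obtain d' where d': "d' > 0" "\<And>h. 0 < h \<Longrightarrow> h < d' \<Longrightarrow> g (y2 - h) > g y2" using DERIV_neg_dec_left[OF der p] by blast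
      show ?thesis using d(2)[of "min d e / 2"] d'(2)[of "min d' e / 2"] d d' e0
        by (intro conjI exI[of _ "y2 + min d e / 2"] exI[of _ "y2 - min d' e / 2"]) auto
    qed
    then show "\<exists>z. \<bar>z - y2\<bar> < e \<and> g y2 < g z" "\<exists>z. \<bar>z - y2\<bar> < e \<and> g z < g y2" by auto
  qed
  \<comment> \<open>The nonzero slope at y2 yields values on both sides of the common level, so y2
    can follow whichever side g takes near y1.\<close>
  obtain \<alpha>0 \<beta>0 x1 z1 x2 z2 where ab: "\<alpha>0 < \<beta>0" "\<bar>x1 - y1\<bar> < e" "\<bar>z1 - y1\<bar> < e" "\<bar>x2 - y2\<bar> < e" "\<bar>z2 - y2\<bar> < e"
    "g x1 \<le> \<alpha>0" "\<beta>0 \<le> g z1" "g x2 \<le> \<alpha>0" "\<beta>0 \<le> g z2" "mn \<le> \<alpha>0" "\<beta>0 \<le> mx"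
  proof (cases "g y1 < g y")
    case True
    obtain z where z: "\<bar>z - y2\<bar> < e" "g y2 < g z" using up by blast
    show ?thesis by (rule that[of "g y1" "min (g y) (g z)" y1 y y2 z]) (use True y z e0 eq mn_le_g[of y2] g_le_mx[of z] in linarith)+
  next
    case False
    obtain z where z: "\<bar>z - y2\<bar> < e" "g z < g y2" using down by blast
    show ?thesis by (rule that[of "max (g y) (g z)" "g y1" y y1 z y2]) (use False y z e0 eq mn_le_g[of z] g_le_mx[of y2] in linarith)+
  qed
  have "gain \<alpha>0 \<beta>0 (1 + \<kappa> / 4)"
    unfolding gain_def
  proof safe
    fix \<alpha> \<beta> \<omega> :: real assume *: "\<alpha>0 \<le> \<alpha>" "\<alpha> \<le> \<beta>" "\<beta> \<le> \<beta>0" "0 \<le> \<omega>"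
    have I1: "ennreal (k * \<omega> * (\<beta> - \<alpha>)) \<le> penalised {y1 - e<..<y1 + e} \<alpha> \<beta> \<omega>"
      if "0 \<le> k" "\<And>x. 0 \<le> x \<Longrightarrow> x \<le> c1 \<Longrightarrow> k * \<omega> * x \<le> x\<^sup>2 + \<omega>\<^sup>2" for k
    proof (rule interval_energy[of x1 _ _ z1])
      fix y assume "y1 - e < y" "y < y1 + e"
      then have "k * \<omega> * \<bar>g' y\<bar> \<le> \<bar>g' y\<bar>\<^sup>2 + \<omega>\<^sup>2" by (intro that(2)[OF abs_ge_zero less_imp_le[OF s1]]) linarith
      then show "k * \<omega> * \<bar>g' y\<bar> \<le> (g' y)\<^sup>2 + \<omega>\<^sup>2 " by simp
    qed (use ab * that in auto)
    have I2: "ennreal (k * \<omega> * (\<beta> - \<alpha>)) \<le> penalised {y2 - e<..<y2 + e} \<alpha> \<beta> \<omega>"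
      if "0 \<le> k" "\<And>x. c2 \<le> x \<Longrightarrow> k * \<omega> * x \<le> x\<^sup>2 + \<omega>\<^sup>2" for k
    proof (rule interval_energy[of x2 _ _ z2])
      fix y assume "y2 - e < y" "y < y2 + e"
      then have "k * \<omega> * \<bar>g' y\<bar> \<le> \<bar>g' y\<bar>\<^sup>2 + \<omega>\<^sup>2" by (intro that(2)[OF less_imp_le[OF s2]]) linarith
      then show "k * \<omega> * \<bar>g' y\<bar> \<le> (g' y)\<^sup>2 + \<omega>\<^sup>2 " by simp
    qed (use ab * that in auto)
    \<comment> \<open>The neighbourhood that receives 2 + \<kappa> depends on \<omega>, but the sum
      4 + \<kappa> does not; hence \<rho> = 1 + \<kappa>/4.\<close>
    obtain k1 k2 where k: "0 \<le> k1" "0 \<le> k2" "k1 + k2 = 4 + \<kappa>" "\<And>x. 0 \<le> x \<Longrightarrow> x \<le> c1 \<Longrightarrow> k1 * \<omega> * x \<le> x\<^sup>2 + \<omega>\<^sup>2"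
      "\<And>x. c2 \<le> x \<Longrightarrow> k2 * \<omega> * x \<le> x\<^sup>2 + \<omega>\<^sup>2"
    proof -
      have am: "2 * \<omega> * x \<le> x\<^sup>2 + \<omega>\<^sup>2" for x using zero_le_power2[of "x - \<omega>"] by (simp add: power2_diff algebra_simps)
      from \<kappa>(2)[OF *(4)] show ?thesis
      proof
        assume H: "\<forall>x. 0 \<le> x \<longrightarrow> x \<le> c1 \<longrightarrow> (2 + \<kappa>) * \<omega> * x \<le> x\<^sup>2 + \<omega>\<^sup>2"
        show ?thesis by (rule that[of "2 + \<kappa>" 2]) (use \<kappa>(1) H am in simp_all)
      next
        assume H: "\<forall>x. c2 \<le> x \<longrightarrow> (2 + \<kappa>) * \<omega> * x \<le> x\<^sup>2 + \<omega>\<^sup>2"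
        show ?thesis by (rule that[of 2 "2 + \<kappa>"]) (use \<kappa>(1) H am in simp_all)
      qed
    qed
    have "ennreal (k1 * \<omega> * (\<beta> - \<alpha>) + k2 * \<omega> * (\<beta> - \<alpha>) + 0) \<le> penalised {-l..l} \<alpha> \<beta> \<omega>"
    proof (rule three_intervals[OF a _ _ _ _ _ _ _ _ _ _ _ _ I1[OF k(1,4)] I2[OF k(2,5)]])
      show "{y1 - e<..<y1 + e} \<inter> {y2 - e<..<y2 + e} = {}" using el(3) by (fastforce simp: disjoint_iff)
      show "{y1 - e<..<y1 + e} \<inter> {a<..<a} = {}" "{y2 - e<..<y2 + e} \<inter> {a<..<a} = {}" by auto
      show "a \<le> y1 - e" "y1 + e \<le> a + 2 * l" "a \<le> y2 - e" "y2 + e \<le> a + 2 * l" using el by linarith+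
      show "a \<le> a" "a \<le> a + 2 * l" using l by auto
      show "0 \<le> k1 * \<omega> * (\<beta> - \<alpha>)" "0 \<le> k2 * \<omega> * (\<beta> - \<alpha>)" "0 \<le> (0::real)" using * k by auto
    qed auto
    also have "k1 * \<omega> * (\<beta> - \<alpha>) + k2 * \<omega> * (\<beta> - \<alpha>) + 0 = (k1 + k2) * \<omega> * (\<beta> - \<alpha>)" by (simp add: algebra_simps)
    finally show "ennreal (4 * (1 + \<kappa> / 4) * \<omega> * (\<beta> - \<alpha>)) \<le> penalised {-l..l} \<alpha> \<beta> \<omega>"
      unfolding k(3) by (simp add: algebra_simps)
  qed
  then show ?thesis using ab \<kappa>(1) by (intro exI[of _ \<alpha>0] exI[of _ \<beta>0] exI[of _ "1 + \<kappa> / 4"]) auto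
qed

end

section \<open>From gains on bands to the energy of the rearranged slice\<close>

context periodic_C1 begin

lemma gainD:
  assumes "gain a b \<rho>" "a \<le> \<alpha>" "\<alpha> \<le> \<beta>" "\<beta> \<le> b" "0 \<le> \<omega>"
  shows "ennreal (4 * \<rho> * \<omega> * (\<beta> - \<alpha>)) \<le> penalised {-l..l} \<alpha> \<beta> \<omega>"
  using assms unfolding gain_def by blast

text \<open>The band is cut into the parts below, inside and above [a, b], and only the middle part
  has the better factor. Clamping both ends to [a, b] measures that part and gives 0 when the band
  does not meet it.\<close>

lemma gain_split:
  assumes G: "gain a b \<rho>" and ab: "mn \<le> a" "a \<le> b" "b \<le> mx" and r: "1 \<le> \<rho>"
    and t: "mn \<le> \<alpha>" "\<alpha> \<le> \<beta>" "\<beta> \<le> mx" and om: "0 \<le> \<omega>"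
  shows "ennreal (4 * \<omega> * (\<beta> - \<alpha>) + 4 * (\<rho> - 1) * \<omega> * (min b (max a \<beta>) - min b (max a \<alpha>)))
    \<le> penalised {-l..l} \<alpha> \<beta> \<omega>"
proof -
  define p where "p = max \<alpha> (min \<beta> a)"
  define q where "q = max \<alpha> (min \<beta> b)"
  have pq: "\<alpha> \<le> p" "p \<le> q" "q \<le> \<beta>" using t ab by (auto simp: p_def q_def)
  have d: "q - p = min b (max a \<beta>) - min b (max a \<alpha>)" using t ab by (auto simp: p_def q_def min_def max_def)
  have "ennreal (4 * 1 * \<omega> * (p - \<alpha>)) \<le> penalised {-l..l} \<alpha> p \<omega>"
    using pq t om by (intro gainD[OF gain_base]) auto
  moreover have "ennreal (4 * 1 * \<omega> * (\<beta> - q)) \<le> penalised {-l..l} q \<beta> \<omega>"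
    using pq t om by (intro gainD[OF gain_base]) auto
  moreover have "ennreal (4 * \<rho> * \<omega> * (q - p)) \<le> penalised {-l..l} p q \<omega>"
  proof (cases "p < q")
    case True
    then have "a \<le> p" "q \<le> b" using t ab by (auto simp: p_def q_def min_def max_def split: if_splits)
    then show ?thesis using pq om by (intro gainD[OF G]) auto
  qed (use pq in auto)
  ultimately have "ennreal (4 * 1 * \<omega> * (p - \<alpha>)) + ennreal (4 * \<rho> * \<omega> * (q - p)) + ennreal (4 * 1 * \<omega> * (\<beta> - q))
    \<le> penalised {-l..l} \<alpha> p \<omega> + penalised {-l..l} p q \<omega>
     + penalised {-l..l} q \<beta> \<omega>" by (intro add_mono)
  also have "\<dots> \<le> penalised {-l..l} \<alpha> \<beta> \<omega>"
    using pq by (intro nn_integral_disjoint3) (auto simp: band_def)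
  also have "ennreal (4 * 1 * \<omega> * (p - \<alpha>)) + ennreal (4 * \<rho> * \<omega> * (q - p)) + ennreal (4 * 1 * \<omega> * (\<beta> - q))
    = ennreal (4 * \<omega> * (p - \<alpha>) + 4 * \<rho> * \<omega> * (q - p) + 4 * \<omega> * (\<beta> - q))"
    using pq r om by simp
  also have "4 * \<omega> * (p - \<alpha>) + 4 * \<rho> * \<omega> * (q - p) + 4 * \<omega> * (\<beta> - q) = 4 * \<omega> * (\<beta> - \<alpha>) + 4 * (\<rho> - 1) * \<omega> * (q - p)"
    by (simp add: algebra_simps)
  finally show ?thesis unfolding d .
qed

text \<open>With d the length of the part of the band inside [a, b], the multiplier form gives the
  surplus 8 (\<rho> - 1) d (\<beta> - \<alpha>) / w. It is weakened to d^2 so that Cauchy-Schwarz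
  can be applied to the sum over all bands.\<close>

lemma band_energy:
  assumes G: "gain a b \<rho>" and ab: "mn \<le> a" "a \<le> b" "b \<le> mx" and r: "1 \<le> \<rho>"
    and t: "mn \<le> \<alpha>" "\<alpha> \<le> \<beta>" "\<beta> \<le> mx" and w: "0 < w" "emeasure lborel (band {-l..l} \<alpha> \<beta>) \<le> ennreal w"
  shows "ennreal (4 * (\<beta> - \<alpha>)\<^sup>2 / w + 8 * (\<rho> - 1) * (min b (max a \<beta>) - min b (max a \<alpha>))\<^sup>2 / w)
    \<le> (\<integral>\<^sup>+y\<in>band {-l..l} \<alpha> \<beta>. ennreal ((g' y)\<^sup>2) \<partial>lborel)" (is "_ \<le> ?e")
proof -
  \<comment> \<open>The maximiser of 4 \<omega> (\<beta> - \<alpha>) - \<omega>^2 w.\<close>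
  define \<omega> where "\<omega> = 2 * (\<beta> - \<alpha>) / w"
  define d where "d = min b (max a \<beta>) - min b (max a \<alpha>)"
  have om: "0 \<le> \<omega>" using t w by (simp add: \<omega>_def)
  have d: "0 \<le> d" "d \<le> \<beta> - \<alpha>" using t ab by (auto simp: d_def min_def max_def)
  have "ennreal (4 * \<omega> * (\<beta> - \<alpha>) + 4 * (\<rho> - 1) * \<omega> * d)
    \<le> penalised {-l..l} \<alpha> \<beta> \<omega>"
    unfolding d_def by (rule gain_split[OF G ab r t om])
  also have "\<dots> = (\<integral>\<^sup>+y. ennreal ((g' y)\<^sup>2) * indicator (band {-l..l} \<alpha> \<beta>) y + ennreal (\<omega>\<^sup>2) * indicator (band {-l..l} \<alpha> \<beta>) y \<partial>lborel)"
    by (intro nn_integral_cong) (auto simp: indicator_def)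
  also have "\<dots> = ?e + (\<integral>\<^sup>+y. ennreal (\<omega>\<^sup>2) * indicator (band {-l..l} \<alpha> \<beta>) y \<partial>lborel)"
    by (rule nn_integral_add) measurable
  also have "(\<integral>\<^sup>+y. ennreal (\<omega>\<^sup>2) * indicator (band {-l..l} \<alpha> \<beta>) y \<partial>lborel) = ennreal (\<omega>\<^sup>2) * emeasure lborel (band {-l..l} \<alpha> \<beta>)"
    by (rule nn_integral_cmult_indicator) simp
  also have "\<dots> \<le> ennreal (\<omega>\<^sup>2) * ennreal w" by (intro mult_left_mono w) simp
  also have "\<dots> = ennreal (\<omega>\<^sup>2 * w)" using w by (simp add: ennreal_mult')
  finally have *: "ennreal (4 * \<omega> * (\<beta> - \<alpha>) + 4 * (\<rho> - 1) * \<omega> * d) \<le> ?e + ennreal (\<omega>\<^sup>2 * w)" by (simp add: add_left_mono)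
  have "4 * (\<beta> - \<alpha>)\<^sup>2 / w + 8 * (\<rho> - 1) * d\<^sup>2 / w \<le> 4 * \<omega> * (\<beta> - \<alpha>) + 4 * (\<rho> - 1) * \<omega> * d - \<omega>\<^sup>2 * w"
  proof -
    have "4 * \<omega> * (\<beta> - \<alpha>) + 4 * (\<rho> - 1) * \<omega> * d - \<omega>\<^sup>2 * w = 4 * (\<beta> - \<alpha>)\<^sup>2 / w + 8 * (\<rho> - 1) * (d * (\<beta> - \<alpha>)) / w"
      using w by (simp add: \<omega>_def field_simps power2_eq_square)
    moreover have "8 * (\<rho> - 1) * (d * d) / w \<le> 8 * (\<rho> - 1) * (d * (\<beta> - \<alpha>)) / w"
      using d r w by (intro divide_right_mono mult_left_mono) auto
    ultimately show ?thesis by (simp add: power2_eq_square)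
  qed
  then have "ennreal (4 * (\<beta> - \<alpha>)\<^sup>2 / w + 8 * (\<rho> - 1) * d\<^sup>2 / w)
    \<le> ennreal (4 * \<omega> * (\<beta> - \<alpha>) + 4 * (\<rho> - 1) * \<omega> * d - \<omega>\<^sup>2 * w)" by (rule ennreal_leI)
  also have "\<dots> = ennreal (4 * \<omega> * (\<beta> - \<alpha>) + 4 * (\<rho> - 1) * \<omega> * d) - ennreal (\<omega>\<^sup>2 * w)"
    using w by (simp add: ennreal_minus)
  also have "\<dots> \<le> ?e" using * by (simp add: ennreal_minus_le_iff add.commute)
  finally show ?thesis unfolding d_def .
qed

text \<open>The strict band is {g > rad s} without {g \<ge> rad r}. Its measure is bounded by 2s -
  2r through \<open>mu_rad_le\<close> and \<open>measure_ge_rad\<close>, so plateaus at the two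
  levels do no harm.\<close>

lemma band_rad_emeasure:
  assumes rs: "0 \<le> r" "r \<le> s" "s \<le> l"
  shows "emeasure lborel (band {-l..l} (rad l g s) (rad l g r)) \<le> ennreal (2 * (s - r))"
proof -
  let ?A = "{z \<in> {-l..l}. rad l g s < g z}" and ?B = "{z \<in> {-l..l}. rad l g r \<le> g z}"
  have fB: "band {-l..l} (rad l g s) (rad l g r) \<in> fmeasurable lborel"
    by (rule fmeasurableI2[OF superlevel_fmeasurable(1)[of "rad l g s"]]) (auto simp: band_def)
  show ?thesis
  proof (cases "rad l g s < rad l g r")
    case True
    have eq: "band {-l..l} (rad l g s) (rad l g r) = ?A - ?B" by (auto simp: band_def)
    have "emeasure lborel ?A \<noteq> \<infinity>" using superlevel_fmeasurable(1)[of "rad l g s"] unfolding fmeasurable_def by auto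
    then have "measure lborel (?A - ?B) = measure lborel ?A - measure lborel ?B"
      using superlevel_fmeasurable True by (intro measure_Diff) (auto dest: fmeasurableD)
    also have "\<dots> \<le> 2 * s - 2 * r"
      using mu_rad_le[of s] measure_ge_rad[of r] rs unfolding mu_lborel by auto
    finally have "measure lborel (band {-l..l} (rad l g s) (rad l g r)) \<le> 2 * (s - r)" unfolding eq by simp
    then show ?thesis unfolding emeasure_eq_measure2[OF fB] by (rule ennreal_leI)
  next
    case False
    then have "band {-l..l} (rad l g s) (rad l g r) = {}" by (auto simp: band_def)
    then show ?thesis by simp
  qed
qed

text \<open>The sum is the energy of the even piecewise linear interpolation of \<open>rad\<close>
  at the nodes j l / n. Its increments are the heights of disjoint bands, each of measure at most
  2l/n, to which \<open>band_energy\<close> applies.\<close>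

lemma partition_energy:
  assumes G: "gain a b \<rho>" and ab: "mn \<le> a" "a \<le> b" "b \<le> mx" and r: "1 \<le> \<rho>" and n: "n > 0"
  shows "ennreal (\<Sum>j<n. (rad l g (real j * l / n) - rad l g (real (Suc j) * l / n))\<^sup>2 * (2 * real n / l)) + ennreal (4 * (\<rho> - 1) * (b - a)\<^sup>2 / l)
    \<le> (\<integral>\<^sup>+y\<in>{-l..l}. ennreal ((g' y)\<^sup>2) \<partial>lborel)"
proof -
  define t where "t j = rad l g (real j * l / n)" for j
  define w where "w = 2 * l / n"
  define \<phi> where "\<phi> x = min b (max a x)" for x
  let ?A = "\<lambda>j. band {-l..l} (t (Suc j)) (t j)"
  have w: "w > 0" using l n by (simp add: w_def)
  have sl: "real j * l / n \<le> l" if "j \<le> n" for j using that n l by (simp add: field_simps)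
  have tm: "t k \<le> t j" if "j \<le> k" "k \<le> n" for j k
    unfolding t_def using that sl n l by (intro rad_antimono) (auto simp: divide_right_mono mult_right_mono)
  have tb: "mn \<le> t j" "t j \<le> mx" if "j \<le> n" for j
    unfolding t_def using sl[OF that] by (auto intro: mn_le_rad rad_le_mx)
  have t0: "t 0 = mx" "t n = mn" using rad_0 rad_l n by (auto simp: t_def)
  have e: "ennreal (4 * (t j - t (Suc j))\<^sup>2 / w + 8 * (\<rho> - 1) * (\<phi> (t j) - \<phi> (t (Suc j)))\<^sup>2 / w)
    \<le> (\<integral>\<^sup>+y\<in>?A j. ennreal ((g' y)\<^sup>2) \<partial>lborel)" if "j < n" for j
    unfolding \<phi>_def
  proof (rule band_energy[OF G ab r])
    have "emeasure lborel (?A j) \<le> ennreal (2 * (real (Suc j) * l / n - real j * l / n))"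
      unfolding t_def using that l sl[of "Suc j"] by (intro band_rad_emeasure) (auto simp: field_simps)
    also have "2 * (real (Suc j) * l / n - real j * l / n) = w" using n by (simp add: w_def add_divide_distrib distrib_right distrib_left)
    finally show "emeasure lborel (?A j) \<le> ennreal w" .
  qed (use w tb tm that in auto)
  have "(\<Sum>j<n. \<phi> (t j) - \<phi> (t (Suc j))) = \<phi> (t 0) - \<phi> (t n)" by (rule sum_lessThan_telescope')
  also have "\<dots> = b - a" using t0 ab by (auto simp: \<phi>_def)
  finally have s: "(\<Sum>j<n. \<phi> (t j) - \<phi> (t (Suc j))) = b - a" .
  \<comment> \<open>Cauchy-Schwarz for the telescoping sum. The factor n cancels against the band
    width 2l/n, so the surplus does not depend on n.\<close>
  have "(b - a)\<^sup>2 \<le> (\<Sum>j<n. (\<phi> (t j) - \<phi> (t (Suc j)))\<^sup>2) * n"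
    using sum_squared_le_sum_of_squares[of "\<lambda>j. \<phi> (t j) - \<phi> (t (Suc j))" "{..<n}"] unfolding s by simp
  then have "4 * (\<rho> - 1) * (b - a)\<^sup>2 / l \<le> 4 * (\<rho> - 1) * ((\<Sum>j<n. (\<phi> (t j) - \<phi> (t (Suc j)))\<^sup>2) * n) / l"
    using r l by (intro divide_right_mono mult_left_mono) auto
  also have "\<dots> = 8 * (\<rho> - 1) / w * (\<Sum>j<n. (\<phi> (t j) - \<phi> (t (Suc j)))\<^sup>2)"
    using l n by (simp add: w_def divide_simps)
  also have "\<dots> = (\<Sum>j<n. 8 * (\<rho> - 1) * (\<phi> (t j) - \<phi> (t (Suc j)))\<^sup>2 / w)"
    by (simp add: sum_distrib_left)
  finally have g2: "4 * (\<rho> - 1) * (b - a)\<^sup>2 / l \<le> (\<Sum>j<n. 8 * (\<rho> - 1) * (\<phi> (t j) - \<phi> (t (Suc j)))\<^sup>2 / w)" .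
  have "ennreal (\<Sum>j<n. (t j - t (Suc j))\<^sup>2 * (2 * real n / l)) + ennreal (4 * (\<rho> - 1) * (b - a)\<^sup>2 / l)
     = ennreal ((\<Sum>j<n. (t j - t (Suc j))\<^sup>2 * (2 * real n / l)) + 4 * (\<rho> - 1) * (b - a)\<^sup>2 / l)"
    using r l by (intro ennreal_plus[symmetric]) (auto intro!: sum_nonneg)
  also have "\<dots> \<le> ennreal (\<Sum>j<n. 4 * (t j - t (Suc j))\<^sup>2 / w + 8 * (\<rho> - 1) * (\<phi> (t j) - \<phi> (t (Suc j)))\<^sup>2 / w)"
  proof (rule ennreal_leI)
    have "(\<Sum>j<n. (t j - t (Suc j))\<^sup>2 * (2 * real n / l)) = (\<Sum>j<n. 4 * (t j - t (Suc j))\<^sup>2 / w)"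
      using l n by (intro sum.cong) (auto simp: w_def field_simps)
    then show "(\<Sum>j<n. (t j - t (Suc j))\<^sup>2 * (2 * real n / l)) + 4 * (\<rho> - 1) * (b - a)\<^sup>2 / l
      \<le> (\<Sum>j<n. 4 * (t j - t (Suc j))\<^sup>2 / w + 8 * (\<rho> - 1) * (\<phi> (t j) - \<phi> (t (Suc j)))\<^sup>2 / w)"
      using g2 by (simp add: sum.distrib)
  qed
  also have "\<dots> = (\<Sum>j<n. ennreal (4 * (t j - t (Suc j))\<^sup>2 / w + 8 * (\<rho> - 1) * (\<phi> (t j) - \<phi> (t (Suc j)))\<^sup>2 / w))"
    using r w by (intro sum_ennreal[symmetric] add_nonneg_nonneg) auto
  also have "\<dots> \<le> (\<Sum>j<n. (\<integral>\<^sup>+y\<in>?A j. ennreal ((g' y)\<^sup>2) \<partial>lborel))" by (intro sum_mono e) auto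
  also have "\<dots> = (\<integral>\<^sup>+y. (\<Sum>j<n. ennreal ((g' y)\<^sup>2) * indicator (?A j) y) \<partial>lborel)"
    by (rule nn_integral_sum[symmetric]) measurable
  also have "\<dots> \<le> (\<integral>\<^sup>+y\<in>{-l..l}. ennreal ((g' y)\<^sup>2) \<partial>lborel)"
  proof (rule nn_integral_mono)
    fix y
    have "disjoint_family_on ?A {..<n}"
      unfolding disjoint_family_on_def
    proof (intro ballI impI)
      have *: "?A j \<inter> ?A k = {}" if "j < k" "k < n" for j k
        using tm[of "Suc j" k] that by (auto simp: band_def)
      show "?A j \<inter> ?A k = {}" if "j \<in> {..<n}" "k \<in> {..<n}" "j \<noteq> k" for j k
        using *[of j k] *[of k j] that by (cases "j < k") auto
    qed
    then have "(\<Sum>j<n. indicator (?A j) y) = (indicator (\<Union>j<n. ?A j) y :: ennreal)"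
      by (subst indicator_UN_disjoint) auto
    also have "\<dots> \<le> indicator {-l..l} y" by (auto simp: indicator_def band_def)
    finally show "(\<Sum>j<n. ennreal ((g' y)\<^sup>2) * indicator (?A j) y) \<le> ennreal ((g' y)\<^sup>2) * indicator {-l..l} y"
      unfolding sum_distrib_left[symmetric] by (rule mult_left_mono) simp
  qed
  finally show ?thesis unfolding t_def .
qed

end

section \<open>Slices without gain are symmetric\<close>

text \<open>For a nonconstant periodic g, reflection symmetry about c also holds about c + l; the
  monotonicity away from c excludes that second axis.\<close>

definition centre :: "real \<Rightarrow> (real \<Rightarrow> real) \<Rightarrow> real \<Rightarrow> bool" where
  "centre l g c \<longleftrightarrow> (\<forall>s. g (c + s) = g (c - s)) \<and> (\<forall>s s'. 0 \<le> s \<longrightarrow> s \<le> s' \<longrightarrow> s' \<le> l \<longrightarrow> g (c + s') \<le> g (c + s))"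

text \<open>
  The factor \<open>1 :: real ^ 1\<close> is there because the change of variables theorem is about vector-valued functions.
\<close>

lemma change_of_variables_measure:
  fixes g g' f :: "real \<Rightarrow> real"
  assumes S: "S \<in> lmeasurable" and d: "\<And>x. x \<in> S \<Longrightarrow> (g has_real_derivative g' x) (at x)" and i: "inj_on g S"
    and f: "\<And>x. x \<in> S \<Longrightarrow> \<bar>g' x\<bar> * f (g x) = 1"
  shows "integral (g ` S) (\<lambda>t. f t *\<^sub>R (1 :: real ^ 1)) = measure lebesgue S *\<^sub>R 1"
proof -
  let ?F = "\<lambda>t. f t *\<^sub>R (1 :: real ^ 1)"
  have e: "\<bar>g' x\<bar> *\<^sub>R ?F (g x) = 1" if "x \<in> S" for x using f[OF that] by simp
  have "(\<lambda>x. \<bar>g' x\<bar> *\<^sub>R ?F (g x)) absolutely_integrable_on S \<and> integral S (\<lambda>x. \<bar>g' x\<bar> *\<^sub>R ?F (g x)) = measure lebesgue S *\<^sub>R 1"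
  proof
    have "(\<lambda>x. 1 :: real ^ 1) absolutely_integrable_on S" using S by (rule absolutely_integrable_on_const)
    then show "(\<lambda>x. \<bar>g' x\<bar> *\<^sub>R ?F (g x)) absolutely_integrable_on S"
      by (rule set_integrable_cong[THEN iffD1, OF refl refl, rotated]) (simp only: e)
    have "((\<lambda>x. 1 *\<^sub>R (1 :: real ^ 1)) has_integral measure lebesgue S *\<^sub>R 1) S"
      by (intro has_integral_scaleR_left) (simp add: S has_integral_integrable_integral lmeasurable_iff_integrable_on[symmetric] lmeasure_integral[symmetric])
    then have "((\<lambda>x. \<bar>g' x\<bar> *\<^sub>R ?F (g x)) has_integral measure lebesgue S *\<^sub>R 1) S"
      by (rule has_integral_eq[rotated]) (simp only: e scaleR_one)
    then show "integral S (\<lambda>x. \<bar>g' x\<bar> *\<^sub>R ?F (g x)) = measure lebesgue S *\<^sub>R 1" by (rule integral_unique)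
  qed
  moreover have "(g has_vector_derivative g' x) (at x within S)" if "x \<in> S" for x
    using d[OF that] by (simp add: has_real_derivative_iff_has_vector_derivative has_vector_derivative_at_within)
  ultimately show ?thesis
    using has_absolute_integral_change_of_variables_1[of S g g' ?F "measure lebesgue S *\<^sub>R 1"] S i by (auto simp: fmeasurableD)
qed

locale no_gain = periodic_C1 +
  assumes nonconst: "mn < mx"
    and crit: "{y \<in> {-l..l}. g' y = 0 \<and> mn < g y \<and> g y < mx} \<in> null_sets lborel"
    and no_gain: "\<And>\<alpha> \<beta> \<rho>. mn \<le> \<alpha> \<Longrightarrow> \<alpha> < \<beta> \<Longrightarrow> \<beta> \<le> mx \<Longrightarrow> 1 < \<rho> \<Longrightarrow> \<not> gain \<alpha> \<beta> \<rho>"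
begin

definition crit_set where "crit_set = {y. g' y = 0 \<and> mn < g y \<and> g y < mx}"
lemma crit_set_borel[measurable]: "crit_set \<in> sets borel" unfolding crit_set_def by measurable

lemma crit_set_window:
  assumes "a \<le> b" "b \<le> a + 2 * l"
  shows "emeasure lborel (crit_set \<inter> {a..a + 2 * l}) = emeasure lborel (crit_set \<inter> {b..b + 2 * l})"
proof -
  have "(\<integral>\<^sup>+x\<in>{a..a + 2 * l}. indicator crit_set x \<partial>lborel) = (\<integral>\<^sup>+x\<in>{b..b + 2 * l}. indicator crit_set x \<partial>lborel)"
    using assms by (intro nn_integral_window) (auto simp: crit_set_def indicator_def per per')
  then show ?thesis by (simp add: indicator_inter_arith[symmetric])
qed

text \<open>Two periods are covered because the descending arc after the maximum point a and the
  ascending arc before it are treated without reduction modulo 2l.\<close>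

lemma crit_set_null: assumes "a \<in> {-l..l}" shows "crit_set \<inter> {a - 2 * l..a + 2 * l} \<in> null_sets lborel"
proof -
  have "crit_set \<inter> {-l..-l + 2 * l} = {y \<in> {-l..l}. g' y = 0 \<and> mn < g y \<and> g y < mx}" by (auto simp: crit_set_def)
  then have 0: "emeasure lborel (crit_set \<inter> {-l..-l + 2 * l}) = 0" using crit by auto
  have 1: "emeasure lborel (crit_set \<inter> {a..a + 2 * l}) = 0" using crit_set_window[of "-l" a] 0 assms by auto
  have 2: "emeasure lborel (crit_set \<inter> {a - 2 * l..(a - 2 * l) + 2 * l}) = 0" using crit_set_window[of "a - 2 * l" a] 1 l by auto
  have "crit_set \<inter> {a - 2 * l..(a - 2 * l) + 2 * l} \<union> crit_set \<inter> {a..a + 2 * l} \<in> null_sets lborel"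
    using 1 2 by (intro null_sets.Un) (auto simp: null_sets_def)
  moreover have "crit_set \<inter> {a - 2 * l..(a - 2 * l) + 2 * l} \<union> crit_set \<inter> {a..a + 2 * l} = crit_set \<inter> {a - 2 * l..a + 2 * l}" using l by auto
  ultimately show ?thesis by simp
qed

text \<open>A constant stretch strictly between the extreme values would be a nonempty open set of
  critical points, which cannot be null.\<close>

lemma not_locally_const:
  assumes a: "a \<in> {-l..l}" and y: "y \<in> {a - 2 * l<..<a + 2 * l}" "mn < g y" "g y < mx" and e: "e > 0"
  shows "\<exists>z. \<bar>z - y\<bar> < e \<and> g z \<noteq> g y"
proof (rule ccontr)
  assume "\<not> ?thesis"
  then have c: "g z = g y" if "\<bar>z - y\<bar> < e" for z using that by blast
  let ?U = "{y - e<..<y + e} \<inter> {a - 2 * l<..<a + 2 * l}"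
  have "?U \<subseteq> crit_set \<inter> {a - 2 * l..a + 2 * l}"
  proof
    fix z assume z: "z \<in> ?U"
    have "((\<lambda>x. g y) has_real_derivative g' z) (at z)"
    proof (rule DERIV_cong_ev[THEN iffD1, OF refl _ refl der])
      have "eventually (\<lambda>x. x \<in> {y - e<..<y + e}) (nhds z)" using z by (intro eventually_nhds_in_open) auto
      then show "\<forall>\<^sub>F x in nhds z. g x = g y" by eventually_elim (rule c, auto)
    qed
    then have "g' z = 0" by (rule DERIV_unique) simp
    then show "z \<in> crit_set \<inter> {a - 2 * l..a + 2 * l}" using z y c[of z] by (auto simp: crit_set_def)
  qed
  then have "?U \<in> null_sets lebesgue" using null_sets_completionI[OF crit_set_null[OF a]] by (rule null_sets_completion_subset)
  moreover have "open ?U" "?U \<noteq> {}" using y e by (auto intro: exI[of _ y])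
  ultimately show False using open_not_negligible[of ?U] negligible_iff_null_sets by blast
qed

lemma slopes_agree:
  assumes a: "a \<in> {-l..l}" and y: "y1 \<in> {a<..<a + 2 * l}" "y2 \<in> {a<..<a + 2 * l}" "g y1 = g y2" "mn < g y1" "g y1 < mx"
  shows "\<bar>g' y1\<bar> = \<bar>g' y2\<bar>"
proof -
  have "\<not> \<bar>g' y1\<bar> < \<bar>g' y2\<bar>" if y: "y1 \<in> {a<..<a + 2 * l}" "y2 \<in> {a<..<a + 2 * l}" "g y1 = g y2" "mn < g y1" "g y1 < mx" for y1 y2
  proof
    assume "\<bar>g' y1\<bar> < \<bar>g' y2\<bar>"
    from gain_mismatch[OF a y(1,2,3) this] not_locally_const[OF a, of y1] y l no_gain show False by auto
  qed
  from this[of y1 y2] this[of y2 y1] y show ?thesis by simp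
qed

section \<open>Monotone arcs, their inverses and the common midpoint\<close>

context
  fixes a p assumes a: "a \<in> {-l..l}" "g a = mx" and p: "a < p" "p < a + 2 * l" "g p = mn"
begin

text \<open>If g increased from y1 to y2 on the way from the maximum a to the minimum p, the points
  a, y1, y2, p would alternate and \<open>gain_three\<close> would apply to the levels between g y1
  and g y2.\<close>

lemma dec: assumes "a \<le> y1" "y1 \<le> y2" "y2 \<le> p" shows "g y2 \<le> g y1"
proof (rule ccontr)
  assume "\<not> g y2 \<le> g y1"
  moreover have "gain (g y1) (g y2) (3/2)"
    by (rule gain_three[OF a(1), of a y1 y2 p]) (use assms a p calculation mn_le_g[of y1] g_le_mx[of y2] g_le_mx[of y1] mn_le_g[of y2] in auto)
  ultimately show False using no_gain[OF mn_le_g _ g_le_mx, of y1 y2 "3/2"] by auto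
qed

lemma inc: assumes "p - 2 * l \<le> y1" "y1 \<le> y2" "y2 \<le> a" shows "g y1 \<le> g y2"
proof (rule ccontr)
  assume *: "\<not> g y1 \<le> g y2"
  have "g (y1 + 2 * l) = g y1" "g (y2 + 2 * l) = g y2" "g (a + 2 * l) = mx" using per a by auto
  moreover from this have "gain (g y2) (g y1) (3/2)"
    by (intro gain_three[OF a(1), of p "y1 + 2 * l" "y2 + 2 * l" "a + 2 * l"]) (use assms a p * mn_le_g[of y1] g_le_mx[of y2] g_le_mx[of y1] mn_le_g[of y2] in auto)
  ultimately show False using no_gain[OF mn_le_g _ g_le_mx, of y2 y1 "3/2"] * by auto
qed

text \<open>The inverse of g on the descending arc; \<open>lo\<close> is the one on the ascending
  arc that ends at the same maximum point. At intermediate levels existence is the intermediate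
  value theorem and uniqueness is \<open>dec_strict\<close> or \<open>inc_strict\<close>.\<close>

definition hi where "hi t = (SOME y. y \<in> {a..p} \<and> g y = t)"
definition lo where "lo t = (SOME y. y \<in> {p - 2 * l..a} \<and> g y = t)"

lemma gp2: "g (p - 2 * l) = mn" using per[of "p - 2 * l"] p by simp

lemma hi: assumes "mn < t" "t < mx" shows "a < hi t" "hi t < p" "g (hi t) = t"
proof -
  have "\<exists>y. a \<le> y \<and> y \<le> p \<and> g y = t"
    using IVT2'[of g p t a] a p assms continuous_on_subset[OF cont] by auto
  then have "hi t \<in> {a..p} \<and> g (hi t) = t" unfolding hi_def by (intro someI_ex[where P="\<lambda>y. y \<in> {a..p} \<and> g y = t"]) auto
  then show "a < hi t" "hi t < p" "g (hi t) = t" using a p assms by (auto simp: order_less_le)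
qed

lemma lo: assumes "mn < t" "t < mx" shows "p - 2 * l < lo t" "lo t < a" "g (lo t) = t"
proof -
  have "\<exists>y. p - 2 * l \<le> y \<and> y \<le> a \<and> g y = t"
    using IVT'[of g "p - 2 * l" t a] a p assms continuous_on_subset[OF cont] gp2 by auto
  then have "lo t \<in> {p - 2 * l..a} \<and> g (lo t) = t" unfolding lo_def by (intro someI_ex[where P="\<lambda>y. y \<in> {p - 2 * l..a} \<and> g y = t"]) auto
  then show "p - 2 * l < lo t" "lo t < a" "g (lo t) = t" using a p assms gp2 by (auto simp: order_less_le)
qed

text \<open>Monotonicity turns equal values into a plateau, which \<open>not_locally_const\<close>
  forbids at intermediate levels. The hypotheses leave room for plateaus at the maximum and the
  minimum.\<close>

lemma dec_strict: assumes y: "a \<le> y1" "y1 < y2" "y2 \<le> p" and m: "mn < g y1" "g y2 < mx" shows "g y2 < g y1"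
proof (rule ccontr)
  assume "\<not> g y2 < g y1"
  then have eq: "g y2 = g y1" using dec[of y1 y2] y by auto
  let ?y = "(y1 + y2) / 2"
  have c: "g z = g y1" if "y1 \<le> z" "z \<le> y2" for z using dec[of y1 z] dec[of z y2] that y eq by auto
  have "\<exists>z. \<bar>z - ?y\<bar> < (y2 - y1) / 2 \<and> g z \<noteq> g ?y"
    using y m a p l eq c[of ?y] by (intro not_locally_const[OF a(1)]) auto
  then obtain z where z: "\<bar>z - ?y\<bar> < (y2 - y1) / 2" "g z \<noteq> g ?y" by blast
  have "y1 \<le> z \<and> z \<le> y2" using z(1) by (auto simp: abs_less_iff field_simps)
  then show False using z(2) c[of z] c[of ?y] y by auto
qed

lemma inc_strict: assumes y: "p - 2 * l \<le> y1" "y1 < y2" "y2 \<le> a" and m: "mn < g y2" "g y1 < mx" shows "g y1 < g y2"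
proof (rule ccontr)
  assume "\<not> g y1 < g y2"
  then have eq: "g y2 = g y1" using inc[of y1 y2] y by auto
  let ?y = "(y1 + y2) / 2"
  have c: "g z = g y1" if "y1 \<le> z" "z \<le> y2" for z using inc[of y1 z] inc[of z y2] that y eq by auto
  have "\<exists>z. \<bar>z - ?y\<bar> < (y2 - y1) / 2 \<and> g z \<noteq> g ?y"
    using y m a p l eq c[of ?y] by (intro not_locally_const[OF a(1)]) auto
  then obtain z where z: "\<bar>z - ?y\<bar> < (y2 - y1) / 2" "g z \<noteq> g ?y" by blast
  have "y1 \<le> z \<and> z \<le> y2" using z(1) by (auto simp: abs_less_iff field_simps)
  then show False using z(2) c[of z] c[of ?y] y by auto
qed

lemma hi_iff: assumes t: "mn < t" "t < mx" and y: "a \<le> y" "y \<le> p" shows "t < g y \<longleftrightarrow> y < hi t"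
  using hi[OF t] dec[of "hi t" y] dec_strict[of y "hi t"] y t dec[of y "hi t"] by (cases "y < hi t") auto

lemma lo_iff: assumes t: "mn < t" "t < mx" and y: "p - 2 * l \<le> y" "y \<le> a" shows "t < g y \<longleftrightarrow> lo t < y"
  using lo[OF t] inc[of y "lo t"] inc_strict[of "lo t" y] y t inc[of "lo t" y] by (cases "lo t < y") auto

lemma hi_g: assumes "a \<le> y" "y \<le> p" "mn < g y" "g y < mx" shows "hi (g y) = y"
  using hi[OF assms(3,4)] dec_strict[of y "hi (g y)"] dec_strict[of "hi (g y)" y] assms
  by (cases rule: linorder_cases[of "hi (g y)" y]) auto

lemma lo_g: assumes "p - 2 * l \<le> y" "y \<le> a" "mn < g y" "g y < mx" shows "lo (g y) = y"
  using lo[OF assms(3,4)] inc_strict[of y "lo (g y)"] inc_strict[of "lo (g y)" y] assms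
  by (cases rule: linorder_cases[of "lo (g y)" y]) auto

lemma slopes_hi_lo: assumes t: "mn < t" "t < mx" shows "\<bar>g' (hi t)\<bar> = \<bar>g' (lo t)\<bar>"
proof -
  have "\<bar>g' (hi t)\<bar> = \<bar>g' (lo t + 2 * l)\<bar>"
    using hi[OF t] lo[OF t] t p by (intro slopes_agree[OF a(1)]) (auto simp: per)
  then show ?thesis by (simp add: per')
qed

text \<open>Removing the critical points leaves the length unchanged, and on what remains the
  density 1/|g'| of the change of variables is defined.\<close>

lemma measure_regular:
  assumes "x < y" "a - 2 * l \<le> x" "y \<le> a + 2 * l" "\<And>z. x < z \<Longrightarrow> z < y \<Longrightarrow> mn < g z \<and> g z < mx"
  shows "{z \<in> {x<..<y}. g' z \<noteq> 0} \<in> lmeasurable" "measure lebesgue {z \<in> {x<..<y}. g' z \<noteq> 0} = y - x"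
proof -
  have eq: "{z \<in> {x<..<y}. g' z \<noteq> 0} = {x<..<y} - (crit_set \<inter> {a - 2 * l..a + 2 * l})" using assms by (auto simp: crit_set_def)
  have n: "crit_set \<inter> {a - 2 * l..a + 2 * l} \<in> null_sets lebesgue" using crit_set_null[OF a(1)] by (rule null_sets_completionI)
  show "{z \<in> {x<..<y}. g' z \<noteq> 0} \<in> lmeasurable" unfolding eq using n by (intro fmeasurable_Diff) auto
  have "emeasure lebesgue ({x<..<y} - (crit_set \<inter> {a - 2 * l..a + 2 * l})) = emeasure lebesgue {x<..<y}"
    using n by (intro emeasure_Diff_null_set) auto
  then show "measure lebesgue {z \<in> {x<..<y}. g' z \<noteq> 0} = y - x" unfolding eq using assms(1) by (simp add: measure_def)
qed

text \<open>Both hi t1 - hi t2 and lo t2 - lo t1 are the integral of 1/|g'| over the same set of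
  levels, since the slopes at the two points of a level agree. Working with integrals over regular
  points avoids differentiating \<open>hi\<close> and \<open>lo\<close>.\<close>

lemma sum_const: assumes t: "mn < t1" "t1 < t2" "t2 < mx" shows "hi t1 + lo t1 = hi t2 + lo t2"
proof -
  have t': "mn < t2" "t1 < mx" using t by auto
  note h1 = hi[OF t(1) t'(2)] and h2 = hi[OF t'(1) t(3)] and l1 = lo[OF t(1) t'(2)] and l2 = lo[OF t'(1) t(3)]
  have h: "hi t2 < hi t1" using hi_iff[OF t(1) t'(2), of "hi t2"] h2 t by auto
  have ll: "lo t1 < lo t2" using lo_iff[OF t(1) t'(2), of "lo t2"] l2 t by auto
  let ?S1 = "{z \<in> {hi t2<..<hi t1}. g' z \<noteq> 0}" and ?S2 = "{z \<in> {lo t1<..<lo t2}. g' z \<noteq> 0}"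
  have r1: "t1 < g z \<and> g z < t2" if "hi t2 < z" "z < hi t1" for z
    using that h1 h2 t dec[of "hi t2" z] dec_strict[of "hi t2" z] hi_iff[OF t(1) t'(2), of z] by auto
  have r2: "t1 < g z \<and> g z < t2" if "lo t1 < z" "z < lo t2" for z
    using that l1 l2 t inc[of z "lo t2"] inc_strict[of z "lo t2"] lo_iff[OF t(1) t'(2), of z] by auto
  let ?f = "\<lambda>t. 1 / \<bar>g' (hi t)\<bar>"
  let ?F = "\<lambda>t. ?f t *\<^sub>R (1 :: real ^ 1)"
  have g1: "hi (g z) = z \<and> \<bar>g' (lo (g z))\<bar> = \<bar>g' z\<bar>" if "hi t2 < z" "z < hi t1" for z
    using r1[OF that] t h1 h2 that hi_g[of z] slopes_hi_lo[of "g z"] by auto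
  have g2: "lo (g z) = z \<and> \<bar>g' (hi (g z))\<bar> = \<bar>g' z\<bar>" if "lo t1 < z" "z < lo t2" for z
    using r2[OF that] t l1 l2 that lo_g[of z] slopes_hi_lo[of "g z"] by auto
  have "hi t1 - hi t2 = measure lebesgue ?S1"
    using h h1 h2 l p r1 t by (intro measure_regular(2)[symmetric]) (auto dest!: r1)
  then have "(hi t1 - hi t2) *\<^sub>R 1 = measure lebesgue ?S1 *\<^sub>R (1 :: real ^ 1)" by (rule arg_cong)
  also have "\<dots> = integral (g ` ?S1) ?F"
  proof (rule change_of_variables_measure[symmetric])
    show "?S1 \<in> lmeasurable" using h h1 h2 l p r1 t by (intro measure_regular(1)) (auto dest!: r1)
    show "inj_on g ?S1" using g1 by (intro inj_onI) (metis (mono_tags, lifting) greaterThanLessThan_iff mem_Collect_eq)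
    show "\<bar>g' z\<bar> * ?f (g z) = 1" if "z \<in> ?S1" for z using g1[of z] that by auto
  qed (rule der)
  \<comment> \<open>By equal slopes a level is regular on one arc exactly if it is regular on the
    other.\<close>
  also have "g ` ?S1 = g ` ?S2"
  proof safe
    fix z assume z: "z \<in> {hi t2<..<hi t1}" "g' z \<noteq> 0"
    have b: "mn < g z" "g z < mx" "t1 < g z" "g z < t2" using r1[of z] z t by auto
    have "lo t1 < lo (g z)" using lo_iff[OF t(1) t'(2), of "lo (g z)"] lo[OF b(1,2)] b by auto
    moreover have "lo (g z) < lo t2" using lo_iff[OF b(1,2), of "lo t2"] l2 b by auto
    ultimately show "g z \<in> g ` ?S2" using g1[of z] z lo[OF b(1,2)] by (intro image_eqI[of _ _ "lo (g z)"]) auto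
  next
    fix z assume z: "z \<in> {lo t1<..<lo t2}" "g' z \<noteq> 0"
    have b: "mn < g z" "g z < mx" "t1 < g z" "g z < t2" using r2[of z] z t by auto
    have "hi (g z) < hi t1" using hi_iff[OF t(1) t'(2), of "hi (g z)"] hi[OF b(1,2)] b by auto
    moreover have "hi t2 < hi (g z)" using hi_iff[OF b(1,2), of "hi t2"] h2 b by auto
    ultimately show "g z \<in> g ` ?S1" using g2[of z] z hi[OF b(1,2)] by (intro image_eqI[of _ _ "hi (g z)"]) auto
  qed
  also have "integral (g ` ?S2) ?F = measure lebesgue ?S2 *\<^sub>R 1"
  proof (rule change_of_variables_measure)
    show "?S2 \<in> lmeasurable" using ll l1 l2 l p r2 t by (intro measure_regular(1)) (auto dest!: r2)
    show "inj_on g ?S2" using g2 by (intro inj_onI) (metis (mono_tags, lifting) greaterThanLessThan_iff mem_Collect_eq)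
    show "\<bar>g' z\<bar> * ?f (g z) = 1" if "z \<in> ?S2" for z using g2[of z] that by auto
  qed (rule der)
  also have "measure lebesgue ?S2 = lo t2 - lo t1"
    using ll l1 l2 l p r2 t by (intro measure_regular(2)) (auto dest!: r2)
  finally have "hi t1 - hi t2 = lo t2 - lo t1 \<or> (1 :: real ^ 1) = 0" unfolding scaleR_cancel_right .
  then have "hi t1 - hi t2 = lo t2 - lo t1" by (simp only: one_neq_zero simp_thms)
  then show ?thesis by linarith
qed

text \<open>By \<open>sum_const\<close> the superlevel sets at all intermediate levels are intervals
  with the same midpoint c within the period from p - 2l to p. Nested concentric intervals mean
  symmetry and monotonicity.\<close>

lemma centre_exists_aux: "\<exists>c. centre l g c"
proof -
  obtain t0 where t0: "mn < t0" "t0 < mx" using dense[OF nonconst] by blast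
  define c where "c = (hi t0 + lo t0) / 2"
  have c0: "hi t0 + lo t0 = 2 * c" unfolding c_def by simp
  have c: "hi t + lo t = 2 * c" if "mn < t" "t < mx" for t
  proof (cases t t0 rule: linorder_cases)
    case less then show ?thesis using sum_const[of t t0] that t0 c0 by metis
  next
    case equal then show ?thesis using c0 by simp
  next
    case greater then show ?thesis using sum_const[of t0 t] that t0 c0 by metis
  qed
  have cb: "p - 2 * l < c" "c < p" using hi(1,2)[OF t0] lo(1,2)[OF t0] p(1,2) c0 by linarith+
  \<comment> \<open>The period around c need not coincide with the one from p - 2l to p; points that
    stick out are moved back by one period, where the value is at most t on both sides of the
    equivalence.\<close>
  have iff: "t < g (c + s) \<longleftrightarrow> \<bar>s\<bar> < (hi t - lo t) / 2" if t: "mn < t" "t < mx" and s: "\<bar>s\<bar> \<le> l" for t s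
  proof -
    note h = hi[OF t] and l' = lo[OF t] and ct = c[OF t]
    have w: "t < g y \<longleftrightarrow> lo t < y \<and> y < hi t" if "p - 2 * l \<le> y" "y \<le> p" for y
      using hi_iff[OF t, of y] lo_iff[OF t, of y] that h l' by (cases "a \<le> y") auto
    consider "p < c + s" | "c + s < p - 2 * l" | "p - 2 * l \<le> c + s" "c + s \<le> p" by linarith
    then show ?thesis
    proof cases
      case 1
      have "g (c + s) = g (c + s - 2 * l)" using per[of "c + s - 2 * l"] by simp
      moreover have "\<not> t < g (c + s - 2 * l)" using w[of "c + s - 2 * l"] 1 s cb ct h(2) l'(1) l by linarith
      moreover have "\<not> \<bar>s\<bar> < (hi t - lo t) / 2" using 1 ct h(2) l'(1) by (auto simp: abs_less_iff)
      ultimately show ?thesis by simp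
    next
      case 2
      have "g (c + s) = g (c + s + 2 * l)" using per[of "c + s"] by simp
      moreover have "\<not> t < g (c + s + 2 * l)" using w[of "c + s + 2 * l"] 2 s cb ct h(2) l'(1) l by linarith
      moreover have "\<not> \<bar>s\<bar> < (hi t - lo t) / 2" using 2 ct h(2) l'(1) by (auto simp: abs_less_iff)
      ultimately show ?thesis by simp
    next
      case 3
      then have "t < g (c + s) \<longleftrightarrow> lo t < c + s \<and> c + s < hi t" using w[of "c + s"] by blast
      also have "\<dots> \<longleftrightarrow> \<bar>s\<bar> < (hi t - lo t) / 2" using ct unfolding abs_less_iff by auto
      finally show ?thesis .
    qed
  qed
  \<comment> \<open>Formulated with absolute values, so that applying it to r and -r in both orders
    gives the symmetry.\<close>
  have mono: "g (c + s') \<le> g (c + s)" if "\<bar>s\<bar> \<le> \<bar>s'\<bar>" "\<bar>s'\<bar> \<le> l" for s s'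
  proof (rule ccontr)
    assume "\<not> g (c + s') \<le> g (c + s)"
    then obtain t where t: "g (c + s) < t" "t < g (c + s')" by (meson dense not_le)
    then have "mn < t" "t < mx" using mn_le_g[of "c + s"] g_le_mx[of "c + s'"] by auto
    then show False using iff[of t s] iff[of t s'] t that by auto
  qed
  have "g (c + s) = g (c - s)" for s
  proof -
    define r where "r = circle_rep l s"
    obtain k where k: "s = r + 2 * l * of_int k" unfolding r_def using circle_rep_eq by blast
    have r: "\<bar>r\<bar> \<le> l" unfolding r_def using abs_circle_rep_le[OF l] .
    have "g (c + r) = g (c + - r)" using mono[of r "-r"] mono[of "-r" r] r by simp
    moreover have "g (c + s) = g (c + r)" using per_int[of "c + r" k] by (simp add: k add.assoc)
    moreover have "g (c - s) = g (c + - r)" using per_int[of "c - r" "-k"] by (simp add: k algebra_simps)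
    ultimately show ?thesis by simp
  qed
  moreover have "g (c + s') \<le> g (c + s)" if "0 \<le> s" "s \<le> s'" "s' \<le> l" for s s' using mono[of s s'] that by auto
  ultimately show ?thesis unfolding centre_def by blast
qed

end

lemma centre_exists: "\<exists>c. centre l g c"
proof -
  obtain a where a: "a \<in> {-l..l}" "g a = mx" by (rule mx_attained)
  obtain p where p: "p \<in> {a..a + 2 * l}" "g p = mn" using min_after_max[OF a] by blast
  have "p \<noteq> a" "p \<noteq> a + 2 * l" using p a nonconst per[of a] by auto
  then show ?thesis using centre_exists_aux[OF a, of p] p by auto
qed

end

section \<open>Energies of slices of the symmetrization\<close>

text \<open>Differentiability at r alone suffices because r lies between the two nodes: the two
  errors are at most \<epsilon>/2 times the distances to r, which add up to the denominator.\<close>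

lemma straddle:
  fixes f :: "real \<Rightarrow> real"
  assumes f: "(f has_real_derivative d) (at r)" and ab: "\<And>n. a n \<le> r" "\<And>n. r \<le> b n" "\<And>n. a n < b n"
    and lim: "a \<longlonglongrightarrow> r" "b \<longlonglongrightarrow> r"
  shows "(\<lambda>n. (f (b n) - f (a n)) / (b n - a n)) \<longlonglongrightarrow> d"
proof (rule tendstoI)
  fix e :: real assume e: "e > 0"
  have "(f has_derivative (\<lambda>h. d * h)) (at r)" using f by (simp add: has_field_derivative_def mult_commute_abs)
  then obtain s where s: "s > 0" "\<And>y. norm (y - r) < s \<Longrightarrow> norm (f y - f r - d * (y - r)) \<le> (e / 2) * norm (y - r)"
    using e unfolding has_derivative_at_alt by (metis half_gt_zero)
  have "eventually (\<lambda>n. dist (a n) r < s) sequentially" "eventually (\<lambda>n. dist (b n) r < s) sequentially"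
    using lim s(1) by (auto dest: tendstoD)
  then show "eventually (\<lambda>n. dist ((f (b n) - f (a n)) / (b n - a n)) d < e) sequentially"
  proof eventually_elim
    case (elim n)
    have 1: "\<bar>f (b n) - f r - d * (b n - r)\<bar> \<le> (e / 2) * (b n - r)" using s(2)[of "b n"] elim ab by (auto simp: dist_real_def)
    have 2: "\<bar>f (a n) - f r - d * (a n - r)\<bar> \<le> (e / 2) * (r - a n)" using s(2)[of "a n"] elim ab(1)[of n] by (auto simp: dist_real_def abs_minus_commute)
    have "f (b n) - f (a n) - d * (b n - a n) = (f (b n) - f r - d * (b n - r)) - (f (a n) - f r - d * (a n - r))"
      by (simp add: algebra_simps)
    then have "\<bar>f (b n) - f (a n) - d * (b n - a n)\<bar> \<le> (e / 2) * (b n - r) + (e / 2) * (r - a n)"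
      using 1 2 by linarith
    also have "\<dots> = (e / 2) * (b n - a n)" by (simp add: field_simps)
    also have "\<dots> < e * (b n - a n)" using e ab(3)[of n] by simp
    finally have "\<bar>f (b n) - f (a n) - d * (b n - a n)\<bar> < e * (b n - a n)" .
    moreover have "(f (b n) - f (a n)) / (b n - a n) - d = (f (b n) - f (a n) - d * (b n - a n)) / (b n - a n)"
      using ab(3)[of n] by (simp add: field_simps)
    ultimately show ?case using ab(3)[of n] by (simp add: dist_real_def abs_divide pos_divide_less_eq)
  qed
qed

lemma grad_eq: "GDERIV f x :> D \<Longrightarrow> grad f x = D"
proof -
  assume D: "GDERIV f x :> D"
  have u: "E = D" if "GDERIV f x :> E" for E
  proof -
    have "(\<lambda>h. inner h E) = (\<lambda>h. inner h D)"
      using D that unfolding gderiv_def by (rule has_derivative_unique[rotated])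
    then have "inner h (E - D) = 0" for h by (simp add: inner_diff_right fun_eq_iff)
    then show "E = D" using inner_eq_zero_iff[of "E - D"] by auto
  qed
  have "(THE E. GDERIV f x :> E) = D" by (rule the_equality[where P = "\<lambda>E. GDERIV f x :> E", OF D u])
  moreover have "\<exists>E. GDERIV f x :> E" using D by blast
  ultimately show ?thesis unfolding grad_def by (simp only: if_True)
qed

lemma GDERIV_path:
  fixes f :: "'a::real_inner \<times> real \<Rightarrow> real"
  assumes D: "GDERIV f (x, y) :> D"
  shows "((\<lambda>t. f (x + t *\<^sub>R b, y)) has_real_derivative inner (fst D) b) (at 0)"
    and "((\<lambda>t. f (x, t)) has_real_derivative snd D) (at y)"
proof -
  have F: "(f has_derivative (\<lambda>h. inner h D)) (at (x, y))" using D by (simp add: gderiv_def)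
  have "((\<lambda>t. f (x + t *\<^sub>R b, y)) has_derivative (\<lambda>t. inner (t *\<^sub>R b, 0) D)) (at 0)"
    by (rule has_derivative_compose[where g = f and f = "\<lambda>t. (x + t *\<^sub>R b, y)"])
      (auto intro!: derivative_eq_intros simp: F)
  then show "((\<lambda>t. f (x + t *\<^sub>R b, y)) has_real_derivative inner (fst D) b) (at 0)"
    by (simp add: has_field_derivative_def inner_prod_def mult_commute_abs inner_commute[of b])
  have "((\<lambda>t. f (x, t)) has_derivative (\<lambda>t. inner (0, t) D)) (at y)"
    by (rule has_derivative_compose[where g = f and f = "\<lambda>t. (x, t)"])
      (auto intro!: derivative_eq_intros simp: F)
  then show "((\<lambda>t. f (x, t)) has_real_derivative snd D) (at y)"
    by (simp add: has_field_derivative_def inner_prod_def mult_commute_abs)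
qed

lemma norm_Pair_sq:
  fixes D :: "'a::euclidean_space \<times> real"
  shows "(norm D)\<^sup>2 = (snd D)\<^sup>2 + (\<Sum>b\<in>Basis. (inner (fst D) b)\<^sup>2)"
  unfolding power2_norm_eq_inner inner_prod_def euclidean_inner[of "fst D" "fst D"] by (simp add: power2_eq_square)

lemma indicator_sum_split:
  assumes "0 \<le> a" "\<And>b. b \<in> I \<Longrightarrow> 0 \<le> f b"
  shows "ennreal (a + sum f I) * indicator S y = ennreal a * indicator S y + (\<Sum>b\<in>I. ennreal (f b) * indicator S y)"
  using assms by (simp add: sum_nonneg distrib_right flip: sum_distrib_right sum_ennreal)

lemma scale_identity: "l \<noteq> 0 \<Longrightarrow> N \<noteq> 0 \<Longrightarrow> (d * (N / l))\<^sup>2 * (2 * l / N) = d\<^sup>2 * (2 * N / l)" for d N l :: real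
  by (simp add: field_simps power2_eq_square)

locale torus_C1 =
  fixes l :: real and u :: "'a::euclidean_space \<times> real \<Rightarrow> real" and D :: "'a \<times> real \<Rightarrow> 'a \<times> real"
  assumes l: "l > 0" and der: "\<And>p. GDERIV u p :> D p" and contD: "continuous_on UNIV D"
    and per: "\<And>x y. u (x, y + 2 * l) = u (x, y)"
begin

lemma contu: "continuous_on UNIV u"
  using der by (intro continuous_at_imp_continuous_on) (auto simp: gderiv_def intro: has_derivative_continuous)

lemma contu': "continuous_on S f \<Longrightarrow> continuous_on S (\<lambda>z. u (f z))"
  by (rule continuous_on_compose2[OF contu]) auto
lemma contD': "continuous_on S f \<Longrightarrow> continuous_on S (\<lambda>z. D (f z))"
  by (rule continuous_on_compose2[OF contD]) auto

lemma slice_C1: "periodic_C1 l (\<lambda>y. u (x, y)) (\<lambda>y. snd (D (x, y)))"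
proof
  show "((\<lambda>y. u (x, y)) has_real_derivative snd (D (x, y))) (at y)" for y using GDERIV_path(2)[OF der] .
qed (use l per in \<open>auto intro!: continuous_intros contu' contD'\<close>)

lemma slice_slice: "slice_fun l (\<lambda>y. u (x, y))" using slice_C1[of x] by (simp add: periodic_C1_def)

definition v where "v = steiner l u"

lemma v_eq: "\<bar>y\<bar> \<le> l \<Longrightarrow> v (x, y) = rad l (\<lambda>z. u (x, z)) \<bar>y\<bar>"
  by (simp add: v_def steiner_eq_rad abs_circle_rep l)

lemma u_measurable[measurable]: "(\<lambda>y. u (x, y)) \<in> borel_measurable borel"
  by (intro borel_measurable_continuous_onI contu' continuous_intros)
lemma D_measurable[measurable]:
  "(\<lambda>y. inner (fst (D (x, y))) b) \<in> borel_measurable borel" "(\<lambda>y. snd (D (x, y))) \<in> borel_measurable borel"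
  "(\<lambda>y. norm (D (x, y))) \<in> borel_measurable borel"
  by (intro borel_measurable_continuous_onI contD' continuous_intros)+

text \<open>The mean value theorem with the gradient bounded on a compact set. This supplies the
  dominating constant in \<open>energy_b_limit\<close>.\<close>

lemma difference_quotient_bound:
  obtains K where "\<And>t y. 0 \<le> t \<Longrightarrow> t \<le> 1 \<Longrightarrow> y \<in> {-l..l} \<Longrightarrow> \<bar>u (x + t *\<^sub>R b, y) - u (x, y)\<bar> \<le> K * t"
proof -
  have "compact ((\<lambda>(t, y). inner (fst (D (x + t *\<^sub>R b, y))) b) ` ({0..1} \<times> {-l..l}))"
    by (intro compact_continuous_image compact_Times) (auto intro!: continuous_intros contD' simp: case_prod_unfold)
  then obtain K where "\<forall>z\<in>(\<lambda>(t, y). inner (fst (D (x + t *\<^sub>R b, y))) b) ` ({0..1} \<times> {-l..l}). norm z \<le> K"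
    by (metis (no_types, lifting) compact_imp_bounded bounded_iff)
  then have K: "\<bar>inner (fst (D (x + t *\<^sub>R b, y))) b\<bar> \<le> K" if "t \<in> {0..1}" "y \<in> {-l..l}" for t y
    using that by (auto dest!: bspec[of _ _ "inner (fst (D (x + t *\<^sub>R b, y))) b"])
  have "\<bar>u (x + t *\<^sub>R b, y) - u (x, y)\<bar> \<le> K * t" if t: "0 \<le> t" "t \<le> 1" and y: "y \<in> {-l..l}" for t y
  proof (cases "t = 0")
    case False
    have d: "((\<lambda>t. u (x + t *\<^sub>R b, y)) has_real_derivative inner (fst (D (x + s *\<^sub>R b, y))) b) (at s)" for s
    proof -
      have "((\<lambda>t. u ((x + s *\<^sub>R b) + t *\<^sub>R b, y)) has_real_derivative inner (fst (D (x + s *\<^sub>R b, y))) b) (at 0)"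
        by (rule GDERIV_path(1)[OF der])
      then have "((\<lambda>t. u (x + (t + s) *\<^sub>R b, y)) has_real_derivative inner (fst (D (x + s *\<^sub>R b, y))) b) (at 0)"
        by (simp add: algebra_simps)
      then show ?thesis using DERIV_shift[of "\<lambda>t. u (x + t *\<^sub>R b, y)" _ 0 s] by simp
    qed
    obtain z where z: "0 < z" "z < t" "u (x + t *\<^sub>R b, y) - u (x + 0 *\<^sub>R b, y) = (t - 0) * inner (fst (D (x + z *\<^sub>R b, y))) b"
      using MVT2[of 0 t "\<lambda>t. u (x + t *\<^sub>R b, y)" "\<lambda>s. inner (fst (D (x + s *\<^sub>R b, y))) b"] d t False by auto
    then show ?thesis using K[of z y] t y by (simp add: abs_mult mult.commute mult_left_mono)
  qed simp
  then show ?thesis using that by blast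
qed

end

lemma GDERIV_quotient:
  fixes f :: "'a::real_inner \<times> real \<Rightarrow> real"
  assumes D: "GDERIV f (x, y) :> D"
  shows "(\<lambda>n. (f (x + (1 / Suc n) *\<^sub>R b, y) - f (x, y)) * Suc n) \<longlonglongrightarrow> inner (fst D) b"
proof -
  have "(\<lambda>t. (f (x + (0 + t) *\<^sub>R b, y) - f (x + 0 *\<^sub>R b, y)) / t) \<midarrow>0\<rightarrow> inner (fst D) b"
    using GDERIV_path(1)[OF D, of b] unfolding DERIV_def .
  moreover have "filterlim (\<lambda>n. 1 / real (Suc n)) (at 0) sequentially"
    unfolding filterlim_at using LIMSEQ_inverse_real_of_nat by (auto simp: inverse_eq_divide)
  ultimately have "((\<lambda>n. (f (x + (0 + 1 / Suc n) *\<^sub>R b, y) - f (x + 0 *\<^sub>R b, y)) / (1 / Suc n)) \<longlonglongrightarrow> inner (fst D) b)"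
    by (rule filterlim_compose)
  then show ?thesis by (simp del: of_nat_Suc)
qed

section \<open>Comparison of slice energies through difference quotients\<close>

context torus_C1 begin

lemma energy_b_limit:
  "(\<lambda>n. \<integral>\<^sup>+y\<in>{-l..l}. ennreal (((u (x + (1 / Suc n) *\<^sub>R b, y) - u (x, y)) * Suc n)\<^sup>2) \<partial>lborel)
    \<longlonglongrightarrow> (\<integral>\<^sup>+y\<in>{-l..l}. ennreal ((inner (fst (D (x, y))) b)\<^sup>2) \<partial>lborel)"
proof -
  obtain K where K: "\<And>t y. 0 \<le> t \<Longrightarrow> t \<le> 1 \<Longrightarrow> y \<in> {-l..l} \<Longrightarrow> \<bar>u (x + t *\<^sub>R b, y) - u (x, y)\<bar> \<le> K * t"
    using difference_quotient_bound[of x b] by blast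
  show ?thesis
  proof (rule nn_integral_dominated_convergence[where w = "\<lambda>y. ennreal (K\<^sup>2) * indicator {-l..l} y"])
    show "AE y in lborel. ennreal (((u (x + (1 / Suc n) *\<^sub>R b, y) - u (x, y)) * Suc n)\<^sup>2) * indicator {-l..l} y \<le> ennreal (K\<^sup>2) * indicator {-l..l} y" for n
    proof (rule AE_I2)
      fix y
      show "ennreal (((u (x + (1 / Suc n) *\<^sub>R b, y) - u (x, y)) * Suc n)\<^sup>2) * indicator {-l..l} y \<le> ennreal (K\<^sup>2) * indicator {-l..l} y"
      proof (cases "y \<in> {-l..l}")
        case True
        have "\<bar>u (x + (1 / Suc n) *\<^sub>R b, y) - u (x, y)\<bar> * Suc n \<le> (K * (1 / Suc n)) * Suc n"
          using K[of "1 / Suc n" y] True by (intro mult_right_mono) auto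
        also have "\<dots> = K" by simp
        finally have "\<bar>(u (x + (1 / Suc n) *\<^sub>R b, y) - u (x, y)) * Suc n\<bar> \<le> K" by (simp add: abs_mult)
        then have "((u (x + (1 / Suc n) *\<^sub>R b, y) - u (x, y)) * Suc n)\<^sup>2 \<le> K\<^sup>2"
          by (metis abs_ge_zero power2_abs power_mono)
        then show ?thesis by (intro mult_right_mono ennreal_leI) auto
      qed simp
    qed
    show "AE y in lborel. (\<lambda>n. ennreal (((u (x + (1 / Suc n) *\<^sub>R b, y) - u (x, y)) * Suc n)\<^sup>2) * indicator {-l..l} y)
      \<longlonglongrightarrow> ennreal ((inner (fst (D (x, y))) b)\<^sup>2) * indicator {-l..l} y"
    proof (rule AE_I2)
      fix y
      have "(\<lambda>n. ennreal (((u (x + (1 / Suc n) *\<^sub>R b, y) - u (x, y)) * Suc n)\<^sup>2)) \<longlonglongrightarrow> ennreal ((inner (fst (D (x, y))) b)\<^sup>2)"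
        by (intro tendsto_ennrealI tendsto_power GDERIV_quotient der)
      then show "(\<lambda>n. ennreal (((u (x + (1 / Suc n) *\<^sub>R b, y) - u (x, y)) * Suc n)\<^sup>2) * indicator {-l..l} y)
        \<longlonglongrightarrow> ennreal ((inner (fst (D (x, y))) b)\<^sup>2) * indicator {-l..l} y"
        by (cases "y \<in> {-l..l}") auto
    qed
    show "(\<integral>\<^sup>+y. ennreal (K\<^sup>2) * indicator {-l..l} y \<partial>lborel) < \<infinity>"
      using l by (simp add: nn_integral_cmult_indicator ennreal_mult_less_top)
  qed measurable
qed

definition slice_energy where "slice_energy x = (\<integral>\<^sup>+y\<in>{-l..l}. ennreal ((norm (D (x, y)))\<^sup>2) \<partial>lborel)"
text \<open>Since \<open>grad v\<close> may fail to be measurable in y, this is a lower integral;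
  comparison with larger integrands remains valid.\<close>

definition sym_energy where "sym_energy x = (\<integral>\<^sup>+y\<in>{-l..l}. ennreal ((norm (grad v (x, y)))\<^sup>2) \<partial>lborel)"

lemma slice_energy_split: "slice_energy x = (\<integral>\<^sup>+y\<in>{-l..l}. ennreal ((snd (D (x, y)))\<^sup>2) \<partial>lborel)
    + (\<Sum>b\<in>Basis. \<integral>\<^sup>+y\<in>{-l..l}. ennreal ((inner (fst (D (x, y))) b)\<^sup>2) \<partial>lborel)"
proof -
  have "slice_energy x = (\<integral>\<^sup>+y. ennreal ((snd (D (x, y)))\<^sup>2) * indicator {-l..l} y + (\<Sum>b\<in>Basis. ennreal ((inner (fst (D (x, y))) b)\<^sup>2) * indicator {-l..l} y) \<partial>lborel)"
    unfolding slice_energy_def norm_Pair_sq by (intro nn_integral_cong indicator_sum_split) auto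
  also have "\<dots> = (\<integral>\<^sup>+y\<in>{-l..l}. ennreal ((snd (D (x, y)))\<^sup>2) \<partial>lborel)
    + (\<integral>\<^sup>+y. (\<Sum>b\<in>Basis. ennreal ((inner (fst (D (x, y))) b)\<^sup>2) * indicator {-l..l} y) \<partial>lborel)"
    by (rule nn_integral_add) measurable
  also have "(\<integral>\<^sup>+y. (\<Sum>b\<in>Basis. ennreal ((inner (fst (D (x, y))) b)\<^sup>2) * indicator {-l..l} y) \<partial>lborel)
    = (\<Sum>b\<in>Basis. \<integral>\<^sup>+y\<in>{-l..l}. ennreal ((inner (fst (D (x, y))) b)\<^sup>2) \<partial>lborel)"
    by (rule nn_integral_sum) measurable
  finally show ?thesis .
qed

text \<open>
  Difference quotients of the symmetrization: in \<open>y\<close> over the cells of a partition that depends only on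
  \<open>n\<close>, so that their integral is a finite sum, and in a basis direction \<open>b\<close> with step \<open>1 / Suc n\<close>.
\<close>

definition qy where "qy x n y = (\<Sum>j<Suc n. indicat_real {y. real j * l / Suc n \<le> \<bar>y\<bar> \<and> \<bar>y\<bar> < real (Suc j) * l / Suc n} y
   * ((rad l (\<lambda>z. u (x, z)) (real j * l / Suc n) - rad l (\<lambda>z. u (x, z)) (real (Suc j) * l / Suc n)) * (Suc n / l))\<^sup>2)"
definition qb where "qb x n b y = ((rad l (\<lambda>z. u (x + (1 / Suc n) *\<^sub>R b, z)) (min \<bar>y\<bar> l) - rad l (\<lambda>z. u (x, z)) (min \<bar>y\<bar> l)) * Suc n)\<^sup>2"

lemma qy_measurable[measurable]: "qy x n \<in> borel_measurable borel" unfolding qy_def by measurable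
lemma qb_measurable[measurable]: "qb x n b \<in> borel_measurable borel"
proof -
  note [measurable] = slice_fun.rad_borel[OF slice_slice]
  show ?thesis unfolding qb_def by measurable
qed
lemma qy_nonneg: "0 \<le> qy x n y" unfolding qy_def by (intro sum_nonneg) auto
lemma qb_nonneg: "0 \<le> qb x n b y" unfolding qb_def by simp

text \<open>Each cell in |y| consists of two intervals of length l/(n+1). The bound is exactly the
  sum in \<open>partition_energy\<close> with \<open>Suc n\<close> cells.\<close>

lemma qy_integral: "(\<integral>\<^sup>+y\<in>{-l..l}. ennreal (qy x n y) \<partial>lborel)
  \<le> ennreal (\<Sum>j<Suc n. (rad l (\<lambda>z. u (x, z)) (real j * l / Suc n) - rad l (\<lambda>z. u (x, z)) (real (Suc j) * l / Suc n))\<^sup>2 * (2 * real (Suc n) / l))"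
proof -
  let ?d = "\<lambda>j. rad l (\<lambda>z. u (x, z)) (real j * l / Suc n) - rad l (\<lambda>z. u (x, z)) (real (Suc j) * l / Suc n)"
  let ?I = "\<lambda>j. {y. real j * l / Suc n \<le> \<bar>y\<bar> \<and> \<bar>y\<bar> < real (Suc j) * l / Suc n}"
  have "(\<integral>\<^sup>+y\<in>{-l..l}. ennreal (qy x n y) \<partial>lborel) \<le> (\<integral>\<^sup>+y. ennreal (qy x n y) \<partial>lborel)"
    by (intro nn_integral_mono) (auto simp: indicator_def)
  also have "\<dots> = (\<integral>\<^sup>+y. (\<Sum>j<Suc n. ennreal ((?d j * (Suc n / l))\<^sup>2) * indicator (?I j) y) \<partial>lborel)"
  proof (rule nn_integral_cong)
    fix y
    have "ennreal (qy x n y) = (\<Sum>j<Suc n. ennreal (indicat_real (?I j) y * (?d j * (Suc n / l))\<^sup>2))"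
      unfolding qy_def by (rule sum_ennreal[symmetric]) simp
    also have "\<dots> = (\<Sum>j<Suc n. ennreal ((?d j * (Suc n / l))\<^sup>2) * indicator (?I j) y)"
      by (intro sum.cong refl) (simp add: indicator_def)
    finally show "ennreal (qy x n y) = (\<Sum>j<Suc n. ennreal ((?d j * (Suc n / l))\<^sup>2) * indicator (?I j) y)" .
  qed
  also have "\<dots> = (\<Sum>j<Suc n. ennreal ((?d j * (Suc n / l))\<^sup>2) * emeasure lborel (?I j))"
    by (subst nn_integral_sum, measurable) (intro sum.cong refl nn_integral_cmult_indicator, measurable)
  also have "\<dots> \<le> (\<Sum>j<Suc n. ennreal (?d j ^ 2 * (2 * real (Suc n) / l)))"
  proof (rule sum_mono)
    fix j
    have "emeasure lborel (?I j) \<le> emeasure lborel {y. real j * l / Suc n \<le> \<bar>y\<bar> \<and> \<bar>y\<bar> \<le> real (Suc j) * l / Suc n}"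
      by (rule emeasure_mono) auto
    also have "\<dots> \<le> ennreal (2 * (real (Suc j) * l / Suc n - real j * l / Suc n))"
      using l by (intro emeasure_annulus) simp
    also have "2 * (real (Suc j) * l / Suc n - real j * l / Suc n) = 2 * l / Suc n"
      by (simp add: add_divide_distrib distrib_right distrib_left)
    finally have "ennreal ((?d j * (Suc n / l))\<^sup>2) * emeasure lborel (?I j) \<le> ennreal ((?d j * (Suc n / l))\<^sup>2) * ennreal (2 * l / Suc n)"
      by (rule mult_left_mono) simp
    also have "\<dots> = ennreal ((?d j * (Suc n / l))\<^sup>2 * (2 * l / Suc n))" by (rule ennreal_mult'[symmetric]) simp
    also have "(?d j * (Suc n / l))\<^sup>2 * (2 * l / Suc n) = ?d j ^ 2 * (2 * real (Suc n) / l)"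
      using l by (intro scale_identity) auto
    finally show "ennreal ((?d j * (Suc n / l))\<^sup>2) * emeasure lborel (?I j) \<le> ennreal (?d j ^ 2 * (2 * real (Suc n) / l))" .
  qed
  also have "\<dots> = ennreal (\<Sum>j<Suc n. ?d j ^ 2 * (2 * real (Suc n) / l))" using l by (intro sum_ennreal) auto
  finally show ?thesis .
qed

lemma qb_integral: "(\<integral>\<^sup>+y\<in>{-l..l}. ennreal (qb x n b y) \<partial>lborel)
  \<le> (\<integral>\<^sup>+y\<in>{-l..l}. ennreal (((u (x + (1 / Suc n) *\<^sub>R b, y) - u (x, y)) * Suc n)\<^sup>2) \<partial>lborel)"
proof -
  note [measurable] = slice_fun.rad_borel[OF slice_slice]
  have e: "(\<integral>\<^sup>+y\<in>{-l..l}. ennreal ((f y * Suc n)\<^sup>2) \<partial>lborel) = ennreal ((real (Suc n))\<^sup>2) * (\<integral>\<^sup>+y\<in>{-l..l}. ennreal ((f y)\<^sup>2) \<partial>lborel)"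
    if [measurable]: "f \<in> borel_measurable borel" for f :: "real \<Rightarrow> real"
  proof -
    have "(\<integral>\<^sup>+y\<in>{-l..l}. ennreal ((f y * Suc n)\<^sup>2) \<partial>lborel) = (\<integral>\<^sup>+y. ennreal ((real (Suc n))\<^sup>2) * (ennreal ((f y)\<^sup>2) * indicator {-l..l} y) \<partial>lborel)"
      by (intro nn_integral_cong) (simp add: power_mult_distrib ennreal_mult' mult_ac del: of_nat_Suc)
    also have "\<dots> = ennreal ((real (Suc n))\<^sup>2) * (\<integral>\<^sup>+y\<in>{-l..l}. ennreal ((f y)\<^sup>2) \<partial>lborel)"
      by (rule nn_integral_cmult) measurable
    finally show ?thesis .
  qed
  show ?thesis unfolding qb_def
    by (subst (1 2) e, measurable) (intro mult_left_mono rad_nonexp slice_slice, simp)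
qed

text \<open>Only the cell containing |y| contributes, and its nodes shrink to |y| from both sides,
  so \<open>straddle\<close> applies to the radial profile. The points 0 and l are excluded because
  there v is not locally the radial profile in a single variable sign.\<close>

lemma qy_limit:
  assumes D0: "GDERIV v (x, y) :> D0" and y: "0 < \<bar>y\<bar>" "\<bar>y\<bar> < l"
  shows "(\<lambda>n. qy x n y) \<longlonglongrightarrow> (snd D0)\<^sup>2"
proof -
  let ?h = "rad l (\<lambda>z. u (x, z))"
  define r where "r = \<bar>y\<bar>"
  \<comment> \<open>The index of the cell that contains r; the cells are half-open, so it is
    unique.\<close>
  define j where "j n = nat \<lfloor>r * Suc n / l\<rfloor>" for n :: nat
  have r: "0 < r" "r < l" using y by (auto simp: r_def)
  have fl: "real k * l / Suc n \<le> r \<and> r < real (Suc k) * l / Suc n \<longleftrightarrow> k = j n" for k n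
  proof -
    have "real k * l / Suc n \<le> r \<and> r < real (Suc k) * l / Suc n \<longleftrightarrow> real k \<le> r * Suc n / l \<and> r * Suc n / l < real k + 1"
      using l by (simp add: field_simps)
    also have "\<dots> \<longleftrightarrow> \<lfloor>r * Suc n / l\<rfloor> = int k" by (auto simp: floor_eq_iff)
    also have "\<dots> \<longleftrightarrow> k = j n" using r l by (auto simp: j_def)
    finally show ?thesis .
  qed
  have jn: "j n < Suc n" for n
  proof (rule ccontr)
    assume "\<not> j n < Suc n"
    then have "real (Suc n) * l \<le> real (j n) * l" using l by (intro mult_right_mono) auto
    then have "l \<le> real (j n) * l / Suc n" by (simp add: field_simps)
    then show False using fl[of "j n" n] r by simp
  qed
  have q: "qy x n y = ((?h (real (Suc (j n)) * l / Suc n) - ?h (real (j n) * l / Suc n)) / (real (Suc (j n)) * l / Suc n - real (j n) * l / Suc n))\<^sup>2" for n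
  proof -
    have "qy x n y = (\<Sum>k<Suc n. if k = j n then ((?h (real k * l / Suc n) - ?h (real (Suc k) * l / Suc n)) * (Suc n / l))\<^sup>2 else 0)"
      unfolding qy_def by (intro sum.cong refl) (use fl in \<open>auto simp: indicator_def r_def\<close>)
    also have "\<dots> = ((?h (real (j n) * l / Suc n) - ?h (real (Suc (j n)) * l / Suc n)) * (Suc n / l))\<^sup>2"
      using jn by (simp only: sum.delta finite_lessThan lessThan_iff if_True)
    also have "\<dots> = ((?h (real (Suc (j n)) * l / Suc n) - ?h (real (j n) * l / Suc n)) * (Suc n / l))\<^sup>2"
      unfolding power_mult_distrib by (simp only: power2_commute)
    also have "real (Suc n) / l = 1 / (real (Suc (j n)) * l / Suc n - real (j n) * l / Suc n)"
      using l by (simp add: distrib_right add_divide_distrib)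
    finally show ?thesis by simp
  qed
  have lim0: "(\<lambda>n. l / real (Suc n)) \<longlonglongrightarrow> 0" by (rule LIMSEQ_Suc[OF lim_const_over_n])
  have gap: "real (Suc (j n)) * l / Suc n = real (j n) * l / Suc n + l / Suc n" for n
    by (simp add: distrib_right add_divide_distrib)
  have b: "real (j n) * l / Suc n \<le> r" "r < real (Suc (j n)) * l / Suc n" for n using fl[of "j n" n] by auto
  have lima: "(\<lambda>n. real (j n) * l / Suc n) \<longlonglongrightarrow> r"
  proof (rule real_tendsto_sandwich[of "\<lambda>n. r - l / Suc n" _ _ "\<lambda>n. r"])
    show "(\<lambda>n. r - l / real (Suc n)) \<longlonglongrightarrow> r" using tendsto_diff[OF tendsto_const[of r] lim0] by simp
    show "\<forall>\<^sub>F n in sequentially. r - l / real (Suc n) \<le> real (j n) * l / real (Suc n)"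
      using b(2) gap by (intro always_eventually allI) (smt (verit))
  qed (use b in \<open>auto intro: always_eventually\<close>)
  have limb: "(\<lambda>n. real (Suc (j n)) * l / Suc n) \<longlonglongrightarrow> r"
    using tendsto_add[OF lima lim0] unfolding gap by simp
  \<comment> \<open>The sign of y. It converts the derivative in y into one in |y| and disappears on
    squaring.\<close>
  define s :: real where "s = (if y > 0 then 1 else -1)"
  have s: "s = 1 \<or> s = -1" "y = s * r" using y by (auto simp: r_def s_def)
  have "((\<lambda>t. v (x, s * t)) has_real_derivative snd D0 * s) (at r)"
  proof (rule DERIV_chain'[where f = "\<lambda>t. s * t" and g = "\<lambda>t. v (x, t)"])
    show "((*) s has_real_derivative s) (at r)" by (auto intro!: derivative_eq_intros)
    show "((\<lambda>t. v (x, t)) has_real_derivative snd D0) (at (s * r))"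
      using GDERIV_path(2)[OF D0] s by simp
  qed
  moreover have ev: "eventually (\<lambda>t. v (x, s * t) = ?h t) (nhds r)"
  proof -
    have "eventually (\<lambda>t. t \<in> {0<..<l}) (nhds r)" using r by (intro eventually_nhds_in_open) auto
    then show ?thesis by eventually_elim (use s in \<open>auto simp: v_eq abs_mult\<close>)
  qed
  ultimately have "(?h has_real_derivative snd D0 * s) (at r)"
    using DERIV_cong_ev[OF refl ev refl] by simp
  then have "(\<lambda>n. (?h (real (Suc (j n)) * l / Suc n) - ?h (real (j n) * l / Suc n)) / (real (Suc (j n)) * l / Suc n - real (j n) * l / Suc n)) \<longlonglongrightarrow> snd D0 * s"
  proof (rule straddle[OF _ _ _ _ lima limb])
    show "real (j n) * l / Suc n < real (Suc (j n)) * l / Suc n" for n using b[of n] by linarith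
  qed (use b in \<open>auto intro: less_imp_le\<close>)
  then have "(\<lambda>n. qy x n y) \<longlonglongrightarrow> (snd D0 * s)\<^sup>2" unfolding q by (rule tendsto_power)
  then show ?thesis using s by (auto simp: power_mult_distrib)
qed

text \<open>Where v is differentiable the quotients converge to its squared gradient, so Fatou
  bounds \<open>sym_energy\<close> by the limit inferior of their integrals \<open>c n\<close>.
  These satisfy c n + G \<le> E n; in E n the vertical part is the exact energy of u, independent of
  n, and the horizontal part converges by dominated convergence.\<close>

lemma slice_energy_gap:
  assumes Q: "\<And>n. n > 0 \<Longrightarrow> ennreal (\<Sum>j<n. (rad l (\<lambda>z. u (x, z)) (real j * l / n) - rad l (\<lambda>z. u (x, z)) (real (Suc j) * l / n))\<^sup>2 * (2 * n / l)) + ennreal G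
    \<le> (\<integral>\<^sup>+y\<in>{-l..l}. ennreal ((snd (D (x, y)))\<^sup>2) \<partial>lborel)"
  shows "sym_energy x + ennreal G \<le> slice_energy x"
proof -
  define q where "q n y = ennreal (qy x n y + (\<Sum>b\<in>Basis. qb x n b y)) * indicator {-l..l} y" for n y
  define c where "c n = integral\<^sup>N lborel (q n)" for n
  define E where "E n = (\<integral>\<^sup>+y\<in>{-l..l}. ennreal ((snd (D (x, y)))\<^sup>2) \<partial>lborel)
    + (\<Sum>b\<in>Basis. (\<integral>\<^sup>+y\<in>{-l..l}. ennreal (((u (x + (1 / Suc n) *\<^sub>R b, y) - u (x, y)) * Suc n)\<^sup>2) \<partial>lborel))" for n
  have [measurable]: "q n \<in> borel_measurable borel" for n unfolding q_def by measurable
  have cE: "c n + ennreal G \<le> E n" for n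
  proof -
    have "c n = (\<integral>\<^sup>+y. ennreal (qy x n y) * indicator {-l..l} y + (\<Sum>b\<in>Basis. ennreal (qb x n b y) * indicator {-l..l} y) \<partial>lborel)"
      unfolding c_def q_def by (intro nn_integral_cong indicator_sum_split qy_nonneg qb_nonneg)
    also have "\<dots> = (\<integral>\<^sup>+y\<in>{-l..l}. ennreal (qy x n y) \<partial>lborel)
      + (\<integral>\<^sup>+y. (\<Sum>b\<in>Basis. ennreal (qb x n b y) * indicator {-l..l} y) \<partial>lborel)"
      by (rule nn_integral_add) measurable
    also have "(\<integral>\<^sup>+y. (\<Sum>b\<in>Basis. ennreal (qb x n b y) * indicator {-l..l} y) \<partial>lborel)
      = (\<Sum>b\<in>Basis. \<integral>\<^sup>+y\<in>{-l..l}. ennreal (qb x n b y) \<partial>lborel)"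
      by (rule nn_integral_sum) measurable
    finally have "c n + ennreal G = ((\<integral>\<^sup>+y\<in>{-l..l}. ennreal (qy x n y) \<partial>lborel) + ennreal G) + (\<Sum>b\<in>Basis. \<integral>\<^sup>+y\<in>{-l..l}. ennreal (qb x n b y) \<partial>lborel)"
      by (simp add: ac_simps)
    also have "\<dots> \<le> E n" unfolding E_def
      by (intro add_mono sum_mono qb_integral order_trans[OF add_right_mono[OF qy_integral] Q[of "Suc n"]]) simp
    finally show ?thesis .
  qed
  have "sym_energy x \<le> (\<integral>\<^sup>+y. liminf (\<lambda>n. q n y) \<partial>lborel)"
    unfolding sym_energy_def
  proof (rule nn_integral_mono_AE)
    have "AE y in lborel. y \<noteq> 0 \<and> y \<noteq> l \<and> y \<noteq> -l" by (intro AE_conjI AE_lborel_singleton)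
    then show "AE y in lborel. ennreal ((norm (grad v (x, y)))\<^sup>2) * indicator {-l..l} y \<le> liminf (\<lambda>n. q n y)"
    proof eventually_elim
      case (elim y)
      show ?case
      proof (cases "y \<in> {-l..l} \<and> (\<exists>D0. GDERIV v (x, y) :> D0)")
        case True
        then obtain D0 where D0: "GDERIV v (x, y) :> D0" by blast
        have y: "0 < \<bar>y\<bar>" "\<bar>y\<bar> < l" "y \<in> {-l..l}" using elim True by auto
        have "(\<lambda>n. qb x n b y) \<longlonglongrightarrow> (inner (fst D0) b)\<^sup>2" for b
        proof -
          have "qb x n b y = ((v (x + (1 / Suc n) *\<^sub>R b, y) - v (x, y)) * Suc n)\<^sup>2" for n
            using y by (simp add: qb_def v_eq min_def)
          then show ?thesis using GDERIV_quotient[OF D0, of b] by (simp only: tendsto_power)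
        qed
        then have "(\<lambda>n. qy x n y + (\<Sum>b\<in>Basis. qb x n b y)) \<longlonglongrightarrow> (norm D0)\<^sup>2"
          unfolding norm_Pair_sq by (intro tendsto_add tendsto_sum qy_limit[OF D0 y(1,2)])
        then have "(\<lambda>n. q n y) \<longlonglongrightarrow> ennreal ((norm D0)\<^sup>2)" using y(3) by (simp add: q_def tendsto_ennrealI)
        then have "liminf (\<lambda>n. q n y) = ennreal ((norm D0)\<^sup>2)" by (rule lim_imp_Liminf[rotated]) simp
        then show ?thesis using y(3) grad_eq[OF D0] by simp
      next
        case False
        \<comment> \<open>Here the default value 0 of \<open>grad\<close> makes the inequality
          trivial, so points without a gradient need no separate estimate.\<close>
        then have "y \<notin> {-l..l} \<or> grad v (x, y) = 0" by (auto simp: grad_def)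
        then show ?thesis by auto
      qed
    qed
  qed
  also have "\<dots> \<le> liminf c" unfolding c_def by (rule nn_integral_liminf) simp
  finally have Ac: "sym_energy x \<le> liminf c" .
  have "E \<longlonglongrightarrow> slice_energy x" unfolding E_def slice_energy_split by (intro tendsto_add tendsto_const tendsto_sum energy_b_limit)
  \<comment> \<open>Subtraction of G in \<open>ennreal\<close> is truncated, so the surplus is moved
    across only after checking that G is at most the right side, up to an arbitrary
    \<epsilon>.\<close>
  show ?thesis
  proof (rule ennreal_le_epsilon)
    fix e :: real assume fin: "slice_energy x < top" and e: "0 < e"
    then have "slice_energy x < slice_energy x + ennreal e" 
      by (cases "slice_energy x") (auto simp: ennreal_less_iff simp flip: ennreal_plus)
    with \<open>E \<longlonglongrightarrow> slice_energy x\<close> have ev: "eventually (\<lambda>n. E n < slice_energy x + ennreal e) sequentially" by (rule order_tendstoD)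
    then obtain n where "E n < slice_energy x + ennreal e" by (auto dest: eventually_happens)
    then have "ennreal G \<le> slice_energy x + ennreal e" 
      using order_trans[OF order_trans[OF _ cE[of n]] less_imp_le, of "ennreal G"] by (simp add: add_increasing)
    from ev have "eventually (\<lambda>n. c n \<le> slice_energy x + ennreal e - ennreal G) sequentially"
    proof eventually_elim
      case (elim n)
      have "c n = (c n + ennreal G) - ennreal G" by simp
      also have "\<dots> \<le> slice_energy x + ennreal e - ennreal G"
        using order_trans[OF cE[of n] less_imp_le[OF elim]] by (intro ennreal_minus_mono) auto
      finally show ?case .
    qed
    then have "liminf c \<le> slice_energy x + ennreal e - ennreal G" by (rule Liminf_le[rotated]) simp
    with Ac have "sym_energy x \<le> slice_energy x + ennreal e - ennreal G" by (rule order_trans)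
    then have "sym_energy x + ennreal G \<le> (slice_energy x + ennreal e - ennreal G) + ennreal G" by (rule add_right_mono)
    also have "\<dots> = slice_energy x + ennreal e" by (rule diff_add_cancel_ennreal) fact
    finally show "sym_energy x + ennreal G \<le> slice_energy x + ennreal e" .
  qed
qed

end

section \<open>Almost every slice is symmetric\<close>

text \<open>
  No measurability of \<open>f\<close> is assumed: the integral is then a lower integral. This is applied to
  the gradient of the symmetrization.
\<close>

lemma nn_integral_attained_below:
  fixes f :: "'a \<Rightarrow> ennreal"
  obtains F where "F \<in> borel_measurable M" "\<And>x. F x \<le> f x" "integral\<^sup>N M F = integral\<^sup>N M f"
proof -
  let ?A = "{g. simple_function M g \<and> g \<le> f}"
  have "(\<lambda>x. 0) \<in> ?A" by (auto simp: le_fun_def)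
  then have "?A \<noteq> {}" by blast
  from ennreal_SUP_countable_SUP[OF this, of "integral\<^sup>S M"] obtain I :: "nat \<Rightarrow> ennreal"
    where I: "range I \<subseteq> integral\<^sup>S M ` ?A" "integral\<^sup>N M f = (SUP n. I n)" unfolding nn_integral_def by blast
  have "\<forall>n. \<exists>g. g \<in> ?A \<and> I n = integral\<^sup>S M g" using I(1) by blast
  then obtain g where g: "\<And>n. g n \<in> ?A" "\<And>n. I n = integral\<^sup>S M (g n)" by metis
  have [measurable]: "g n \<in> borel_measurable M" for n using g(1)[of n] by (auto intro: borel_measurable_simple_function)
  define F where "F x = (SUP n. g n x)" for x
  have F: "F \<in> borel_measurable M" unfolding F_def by measurable
  have Ff: "F x \<le> f x" for x unfolding F_def using g(1) by (auto simp: le_fun_def intro!: SUP_least)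
  have "integral\<^sup>N M f \<le> integral\<^sup>N M F"
    unfolding I(2)
  proof (rule SUP_least)
    fix n
    have "I n = integral\<^sup>N M (g n)" using g[of n] by (simp add: nn_integral_eq_simple_integral)
    also have "\<dots> \<le> integral\<^sup>N M F" by (intro nn_integral_mono) (auto simp: F_def intro: SUP_upper)
    finally show "I n \<le> integral\<^sup>N M F" .
  qed
  moreover have "integral\<^sup>N M F \<le> integral\<^sup>N M f" using Ff by (intro nn_integral_mono) auto
  ultimately show ?thesis using that F Ff by (metis antisym)
qed

lemma cell_iff: "x \<in> cell l \<longleftrightarrow> (\<forall>i\<in>Basis. -l \<le> x \<bullet> i \<and> x \<bullet> i \<le> l)"
  by (simp add: cell_def mem_box)

lemma cell_Pair: "(x, y) \<in> cell l \<longleftrightarrow> x \<in> cell l \<and> y \<in> {-l..l}" for x :: "'a::euclidean_space" and y :: real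
  unfolding cell_iff Basis_prod_def by (auto simp: ball_Un)

context torus_C1 begin

lemma sym_energy_gain:
  assumes "periodic_C1.gain l (\<lambda>y. u (x, y)) (\<lambda>y. snd (D (x, y))) a b \<rho>"
    "slice_fun.mn l (\<lambda>y. u (x, y)) \<le> a" "a \<le> b" "b \<le> slice_fun.mx l (\<lambda>y. u (x, y))" "1 \<le> \<rho>"
  shows "sym_energy x + ennreal (4 * (\<rho> - 1) * (b - a)\<^sup>2 / l) \<le> slice_energy x"
  by (rule slice_energy_gap) (rule periodic_C1.partition_energy[OF slice_C1 assms])

text \<open>The case \<rho> = 1 of \<open>sym_energy_gain\<close>, in which the surplus
  vanishes.\<close>

lemma sym_energy_le: "sym_energy x \<le> slice_energy x"
proof -
  have "sym_energy x + ennreal (4 * (1 - 1) * (slice_fun.mx l (\<lambda>y. u (x, y)) - slice_fun.mn l (\<lambda>y. u (x, y)))\<^sup>2 / l) \<le> slice_energy x"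
    by (rule sym_energy_gain[OF periodic_C1.gain_base[OF slice_C1]]) (auto intro: slice_fun.mn_le_mx[OF slice_slice])
  then show ?thesis by simp
qed

lemma slice_energy_finite: "slice_energy x < \<infinity>"
proof -
  have "compact ((\<lambda>y. norm (D (x, y))) ` {-l..l})"
    by (intro compact_continuous_image continuous_intros contD') auto
  then obtain K where K: "\<And>y. y \<in> {-l..l} \<Longrightarrow> norm (D (x, y)) \<le> K"
    using compact_imp_bounded[THEN bounded_imp_bdd_above] unfolding bdd_above_def by (metis imageI)
  have "slice_energy x \<le> (\<integral>\<^sup>+y. ennreal (K\<^sup>2) * indicator {-l..l} y \<partial>lborel)"
    unfolding slice_energy_def using K by (intro nn_integral_mono) (auto simp: indicator_def intro!: ennreal_leI power_mono)
  also have "\<dots> < \<infinity>" using l by (simp add: nn_integral_cmult_indicator ennreal_mult_less_top)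
  finally show ?thesis .
qed

lemma no_gain_if_eq:
  assumes "sym_energy x = slice_energy x" "slice_fun.mn l (\<lambda>y. u (x, y)) \<le> a" "a < b" "b \<le> slice_fun.mx l (\<lambda>y. u (x, y))" "1 < \<rho>"
  shows "\<not> periodic_C1.gain l (\<lambda>y. u (x, y)) (\<lambda>y. snd (D (x, y))) a b \<rho>"
proof
  assume "periodic_C1.gain l (\<lambda>y. u (x, y)) (\<lambda>y. snd (D (x, y))) a b \<rho>"
  then have le: "slice_energy x + ennreal (4 * (\<rho> - 1) * (b - a)\<^sup>2 / l) \<le> slice_energy x" using sym_energy_gain[of x a b \<rho>] assms by auto
  obtain r where r: "slice_energy x = ennreal r" "0 \<le> r" using slice_energy_finite[of x] by (cases "slice_energy x") auto
  have "0 < 4 * (\<rho> - 1) * (b - a)\<^sup>2 / l" using assms l by simp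
  then show False using le r by (simp flip: ennreal_plus)
qed

lemma u_grad: "grad u p = D p" by (rule grad_eq[OF der])

lemma D_borel[measurable]: "D \<in> borel_measurable borel"
  by (intro borel_measurable_continuous_onI contD)

lemma cell_borel[measurable]: "cell l \<in> sets borel" unfolding cell_def by simp

lemma slice_energy_measurable[measurable]: "slice_energy \<in> borel_measurable borel"
proof -
  have "closed (UNIV \<times> {-l..l} :: ('a \<times> real) set)" by (intro closed_Times) auto
  then have [measurable]: "(UNIV \<times> {-l..l} :: ('a \<times> real) set) \<in> sets borel" by (rule borel_closed)
  have "(\<lambda>p. ennreal ((norm (D p))\<^sup>2) * indicator (UNIV \<times> {-l..l}) p) \<in> borel_measurable (borel :: ('a \<times> real) measure)" by measurable
  then have "(\<lambda>p. ennreal ((norm (D p))\<^sup>2) * indicator (UNIV \<times> {-l..l}) p) \<in> borel_measurable (lborel \<Otimes>\<^sub>M lborel)"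
    by (simp add: lborel_prod)
  from lborel.borel_measurable_nn_integral_fst[OF this] have "(\<lambda>x. slice_energy x) \<in> borel_measurable lborel"
    by (simp add: slice_energy_def indicator_times)
  then show ?thesis by simp
qed

lemma dirichlet_u: "dirichlet l u = (\<integral>\<^sup>+x\<in>cell l. slice_energy x \<partial>lborel)"
proof -
  have [measurable]: "(\<lambda>p. ennreal ((norm (D p))\<^sup>2) * indicator (cell l) p) \<in> borel_measurable (lborel \<Otimes>\<^sub>M lborel)"
    by (simp add: lborel_prod)
  have "dirichlet l u = (\<integral>\<^sup>+p. ennreal ((norm (D p))\<^sup>2) * indicator (cell l) p \<partial>(lborel \<Otimes>\<^sub>M lborel))"
    by (simp add: dirichlet_def nn_integral_completion u_grad lborel_prod)
  also have "\<dots> = (\<integral>\<^sup>+x. \<integral>\<^sup>+y. ennreal ((norm (D (x, y)))\<^sup>2) * indicator (cell l) (x, y) \<partial>lborel \<partial>lborel)"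
    by (rule lborel.nn_integral_fst[symmetric]) measurable
  also have "\<dots> = (\<integral>\<^sup>+x\<in>cell l. slice_energy x \<partial>lborel)"
    unfolding slice_energy_def by (intro nn_integral_cong) (auto simp: indicator_def cell_Pair)
  finally show ?thesis .
qed

lemma dirichlet_finite: "dirichlet l u < \<infinity>"
proof -
  have "compact ((\<lambda>p. norm (D p)) ` cell l)"
    unfolding cell_def by (intro compact_continuous_image continuous_intros continuous_on_subset[OF contD]) auto
  then obtain K where K: "\<And>p. p \<in> cell l \<Longrightarrow> norm (D p) \<le> K"
    using compact_imp_bounded[THEN bounded_imp_bdd_above] unfolding bdd_above_def by (metis imageI)
  have "dirichlet l u \<le> (\<integral>\<^sup>+p. ennreal (K\<^sup>2) * indicator (cell l :: ('a \<times> real) set) p \<partial>lborel)"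
    unfolding dirichlet_def nn_integral_completion u_grad
    using K by (intro nn_integral_mono) (auto simp: indicator_def intro!: ennreal_leI power_mono)
  also have "\<dots> = ennreal (K\<^sup>2) * emeasure lborel (cell l :: ('a \<times> real) set)"
    by (rule nn_integral_cmult_indicator) (simp add: cell_def)
  also have "\<dots> < \<infinity>" 
    using emeasure_bounded_finite[of "cell l :: ('a \<times> real) set"] by (auto simp: cell_def ennreal_mult_less_top)
  finally show ?thesis .
qed

lemma AE_sym_energy_eq:
  assumes eq: "dirichlet l u = dirichlet l v"
  shows "AE x in lborel. x \<in> cell l \<longrightarrow> sym_energy x = slice_energy x"
proof -
  let ?f = "\<lambda>p. ennreal ((norm (grad v p))\<^sup>2) * indicator (cell l) p"
  obtain F where F: "F \<in> borel_measurable lborel" "\<And>p. F p \<le> ?f p" "integral\<^sup>N lborel F = integral\<^sup>N lborel ?f"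
    using nn_integral_attained_below[of lborel ?f] by blast
  have Fm[measurable]: "F \<in> borel_measurable (lborel \<Otimes>\<^sub>M lborel)" using F(1) by (simp add: lborel_prod)
  define \<Phi> where "\<Phi> x = (\<integral>\<^sup>+y. F (x, y) \<partial>lborel)" for x
  have [measurable]: "\<Phi> \<in> borel_measurable borel"
    using lborel.borel_measurable_nn_integral_fst[OF Fm] by (simp add: \<Phi>_def[abs_def])
  have \<Phi>A: "\<Phi> x \<le> sym_energy x * indicator (cell l) x" for x
  proof -
    have "\<Phi> x \<le> (\<integral>\<^sup>+y. ?f (x, y) \<partial>lborel)" unfolding \<Phi>_def by (intro nn_integral_mono F)
    also have "\<dots> = sym_energy x * indicator (cell l) x" unfolding sym_energy_def by (auto simp: indicator_def cell_Pair)
    finally show ?thesis .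
  qed
  have \<Phi>B: "\<Phi> x \<le> slice_energy x * indicator (cell l) x" for x
    using \<Phi>A[of x] sym_energy_le[of x] by (auto simp: indicator_def split: if_splits)
  have "(\<integral>\<^sup>+x. \<Phi> x \<partial>lborel) = integral\<^sup>N (lborel \<Otimes>\<^sub>M lborel) F" unfolding \<Phi>_def by (rule lborel.nn_integral_fst[OF Fm])
  also have "\<dots> = dirichlet l v" using F(3) by (simp add: lborel_prod dirichlet_def nn_integral_completion)
  finally have I: "(\<integral>\<^sup>+x. \<Phi> x \<partial>lborel) = (\<integral>\<^sup>+x\<in>cell l. slice_energy x \<partial>lborel)" using eq dirichlet_u by simp
  have fin: "(\<integral>\<^sup>+x. \<Phi> x \<partial>lborel) \<noteq> \<infinity>" using dirichlet_finite unfolding dirichlet_u I by auto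
  have "(\<integral>\<^sup>+x. slice_energy x * indicator (cell l) x - \<Phi> x \<partial>lborel) = (\<integral>\<^sup>+x\<in>cell l. slice_energy x \<partial>lborel) - (\<integral>\<^sup>+x. \<Phi> x \<partial>lborel)"
    using fin \<Phi>B by (intro nn_integral_diff) auto
  also have "\<dots> = 0" using fin unfolding I by (simp add: less_top)
  finally have "AE x in lborel. slice_energy x * indicator (cell l) x - \<Phi> x = 0" by (subst (asm) nn_integral_0_iff_AE) auto
  then show ?thesis
  proof eventually_elim
    case (elim x)
    show ?case
    proof
      assume x: "x \<in> cell l"
      have "slice_energy x \<le> \<Phi> x" using elim x slice_energy_finite[of x] by (auto simp: ennreal_minus_eq_0)
      also have "\<Phi> x \<le> sym_energy x" using \<Phi>A[of x] x by simp
      finally show "sym_energy x = slice_energy x" using sym_energy_le[of x] by simp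
    qed
  qed
qed

text \<open>A Lebesgue null set lies in a Borel null set, and almost every slice of the latter is
  null.\<close>

lemma AE_crit:
  assumes N: "{(x, y). (x, y) \<in> cell l \<and> deriv (\<lambda>s. u (x, s)) y = 0 \<and>
            slice_min l u x < u (x, y) \<and> u (x, y) < slice_max l u x} \<in> null_sets lebesgue"
  shows "AE x in lborel. x \<in> cell l \<longrightarrow> {y \<in> {-l..l}. snd (D (x, y)) = 0 \<and> slice_min l u x < u (x, y) \<and> u (x, y) < slice_max l u x} \<in> null_sets lborel"
proof -
  obtain N' where N': "N' \<in> null_sets lborel" "{(x, y). (x, y) \<in> cell l \<and> deriv (\<lambda>s. u (x, s)) y = 0 \<and>
            slice_min l u x < u (x, y) \<and> u (x, y) < slice_max l u x} \<subseteq> N'"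
    using N unfolding null_sets_completion_iff2 by blast
  have "AE p in lborel. p \<notin> N'" by (rule AE_not_in[OF N'(1)])
  then have "AE p in lborel \<Otimes>\<^sub>M lborel. p \<notin> N'" by (subst lborel_prod)
  from lborel_pair.AE_pair[OF this] show ?thesis
  proof eventually_elim
    case (elim x)
    show ?case
    proof
      assume x: "x \<in> cell l"
      let ?Z = "{y \<in> {-l..l}. snd (D (x, y)) = 0 \<and> slice_min l u x < u (x, y) \<and> u (x, y) < slice_max l u x}"
      have "deriv (\<lambda>s. u (x, s)) y = snd (D (x, y))" for y by (rule DERIV_imp_deriv[OF GDERIV_path(2)[OF der]])
      then have sub: "(x, y) \<in> N'" if "y \<in> ?Z" for y using that N'(2) x by (auto simp: cell_Pair)
      have "?Z \<in> sets lborel" by simp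
      moreover have "AE y in lborel. y \<notin> ?Z" using elim by eventually_elim (use sub in blast)
      ultimately show "?Z \<in> null_sets lborel" by (subst AE_iff_null_sets) auto
    qed
  qed
qed

end

locale equality_case = torus_C1 +
  assumes nonconst: "\<And>x. x \<in> cell l \<Longrightarrow> slice_min l u x < slice_max l u x"
    and crit: "{(x, y). (x, y) \<in> cell l \<and> deriv (\<lambda>s. u (x, s)) y = 0 \<and>
            slice_min l u x < u (x, y) \<and> u (x, y) < slice_max l u x} \<in> null_sets lebesgue"
    and equal: "dirichlet l u = dirichlet l (steiner l u)"
begin

lemma AE_centre: "AE x in lborel. x \<in> cell l \<longrightarrow> sym_energy x = slice_energy x \<and> (\<exists>c. centre l (\<lambda>y. u (x, y)) c)"
proof -
  have "AE x in lborel. x \<in> cell l \<longrightarrow> sym_energy x = slice_energy x" by (rule AE_sym_energy_eq) (simp add: equal v_def)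
  then show ?thesis using AE_crit[OF crit]
  proof eventually_elim
    case (elim x)
    show ?case
    proof
      assume x: "x \<in> cell l"
      have m: "slice_min l u x = slice_fun.mn l (\<lambda>y. u (x, y))" "slice_max l u x = slice_fun.mx l (\<lambda>y. u (x, y))"
        by (simp_all add: slice_min_def slice_max_def slice_fun.mn_def[OF slice_slice] slice_fun.mx_def[OF slice_slice])
      have "no_gain l (\<lambda>y. u (x, y)) (\<lambda>y. snd (D (x, y)))"
      proof (rule no_gain.intro[OF slice_C1], unfold_locales)
        show "slice_fun.mn l (\<lambda>y. u (x, y)) < slice_fun.mx l (\<lambda>y. u (x, y))" using nonconst[OF x] m by simp
        show "{y \<in> {- l..l}. snd (D (x, y)) = 0 \<and> slice_fun.mn l (\<lambda>y. u (x, y)) < u (x, y) \<and> u (x, y) < slice_fun.mx l (\<lambda>y. u (x, y))} \<in> null_sets lborel"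
          using elim(2) x unfolding m by blast
      qed (use elim(1) x no_gain_if_eq in blast)
      then show "sym_energy x = slice_energy x \<and> (\<exists>c. centre l (\<lambda>y. u (x, y)) c)"
        using no_gain.centre_exists elim(1) x by blast
    qed
  qed
qed

end

section \<open>The centre does not depend on the slice\<close>

lemma centre_shift:
  assumes "\<And>y. g (y + 2 * l) = g y" "centre l g c"
  shows "centre l g (c + 2 * l * of_int k)"
proof -
  have a: "g (c + 2 * l * of_int k + s) = g (c + s)" for s
    using periodic_int[of g "2 * l" "c + s" k] assms(1) by (simp add: add.assoc add.commute add.left_commute)
  have b: "g (c + 2 * l * of_int k - s) = g (c - s)" for s
    using periodic_int[of g "2 * l" "c - s" k] assms(1) by (simp add: algebra_simps)
  show ?thesis using assms(2) unfolding centre_def a b .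
qed

text \<open>Each centre is a maximum point, so g takes the same value at c and c + d and, being
  monotone in between, is constant within distance d of c. The composition of the two reflections is
  the translation by 2d, which spreads this constant value everywhere.\<close>

lemma centre_unique_pos:
  assumes per: "\<And>y. g (y + 2 * l) = g y" and c: "centre l g c" "centre l g (c + d)" and d: "0 < d" "d \<le> l"
  shows "g y = g c"
proof -
  have s1: "g (c + s) = g (c - s)" and s2: "g (c + d + s) = g (c + d - s)" for s
    using c by (auto simp: centre_def)
  have m1: "g (c + s') \<le> g (c + s)" if "0 \<le> s" "s \<le> s'" "s' \<le> l" for s s' using c(1) that by (auto simp: centre_def)
  have m2: "g (c + d + s') \<le> g (c + d + s)" if "0 \<le> s" "s \<le> s'" "s' \<le> l" for s s' using c(2) that by (auto simp: centre_def)
  have "g c \<le> g (c + d)" using m2[of 0 d] s2[of d] d by simp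
  then have near: "g (c + s) = g c" if "\<bar>s\<bar> \<le> d" for s
    using m1[of 0 "\<bar>s\<bar>"] m1[of "\<bar>s\<bar>" d] s1[of s] that d by (cases "s \<ge> 0") auto
  define f where "f s = g (c + s)" for s
  have "f (s + 2 * d) = f s" for s
    using s2[of "s + d"] s1[of s] by (simp add: f_def algebra_simps)
  then have "f (0 + circle_rep d (y - c)) = f (0 + (y - c))" by (rule periodic_circle_rep)
  then show ?thesis using near[OF abs_circle_rep_le[OF d(1)]] by (simp add: f_def)
qed

lemma centre_unique:
  assumes per: "\<And>y. g (y + 2 * l) = g y" and c: "centre l g c" "centre l g (c + d)" and d: "\<bar>d\<bar> \<le> l"
    and ne: "g y \<noteq> g z"
  shows "d = 0"
proof (rule ccontr)
  assume "d \<noteq> 0"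
  then consider "0 < d" | "d < 0" by linarith
  then show False
  proof cases
    case 1
    then have "g w = g c" for w using d by (intro centre_unique_pos[OF per c]) auto
    then show False using ne by metis
  next
    case 2
    then have "g w = g (c + d)" for w using d c by (intro centre_unique_pos[OF per c(2), of "-d"]) auto
    then show False using ne by metis
  qed
qed

lemma nn_integral_recentre:
  fixes f :: "real \<Rightarrow> ennreal"
  assumes l: "l > 0" and m[measurable]: "f \<in> borel_measurable borel" and per: "\<And>y. f (y + 2 * l) = f y"
  shows "(\<integral>\<^sup>+y\<in>{-l..l}. f y \<partial>lborel) = (\<integral>\<^sup>+z\<in>{-l..l}. f (c + z) \<partial>lborel)"
proof -
  \<comment> \<open>Reduced modulo 2l, because \<open>nn_integral_window\<close> shifts by at most
    one period.\<close>
  define c' where "c' = circle_rep l c"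
  have c': "\<bar>c'\<bar> \<le> l" unfolding c'_def by (rule abs_circle_rep_le[OF l])
  have "(\<integral>\<^sup>+y\<in>{-l..-l + 2 * l}. f y \<partial>lborel) = (\<integral>\<^sup>+y\<in>{c' - l..c' - l + 2 * l}. f y \<partial>lborel)"
  proof (cases "0 \<le> c'")
    case True
    then show ?thesis using c' by (intro nn_integral_window m per) auto
  next
    case False
    then show ?thesis using c' by (intro nn_integral_window[symmetric] m per) auto
  qed
  also have "\<dots> = (\<integral>\<^sup>+y. f y * indicator {c' - l..c' + l} y \<partial>lborel)" by (simp add: algebra_simps)
  also have "\<dots> = (\<integral>\<^sup>+z. f (c' + 1 * z) * indicator {c' - l..c' + l} (c' + 1 * z) \<partial>lborel)"
    by (subst nn_integral_real_affine[where c = 1 and t = c']) auto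
  also have "\<dots> = (\<integral>\<^sup>+z\<in>{-l..l}. f (c + z) \<partial>lborel)"
  proof (rule nn_integral_cong)
    fix z
    have "f (z + circle_rep l c) = f (z + c)" by (rule periodic_circle_rep[of f]) (rule per)
    then show "f (c' + 1 * z) * indicator {c' - l..c' + l} (c' + 1 * z) = f (c + z) * indicator {-l..l} z"
      by (auto simp: c'_def indicator_def add.commute)
  qed
  finally show ?thesis by simp
qed

text \<open>The superlevel sets of g, measured in the period around c, are already centred intervals
  up to their endpoints, so rearranging only moves c to 0.\<close>

lemma (in periodic_C1) rad_centre:
  assumes c: "centre l g c" and r: "0 \<le> r" "r \<le> l"
  shows "rad l g r = g (c + r)"
proof -
  let ?k = "\<lambda>s. g (c + s)"
  have sym: "?k \<bar>s\<bar> = ?k s" for s using c by (cases "s \<ge> 0") (auto simp: centre_def)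
  have dec: "?k s' \<le> ?k s" if "0 \<le> s" "s \<le> s'" "s' \<le> l" for s s' using c that by (auto simp: centre_def)
  have mu: "ennreal (mu t) = emeasure lborel {s \<in> {-l..l}. t < ?k s}" for t
  proof -
    have "ennreal (mu t) = emeasure lborel {z \<in> {-l..l}. t < g z}"
      unfolding mu_lborel using emeasure_eq_measure2[OF superlevel_fmeasurable(1)[of t]] by simp
    also have "\<dots> = (\<integral>\<^sup>+y. indicator {z \<in> {-l..l}. t < g z} y \<partial>lborel)" by simp
    also have "\<dots> = (\<integral>\<^sup>+y\<in>{-l..l}. indicator {z. t < g z} y \<partial>lborel)"
      by (intro nn_integral_cong) (auto simp: indicator_def)
    also have "\<dots> = (\<integral>\<^sup>+s\<in>{-l..l}. indicator {z. t < g z} (c + s) \<partial>lborel)"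
      by (rule nn_integral_recentre[OF l]) (auto simp: indicator_def per)
    also have "\<dots> = (\<integral>\<^sup>+s. indicator {s \<in> {-l..l}. t < ?k s} s \<partial>lborel)"
      by (intro nn_integral_cong) (auto simp: indicator_def)
    also have "\<dots> = emeasure lborel {s \<in> {-l..l}. t < ?k s}" by (rule nn_integral_indicator) measurable
    finally show ?thesis .
  qed
  have top: "g y \<le> ?k 0" for y
  proof -
    have "g y = g (c + circle_rep l (y - c))" using periodic_circle_rep[of g l c "y - c"] per by simp
    also have "\<dots> = ?k \<bar>circle_rep l (y - c)\<bar>" by (simp only: sym)
    also have "\<dots> \<le> ?k 0" using abs_circle_rep_le[OF l] by (intro dec) auto
    finally show ?thesis .
  qed
  show ?thesis
  proof (rule antisym)
    show "?k r \<le> rad l g r"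
    proof (rule field_le_epsilon)
      fix e :: real assume e: "e > 0"
      let ?t = "?k r - e"
      have "{-r..r} \<subseteq> {s \<in> {-l..l}. ?t < ?k s}"
      proof
        fix s assume s: "s \<in> {-r..r}"
        then have "?k r \<le> ?k \<bar>s\<bar>" using r by (intro dec) auto
        then show "s \<in> {s \<in> {-l..l}. ?t < ?k s}" using s r e by (auto simp: sym)
      qed
      then have "emeasure lborel {-r..r} \<le> ennreal (mu ?t)" unfolding mu by (intro emeasure_mono) measurable
      then have "2 * r \<le> mu ?t" using r mu_nonneg by simp
      moreover have "\<exists>z\<in>{-l..l}. ?t < g z"
        using periodic_circle_rep[of g l 0 "c + r"] per e mem_W[of "c + r"] by (intro bexI[of _ "circle_rep l (c + r)"]) auto
      ultimately have "?t \<in> cand r" by (simp add: cand_def)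
      then have "?t \<le> rad l g r" unfolding rad_cand by (rule cSup_upper[OF _ cand_bdd])
      then show "?k r \<le> rad l g r + e" by simp
    qed
    show "rad l g r \<le> ?k r"
    proof (cases "r = 0")
      case True
      obtain y where "g y = mx" using mx_attained by metis
      then show ?thesis using top[of y] True by (simp add: rad_0)
    next
      case False
      show ?thesis
      proof (rule ccontr)
        assume "\<not> rad l g r \<le> ?k r"
        then obtain t where t: "?k r < t" "t < rad l g r" by (meson dense not_le)
        have "open {s. ?k s < t}" by (intro open_Collect_less continuous_intros continuous_on_compose2[OF cont]) auto
        then obtain e where e: "e > 0" "ball r e \<subseteq> {s. ?k s < t}" using t by (metis mem_Collect_eq openE)
        \<comment> \<open>A slightly smaller radius at which the value is still below t. It exists
          only for r > 0, so r = 0 was settled by \<open>rad_0\<close>.\<close>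
        define r' where "r' = max 0 (r - e / 2)"
        have r': "0 \<le> r'" "r' < r" "r' \<in> ball r e" using e(1) False r by (auto simp: r'_def dist_real_def)
        have "{s \<in> {-l..l}. t < ?k s} \<subseteq> {-r'..r'}"
        proof
          fix s assume s: "s \<in> {s \<in> {-l..l}. t < ?k s}"
          have "\<not> r' \<le> \<bar>s\<bar>"
          proof
            assume "r' \<le> \<bar>s\<bar>"
            then have "?k \<bar>s\<bar> \<le> ?k r'" using s r' by (intro dec) auto
            then show False using s r'(3) e(2) by (auto simp: sym)
          qed
          then show "s \<in> {-r'..r'}" by auto
        qed
        then have "ennreal (mu t) \<le> emeasure lborel {-r'..r'}" unfolding mu by (intro emeasure_mono) auto
        then have "mu t \<le> 2 * r'" using r' by simp
        moreover have "r \<le> mu t / 2" by (rule rad_gtD[OF t(2) r(2)])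
        ultimately show False using r' by simp
      qed
    qed
  qed
qed

section \<open>Closed conditions on pairs of a slice and a centre\<close>

context torus_C1 begin

lemma D_per: "D (x, y + 2 * l) = D (x, y)"
proof -
  have "((\<lambda>p. u (p + (0, 2 * l))) has_derivative (\<lambda>h. inner h (D ((x, y) + (0, 2 * l))))) (at (x, y))"
    by (rule has_derivative_compose[where g = u and f = "\<lambda>p. p + (0, 2 * l)"])
      (use der in \<open>auto intro!: derivative_eq_intros simp: gderiv_def\<close>)
  moreover have "(\<lambda>p. u (p + (0, 2 * l))) = u" using per by (auto simp: fun_eq_iff)
  ultimately have "GDERIV u (x, y) :> D (x, y + 2 * l)" by (simp add: gderiv_def)
  then show ?thesis using grad_eq der by metis
qed

lemma v_centre:
  assumes c: "centre l (\<lambda>y. u (x, y)) c"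
  shows "v (x, z) = u (x, c + z)"
proof -
  have "v (x, z) = rad l (\<lambda>y. u (x, y)) \<bar>circle_rep l z\<bar>" by (simp add: v_def steiner_eq_rad)
  also have "\<dots> = u (x, c + \<bar>circle_rep l z\<bar>)"
    by (rule periodic_C1.rad_centre[OF slice_C1 c]) (auto simp: abs_circle_rep_le l)
  also have "\<dots> = u (x, c + circle_rep l z)" using c by (cases "circle_rep l z \<ge> 0") (auto simp: centre_def)
  also have "\<dots> = u (x, c + z)" using periodic_circle_rep[of "\<lambda>y. u (x, y)" l c z] per by simp
  finally show ?thesis .
qed

lemma slice_energy_recentre: "slice_energy x = (\<integral>\<^sup>+z\<in>{-l..l}. ennreal ((norm (D (x, c + z)))\<^sup>2) \<partial>lborel)"
  unfolding slice_energy_def by (rule nn_integral_recentre[OF l]) (auto simp: D_per)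

text \<open>The closed graph of the multivalued centre map. With compactness of the range of centres
  it extends existence from almost every slice to every slice and gives continuity of the
  branches.\<close>

lemma closed_centres: "closed {p. centre l (\<lambda>y. u (fst p, y)) (snd p)}"
proof -
  have "{p. centre l (\<lambda>y. u (fst p, y)) (snd p)} = (\<Inter>s. {p. u (fst p, snd p + s) = u (fst p, snd p - s)})
    \<inter> (\<Inter>(s, s')\<in>{(s, s'). 0 \<le> s \<and> s \<le> s' \<and> s' \<le> l}. {p. u (fst p, snd p + s') \<le> u (fst p, snd p + s)})"
    by (auto simp: centre_def)
  moreover have "closed {p. u (fst p, snd p + s) = u (fst p, snd p - s)}" for s
    by (intro closed_Collect_eq contu' continuous_intros)
  moreover have "closed {p. u (fst p, snd p + s') \<le> u (fst p, snd p + s)}" for s s'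
    by (intro closed_Collect_le contu' continuous_intros)
  ultimately show ?thesis by (auto intro!: closed_Int closed_INT)
qed

text \<open>By \<open>D_reflect\<close> this evenness holds if the gradient of the centre vanishes.
  Stated through the continuous D, it passes to limits without continuity of that gradient being
  known.\<close>

lemma closed_even: "closed {p. \<forall>z. fst (D (fst p, snd p + z)) = fst (D (fst p, snd p - z))}"
proof -
  have "{p. \<forall>z. fst (D (fst p, snd p + z)) = fst (D (fst p, snd p - z))}
     = (\<Inter>z. {p. fst (D (fst p, snd p + z)) = fst (D (fst p, snd p - z))})" by auto
  moreover have "closed {p. fst (D (fst p, snd p + z)) = fst (D (fst p, snd p - z))}" for z
    by (intro closed_Collect_eq continuous_intros contD')
  ultimately show ?thesis by (auto intro!: closed_INT)
qed

end

lemma closed_project_snd: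
  fixes T :: "('a::euclidean_space \<times> 'b::euclidean_space) set"
  assumes "compact K" "closed T"
  shows "closed {x. \<exists>c\<in>K. (x, c) \<in> T}"
proof -
  have "closed ((\<lambda>p. (snd p, fst p)) -` T)"
    using assms(2) by (intro continuous_closed_vimage) (auto intro!: continuous_intros)
  from closed_compact_projection[OF assms(1) this] show ?thesis by (simp add: Bex_def vimage_def)
qed

text \<open>Derivatives of the centre are taken at interior points, and convexity of the box gives
  constancy; the boundary is recovered by taking the closure.\<close>

definition open_cell :: "real \<Rightarrow> 'a::euclidean_space set" where "open_cell l = box (- (l *\<^sub>R One)) (l *\<^sub>R One)"

lemma open_cell_props: "open (open_cell l :: 'a::euclidean_space set)" "convex (open_cell l :: 'a set)" "open_cell l \<subseteq> (cell l :: 'a set)"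
  and closure_open_cell: "l > 0 \<Longrightarrow> closure (open_cell l :: 'a set) = cell l"
  and open_cell_nonempty: "l > 0 \<Longrightarrow> (open_cell l :: 'a set) \<noteq> {}"
proof -
  show "open (open_cell l :: 'a set)" "convex (open_cell l :: 'a set)" "open_cell l \<subseteq> (cell l :: 'a set)"
    by (auto simp: open_cell_def cell_def open_box convex_box intro: box_subset_cbox[THEN subsetD])
  assume l: "l > 0"
  have "(0::'a) \<in> box (- (l *\<^sub>R One)) (l *\<^sub>R One)" using l by (simp add: mem_box)
  then have ne: "box (- (l *\<^sub>R One)) (l *\<^sub>R One) \<noteq> ({} :: 'a set)" by blast
  then show "(open_cell l :: 'a set) \<noteq> {}" by (simp add: open_cell_def)
  show "closure (open_cell l :: 'a set) = cell l" unfolding open_cell_def cell_def using ne by (rule closure_box)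
qed

section \<open>Local branches of the centre and their derivatives\<close>

context equality_case begin

lemma u_nonconst: assumes "x \<in> cell l" obtains y z where "u (x, y) \<noteq> u (x, z)"
proof -
  have "slice_fun.mn l (\<lambda>y. u (x, y)) < slice_fun.mx l (\<lambda>y. u (x, y))"
    using nonconst[OF assms] by (simp add: slice_min_def slice_max_def slice_fun.mn_def[OF slice_slice] slice_fun.mx_def[OF slice_slice])
  moreover obtain y where "u (x, y) = slice_fun.mn l (\<lambda>y. u (x, y))" using slice_fun.mn_attained[OF slice_slice] by metis
  moreover obtain z where "u (x, z) = slice_fun.mx l (\<lambda>y. u (x, y))" using slice_fun.mx_attained[OF slice_slice] by metis
  ultimately have "u (x, y) \<noteq> u (x, z)" by simp
  then show ?thesis by (rule that)
qed

lemma centre_in_W: assumes "centre l (\<lambda>y. u (x, y)) c"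
  shows "circle_rep l c \<in> {-l..l}" "centre l (\<lambda>y. u (x, y)) (circle_rep l c)"
proof -
  show "circle_rep l c \<in> {-l..l}" using abs_circle_rep_le[OF l, of c] by auto
  obtain k where k: "c = circle_rep l c + 2 * l * of_int k" using circle_rep_eq by blast
  have "centre l (\<lambda>y. u (x, y)) (c + 2 * l * of_int (- k))" using per assms by (intro centre_shift) auto
  moreover have "c + 2 * l * of_int (- k) = circle_rep l c" using k unfolding of_int_minus mult_minus_right by linarith
  ultimately show "centre l (\<lambda>y. u (x, y)) (circle_rep l c)" by (simp only:)
qed

text \<open>Projecting a closed set along a compact interval of centres gives a closed set, and a
  closed set that contains almost every point of an open set contains all of it. Normalising centres
  to [-l, l] provides the compactness.\<close>

lemma AE_open_cell_imp_all:
  assumes c: "closed T" and ae: "AE x in lborel. x \<in> open_cell l \<longrightarrow> (\<exists>c. centre l (\<lambda>y. u (x, y)) c \<and> P x c)"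
    and P: "\<And>x c. centre l (\<lambda>y. u (x, y)) c \<Longrightarrow> P x c \<Longrightarrow> (x, circle_rep l c) \<in> T" and x: "x \<in> open_cell l"
  shows "\<exists>c\<in>{-l..l}. (x, c) \<in> T"
proof -
  have cl: "closed {x. \<exists>c\<in>{-l..l}. (x, c) \<in> T}" by (rule closed_project_snd) (use c in auto)
  have "AE x in lborel. x \<in> open_cell l \<longrightarrow> x \<in> {x. \<exists>c\<in>{-l..l}. (x, c) \<in> T}"
    using ae
  proof eventually_elim
    case (elim x)
    then show ?case using P centre_in_W(1) by blast
  qed
  then have "AE x\<in>open_cell l in lebesgue. x \<in> {x. \<exists>c\<in>{-l..l}. (x, c) \<in> T}" by (rule AE_completion)
  from mem_closed_if_AE_lebesgue_open[OF open_cell_props(1) cl this x] show ?thesis by simp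
qed

lemma centre_ex: assumes "x \<in> open_cell l" shows "\<exists>c. centre l (\<lambda>y. u (x, y)) c"
proof -
  have "\<exists>c\<in>{-l..l}. (x, c) \<in> {p. centre l (\<lambda>y. u (fst p, y)) (snd p)}"
  proof (rule AE_open_cell_imp_all[OF closed_centres _ _ assms, where P = "\<lambda>_ _. True"])
    show "AE x in lborel. x \<in> open_cell l \<longrightarrow> (\<exists>c. centre l (\<lambda>y. u (x, y)) c \<and> True)"
      using AE_centre by eventually_elim (use open_cell_props(3) in blast)
  qed (use centre_in_W in auto)
  then show ?thesis by auto
qed

definition slice_centre where "slice_centre x = (SOME c. centre l (\<lambda>y. u (x, y)) c)"
text \<open>
  A centre is determined modulo \<open>2 * l\<close>, so the choice \<open>slice_centre\<close> may jump; \<open>branch x0\<close> takes the representative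
  closest to the centre at \<open>x0\<close> and is continuous there.
\<close>

definition branch where "branch x0 x = slice_centre x0 + circle_rep l (slice_centre x - slice_centre x0)"

lemma slice_centre: "x \<in> open_cell l \<Longrightarrow> centre l (\<lambda>y. u (x, y)) (slice_centre x)"
  unfolding slice_centre_def by (rule someI_ex[OF centre_ex])

lemma branch_slice_centre: "\<exists>k::int. slice_centre x = branch x0 x + 2 * l * of_int k"
proof -
  obtain k :: int where "slice_centre x - slice_centre x0 = circle_rep l (slice_centre x - slice_centre x0) + 2 * l * of_int k" using circle_rep_eq by blast
  then show ?thesis by (intro exI[of _ k]) (simp add: branch_def)
qed

lemma branch: "x \<in> open_cell l \<Longrightarrow> centre l (\<lambda>y. u (x, y)) (branch x0 x)"
proof -
  assume x: "x \<in> open_cell l"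
  obtain k :: int where k: "slice_centre x = branch x0 x + 2 * l * of_int k" using branch_slice_centre by blast
  have "centre l (\<lambda>y. u (x, y)) (slice_centre x + 2 * l * of_int (- k))" using per slice_centre[OF x] by (intro centre_shift) auto
  then show ?thesis using k by simp
qed

lemma branch_self: "branch x0 x0 = slice_centre x0" by (simp add: branch_def circle_rep_def)

text \<open>Having no centre in the compact set \<open>?K\<close>, one period around the centre at
  x0 minus a small ball, is an open condition on x. It holds at x0 by
  \<open>centre_unique\<close>.\<close>

lemma branch_near: assumes x0: "x0 \<in> open_cell l" and e: "e > 0"
  shows "\<exists>d>0. \<forall>x. dist x x0 < d \<longrightarrow> x \<in> open_cell l \<and> \<bar>branch x0 x - slice_centre x0\<bar> < e"
proof -
  let ?K = "{slice_centre x0 - l..slice_centre x0 + l} - ball (slice_centre x0) e"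
  let ?T = "{x. \<exists>c\<in>?K. (x, c) \<in> {p. centre l (\<lambda>y. u (fst p, y)) (snd p)}}"
  have "compact ?K" by (intro compact_diff) auto
  then have "closed ?T" by (rule closed_project_snd[OF _ closed_centres])
  then have o: "open (open_cell l - ?T)" using open_cell_props(1) by (intro open_Diff)
  have "x0 \<notin> ?T"
  proof
    assume "x0 \<in> ?T"
    then obtain c where c: "c \<in> ?K" "centre l (\<lambda>y. u (x0, y)) c" by auto
    obtain y z where ne: "u (x0, y) \<noteq> u (x0, z)" using u_nonconst open_cell_props(3) x0 by blast
    have "c - slice_centre x0 = 0"
      by (rule centre_unique[of "\<lambda>y. u (x0, y)" l "slice_centre x0" _ y z]) (use per slice_centre[OF x0] c ne in auto)
    then show False using c e by simp
  qed
  then obtain d where d: "d > 0" "ball x0 d \<subseteq> open_cell l - ?T" using o x0 by (meson Diff_iff openE)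
  have "x \<in> open_cell l \<and> \<bar>branch x0 x - slice_centre x0\<bar> < e" if "dist x x0 < d" for x
  proof -
    have x: "x \<in> open_cell l" "x \<notin> ?T" using d that by (auto simp: dist_commute subset_iff)
    have "branch x0 x \<notin> ?K" using x(2) branch[OF x(1), of x0] by auto
    moreover have "branch x0 x \<in> {slice_centre x0 - l..slice_centre x0 + l}"
      using abs_circle_rep_le[OF l, of "slice_centre x - slice_centre x0"] by (auto simp: branch_def)
    ultimately show ?thesis using x(1) by (auto simp: dist_real_def abs_minus_commute)
  qed
  then show ?thesis using d(1) by blast
qed

lemma snd_D_odd: assumes "centre l (\<lambda>y. u (x, y)) c" shows "snd (D (x, c - s)) = - snd (D (x, c + s))"
proof -
  have "((\<lambda>s. u (x, c + s)) has_real_derivative snd (D (x, c + s)) * 1) (at s)"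
    by (rule DERIV_chain'[where g = "\<lambda>y. u (x, y)" and f = "\<lambda>s. c + s"])
      (auto intro!: derivative_eq_intros GDERIV_path(2)[OF der])
  moreover have "((\<lambda>s. u (x, c - s)) has_real_derivative snd (D (x, c - s)) * (-1)) (at s)"
    by (rule DERIV_chain'[where g = "\<lambda>y. u (x, y)" and f = "\<lambda>s. c - s"])
      (auto intro!: derivative_eq_intros GDERIV_path(2)[OF der])
  moreover have "(\<lambda>s. u (x, c + s)) = (\<lambda>s. u (x, c - s))" using assms by (auto simp: centre_def)
  ultimately show ?thesis using DERIV_unique by force
qed

text \<open>Implicit differentiation of u(x, c + s) - u(x, c - s) = 0: its derivative in c is 2a,
  because the vertical derivative is odd about the centre. The solution is already given by
  \<open>branch\<close> and continuous at x0, so it suffices to bootstrap from continuity to a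
  Lipschitz bound at x0 and then to the derivative.\<close>

lemma branch_has_derivative:
  assumes x0: "x0 \<in> open_cell l" and a: "snd (D (x0, slice_centre x0 + s)) \<noteq> 0"
  shows "(branch x0 has_derivative (\<lambda>h. inner (- (1 / (2 * snd (D (x0, slice_centre x0 + s)))) *\<^sub>R (fst (D (x0, slice_centre x0 + s)) - fst (D (x0, slice_centre x0 - s)))) h)) (at x0)"
proof -
  define c0 where "c0 = slice_centre x0"
  define a where "a = snd (D (x0, c0 + s))"
  define \<kappa> where "\<kappa> = fst (D (x0, c0 + s)) - fst (D (x0, c0 - s))"
  have a0: "a \<noteq> 0" using a by (simp add: a_def c0_def)
  have cen: "centre l (\<lambda>y. u (x0, y)) c0" unfolding c0_def by (rule slice_centre[OF x0])
  have a': "snd (D (x0, c0 - s)) = - a" unfolding a_def by (rule snd_D_odd[OF cen])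
  have u0: "u (x0, c0 + s) = u (x0, c0 - s)" using cen by (auto simp: centre_def)
  \<comment> \<open>The Lipschitz constant at x0 that remains after half of the |\<delta>| terms
    have been absorbed.\<close>
  define L where "L = (norm \<kappa> + \<bar>a\<bar>) / \<bar>a\<bar>"
  have L: "0 \<le> L" by (simp add: L_def)
  have "\<exists>d>0. \<forall>x. norm (x - x0) < d \<longrightarrow> norm (branch x0 x - branch x0 x0 - inner (- (1 / (2 * a)) *\<^sub>R \<kappa>) (x - x0)) \<le> e0 * norm (x - x0)"
    if e0: "e0 > 0" for e0
  proof -
    \<comment> \<open>The first bound permits the absorption that yields L, the second makes the
      final error at most e0 times the norm of h.\<close>
    define e where "e = min (\<bar>a\<bar> / 2) (e0 * \<bar>a\<bar> / (1 + L))"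
    have e: "e > 0" "2 * e \<le> \<bar>a\<bar>" "e * (1 + L) \<le> e0 * \<bar>a\<bar>"
    proof -
      show "e > 0" using a0 e0 L by (simp add: e_def)
      show "2 * e \<le> \<bar>a\<bar>" by (simp add: e_def)
      have "e \<le> e0 * \<bar>a\<bar> / (1 + L)" by (simp add: e_def)
      then show "e * (1 + L) \<le> e0 * \<bar>a\<bar>" using L by (simp add: pos_le_divide_eq)
    qed
    have "(u has_derivative (\<lambda>h. inner h (D p))) (at p)" for p using der by (simp add: gderiv_def)
    then have "\<exists>d>0. \<forall>q. norm (q - p) < d \<longrightarrow> norm (u q - u p - inner (q - p) (D p)) \<le> e * norm (q - p)" for p
      using e(1) unfolding has_derivative_at_alt by blast
    then obtain d1 d2 where d12: "d1 > 0" "d2 > 0"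
      "\<And>q. norm (q - (x0, c0 + s)) < d1 \<Longrightarrow> norm (u q - u (x0, c0 + s) - inner (q - (x0, c0 + s)) (D (x0, c0 + s))) \<le> e * norm (q - (x0, c0 + s))"
      "\<And>q. norm (q - (x0, c0 - s)) < d2 \<Longrightarrow> norm (u q - u (x0, c0 - s) - inner (q - (x0, c0 - s)) (D (x0, c0 - s))) \<le> e * norm (q - (x0, c0 - s))"
      by metis
    define d where "d = min d1 d2 / 2"
    have d: "d > 0" "d \<le> d1 / 2" "d \<le> d2 / 2" using d12 by (auto simp: d_def)
    obtain d3 where d3: "d3 > 0" "\<And>x. dist x x0 < d3 \<Longrightarrow> x \<in> open_cell l \<and> \<bar>branch x0 x - slice_centre x0\<bar> < d" using branch_near[OF x0 d(1)] by blast
    have "norm (branch x0 x - branch x0 x0 - inner (- (1 / (2 * a)) *\<^sub>R \<kappa>) (x - x0)) \<le> e0 * norm (x - x0)"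
      if x: "norm (x - x0) < min d d3" for x
    proof -
      define h where "h = x - x0"
      define \<delta> where "\<delta> = branch x0 x - c0"
      have xS: "x \<in> open_cell l" and \<delta>: "\<bar>\<delta>\<bar> < d" using d3(2)[of x] x by (auto simp: dist_norm \<delta>_def c0_def)
      have hd: "norm h < d" using x by (simp add: h_def)
      have nle: "norm (h, \<delta>) \<le> norm h + \<bar>\<delta>\<bar>" using norm_Pair_le[of h \<delta>] by simp
      have q1: "(x, branch x0 x + s) - (x0, c0 + s) = (h, \<delta>)" and q2: "(x, branch x0 x - s) - (x0, c0 - s) = (h, \<delta>)"
        by (auto simp: h_def \<delta>_def)
      have 1: "\<bar>u (x, branch x0 x + s) - u (x0, c0 + s) - (inner h (fst (D (x0, c0 + s))) + \<delta> * a)\<bar> \<le> e * (norm h + \<bar>\<delta>\<bar>)"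
      proof -
        have "norm (h, \<delta>) < d1" using nle hd \<delta> d by linarith
        from d12(3)[of "(x, branch x0 x + s)", unfolded q1, OF this]
        have "\<bar>u (x, branch x0 x + s) - u (x0, c0 + s) - (inner h (fst (D (x0, c0 + s))) + \<delta> * a)\<bar> \<le> e * norm (h, \<delta>)"
          by (simp add: inner_prod_def a_def)
        also have "\<dots> \<le> e * (norm h + \<bar>\<delta>\<bar>)" using nle e(1) by (intro mult_left_mono) auto
        finally show ?thesis .
      qed
      have 2: "\<bar>u (x, branch x0 x - s) - u (x0, c0 - s) - (inner h (fst (D (x0, c0 - s))) - \<delta> * a)\<bar> \<le> e * (norm h + \<bar>\<delta>\<bar>)"
      proof -
        have "norm (h, \<delta>) < d2" using nle hd \<delta> d by linarith
        from d12(4)[of "(x, branch x0 x - s)", unfolded q2, OF this]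
        have "\<bar>u (x, branch x0 x - s) - u (x0, c0 - s) - (inner h (fst (D (x0, c0 - s))) - \<delta> * a)\<bar> \<le> e * norm (h, \<delta>)"
          by (simp add: inner_prod_def a')
        also have "\<dots> \<le> e * (norm h + \<bar>\<delta>\<bar>)" using nle e(1) by (intro mult_left_mono) auto
        finally show ?thesis .
      qed
      have eq: "u (x, branch x0 x + s) = u (x, branch x0 x - s)" using branch[OF xS, of x0] by (auto simp: centre_def)
      have \<kappa>h: "inner h \<kappa> = inner h (fst (D (x0, c0 + s))) - inner h (fst (D (x0, c0 - s)))" by (simp add: \<kappa>_def inner_diff_right)
      have 3: "\<bar>inner h \<kappa> + 2 * \<delta> * a\<bar> \<le> 2 * e * norm h + 2 * e * \<bar>\<delta>\<bar>"
        using 1 2 eq u0 \<kappa>h by (simp add: algebra_simps abs_le_iff)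
      have 4: "\<bar>inner h \<kappa>\<bar> \<le> norm h * norm \<kappa>" by (rule Cauchy_Schwarz_ineq2)
      have "2 * e * \<bar>\<delta>\<bar> \<le> \<bar>a\<bar> * \<bar>\<delta>\<bar>" "2 * e * norm h \<le> \<bar>a\<bar> * norm h" using e(2) by (auto intro: mult_right_mono)
      moreover have "2 * \<bar>\<delta>\<bar> * \<bar>a\<bar> \<le> \<bar>inner h \<kappa> + 2 * \<delta> * a\<bar> + \<bar>inner h \<kappa>\<bar>"
      proof -
        have "2 * \<bar>\<delta>\<bar> * \<bar>a\<bar> = \<bar>2 * \<delta> * a\<bar>" by (simp add: abs_mult)
        then show ?thesis by linarith
      qed
      ultimately have "\<bar>\<delta>\<bar> * \<bar>a\<bar> \<le> norm h * (norm \<kappa> + \<bar>a\<bar>)" using 3 4 by (simp add: algebra_simps)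
      then have 5: "\<bar>\<delta>\<bar> \<le> L * norm h" using a0 by (simp add: L_def field_simps)
      have "\<bar>inner h \<kappa> + 2 * \<delta> * a\<bar> \<le> 2 * (e * (1 + L)) * norm h"
      proof -
        have "2 * e * \<bar>\<delta>\<bar> \<le> 2 * e * (L * norm h)" using 5 e(1) by (intro mult_left_mono) auto
        then show ?thesis using 3 by (simp add: algebra_simps)
      qed
      also have "\<dots> \<le> 2 * (e0 * \<bar>a\<bar>) * norm h" using e(3) by (intro mult_right_mono mult_left_mono) auto
      finally have 6: "\<bar>inner h \<kappa> + 2 * \<delta> * a\<bar> \<le> 2 * \<bar>a\<bar> * (e0 * norm h)" by (simp add: mult_ac)
      have "\<delta> - inner (- (1 / (2 * a)) *\<^sub>R \<kappa>) h = (inner h \<kappa> + 2 * \<delta> * a) / (2 * a)"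
        using a0 by (simp add: inner_commute[of \<kappa>] field_simps)
      then have "\<bar>\<delta> - inner (- (1 / (2 * a)) *\<^sub>R \<kappa>) h\<bar> = \<bar>inner h \<kappa> + 2 * \<delta> * a\<bar> / (2 * \<bar>a\<bar>)"
        by (simp add: abs_divide abs_mult)
      also have "\<dots> \<le> e0 * norm h" using 6 a0 by (simp add: pos_divide_le_eq mult_ac)
      finally show ?thesis by (simp add: branch_self \<delta>_def h_def c0_def)
    qed
    then show ?thesis using d d3(1) by (intro exI[of _ "min d d3"]) auto
  qed
  then have "(branch x0 has_derivative (\<lambda>h. inner (- (1 / (2 * a)) *\<^sub>R \<kappa>) h)) (at x0)"
    unfolding has_derivative_at_alt by (intro conjI allI impI bounded_linear_inner_right) auto
  then show ?thesis unfolding a_def \<kappa>_def c0_def .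
qed

text \<open>Without such a point the slice would be constant over a full period, against
  \<open>u_nonconst\<close>. It supplies the nonzero denominator in
  \<open>branch_has_derivative\<close>.\<close>

lemma regular_point: assumes x: "x \<in> open_cell l"
  obtains s where "s \<in> {-l<..<l}" "snd (D (x, slice_centre x + s)) \<noteq> 0"
proof -
  have "\<exists>s\<in>{-l<..<l}. snd (D (x, slice_centre x + s)) \<noteq> 0"
  proof (rule ccontr)
    assume "\<not> ?thesis"
    then have z: "snd (D (x, slice_centre x + s)) = 0" if "-l < s" "s < l" for s using that by auto
    have "u (x, slice_centre x + s) = u (x, slice_centre x - l)" if "s \<in> {-l..l}" for s
    proof -
      have "((\<lambda>s. u (x, slice_centre x + s)) has_real_derivative snd (D (x, slice_centre x + s))) (at s)" for s
      proof -
        have "((\<lambda>s. u (x, slice_centre x + s)) has_real_derivative snd (D (x, slice_centre x + s)) * 1) (at s)"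
          by (rule DERIV_chain'[where g = "\<lambda>y. u (x, y)" and f = "\<lambda>s. slice_centre x + s"])
            (auto intro!: derivative_eq_intros GDERIV_path(2)[OF der])
        then show ?thesis by simp
      qed
      then have "((\<lambda>s. u (x, slice_centre x + s)) has_real_derivative 0) (at s)" if "-l < s" "s < l" for s
        using z[OF that] by metis
      then have "u (x, slice_centre x + s) = u (x, slice_centre x + (-l))"
        using that l by (intro DERIV_isconst2[of "-l" l "\<lambda>s. u (x, slice_centre x + s)"]) (auto intro!: contu' continuous_intros)
      then show ?thesis by simp
    qed
    moreover obtain y z where "u (x, y) \<noteq> u (x, z)" using u_nonconst open_cell_props(3) x by blast
    moreover have "u (x, y) = u (x, slice_centre x + circle_rep l (y - slice_centre x))" for y
      using periodic_circle_rep[of "\<lambda>y. u (x, y)" l "slice_centre x" "y - slice_centre x"] per by simp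
    ultimately show False using abs_circle_rep_le[OF l] by (metis abs_le_iff atLeastAtMost_iff minus_le_iff)
  qed
  then show ?thesis using that by blast
qed

text \<open>Chain rule for v(x, z) = u(x, branch x + z), which holds near x0 because any centre
  represents v by \<open>v_centre\<close>. So v turns out to be differentiable on the whole interior
  slice.\<close>

lemma v_gradient:
  assumes x0: "x0 \<in> open_cell l" and g: "(branch x0 has_derivative (\<lambda>h. inner \<gamma> h)) (at x0)"
  shows "GDERIV v (x0, z) :> (fst (D (x0, slice_centre x0 + z)) + snd (D (x0, slice_centre x0 + z)) *\<^sub>R \<gamma>, snd (D (x0, slice_centre x0 + z)))"
proof -
  let ?D = "D (x0, slice_centre x0 + z)"
  have branch': "((\<lambda>q. branch x0 (fst q)) has_derivative (\<lambda>h. inner \<gamma> (fst h))) (at (x0, z))"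
    by (rule has_derivative_compose[where g = "branch x0" and f = fst]) (auto intro!: derivative_eq_intros simp: g)
  have "((\<lambda>q. u (fst q, branch x0 (fst q) + snd q)) has_derivative (\<lambda>h. inner (fst h, inner \<gamma> (fst h) + snd h) ?D)) (at (x0, z))"
    by (rule has_derivative_compose[where g = u and f = "\<lambda>q. (fst q, branch x0 (fst q) + snd q)"])
      (use der in \<open>auto intro!: derivative_eq_intros branch' simp: gderiv_def branch_self\<close>)
  then have "(v has_derivative (\<lambda>h. inner (fst h, inner \<gamma> (fst h) + snd h) ?D)) (at (x0, z))"
  proof (rule has_derivative_transform_within_open)
    show "open (open_cell l \<times> (UNIV :: real set))" by (intro open_Times open_cell_props) auto
    show "(x0, z) \<in> open_cell l \<times> UNIV" using x0 by simp
    show "u (fst q, branch x0 (fst q) + snd q) = v q" if "q \<in> open_cell l \<times> UNIV" for q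
      using v_centre[OF branch[of "fst q" x0], of "snd q"] that by auto
  qed
  moreover have "(\<lambda>h. inner (fst h, inner \<gamma> (fst h) + snd h) ?D) = (\<lambda>h. inner h (fst ?D + snd ?D *\<^sub>R \<gamma>, snd ?D))"
    by (auto simp: fun_eq_iff inner_prod_def inner_add_right inner_commute algebra_simps)
  ultimately show ?thesis by (simp add: gderiv_def)
qed

text \<open>v is even in z, so its horizontal gradients at z and -z agree. Both are expressed by
  \<open>v_gradient\<close>, and the vertical derivative of u changes sign.\<close>

lemma D_reflect:
  assumes x0: "x0 \<in> open_cell l" and g: "(branch x0 has_derivative (\<lambda>h. inner \<gamma> h)) (at x0)"
  shows "fst (D (x0, slice_centre x0 - z)) = fst (D (x0, slice_centre x0 + z)) + (2 * snd (D (x0, slice_centre x0 + z))) *\<^sub>R \<gamma>"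
proof -
  have odd: "snd (D (x0, slice_centre x0 - z)) = - snd (D (x0, slice_centre x0 + z))" using snd_D_odd[OF slice_centre[OF x0]] by simp
  have 1: "(v has_derivative (\<lambda>h. inner h (fst (D (x0, slice_centre x0 + z)) + snd (D (x0, slice_centre x0 + z)) *\<^sub>R \<gamma>, snd (D (x0, slice_centre x0 + z))))) (at (x0, z))"
    using v_gradient[OF x0 g, of z] by (simp add: gderiv_def)
  have "((\<lambda>q. v (fst q, - snd q)) has_derivative (\<lambda>h. inner (fst h, - snd h) (fst (D (x0, slice_centre x0 + - z)) + snd (D (x0, slice_centre x0 + - z)) *\<^sub>R \<gamma>, snd (D (x0, slice_centre x0 + - z))))) (at (x0, z))"
    by (rule has_derivative_compose[where g = v and f = "\<lambda>q. (fst q, - snd q)"])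
      (use v_gradient[OF x0 g, of "-z"] in \<open>auto intro!: derivative_eq_intros simp: gderiv_def\<close>)
  then have "(v has_derivative (\<lambda>h. inner (fst h, - snd h) (fst (D (x0, slice_centre x0 + - z)) + snd (D (x0, slice_centre x0 + - z)) *\<^sub>R \<gamma>, snd (D (x0, slice_centre x0 + - z))))) (at (x0, z))"
  proof (rule has_derivative_transform_within_open)
    show "open (open_cell l \<times> (UNIV :: real set))" by (intro open_Times open_cell_props) auto
    show "(x0, z) \<in> open_cell l \<times> UNIV" using x0 by simp
    show "v (fst q, - snd q) = v q" if "q \<in> open_cell l \<times> UNIV" for q
    proof -
      have c: "centre l (\<lambda>y. u (fst q, y)) (slice_centre (fst q))" using that by (intro slice_centre) auto
      then have "u (fst q, slice_centre (fst q) - snd q) = u (fst q, slice_centre (fst q) + snd q)" by (auto simp: centre_def)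
      then show ?thesis using v_centre[OF c, of "snd q"] v_centre[OF c, of "- snd q"] by simp
    qed
  qed
  note eq = has_derivative_unique[OF 1 this]
  have H: "inner h (fst (D (x0, slice_centre x0 + z)) + snd (D (x0, slice_centre x0 + z)) *\<^sub>R \<gamma>) = inner h (fst (D (x0, slice_centre x0 - z)) - snd (D (x0, slice_centre x0 + z)) *\<^sub>R \<gamma>)" for h
    using fun_cong[OF eq, of "(h, 0)"] by (simp add: inner_prod_def odd)
  have "fst (D (x0, slice_centre x0 + z)) + snd (D (x0, slice_centre x0 + z)) *\<^sub>R \<gamma> = fst (D (x0, slice_centre x0 - z)) - snd (D (x0, slice_centre x0 + z)) *\<^sub>R \<gamma>"
    by (rule vector_eq_ldot[THEN iffD1]) (rule allI, rule H)
  then have "fst (D (x0, slice_centre x0 - z)) = fst (D (x0, slice_centre x0 + z)) + snd (D (x0, slice_centre x0 + z)) *\<^sub>R \<gamma> + snd (D (x0, slice_centre x0 + z)) *\<^sub>R \<gamma>"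
    by (simp add: eq_diff_eq)
  also have "\<dots> = fst (D (x0, slice_centre x0 + z)) + (2 * snd (D (x0, slice_centre x0 + z))) *\<^sub>R \<gamma>" by (simp add: add.assoc scaleR_left_distrib[symmetric])
  finally show ?thesis .
qed

end

section \<open>Vanishing of the gradient of the centre\<close>

context equality_case begin

lemma centre_gradient:
  assumes x0: "x0 \<in> open_cell l" obtains \<gamma> where "(branch x0 has_derivative (\<lambda>h. inner \<gamma> h)) (at x0)"
  using regular_point[OF x0] branch_has_derivative[OF x0] by metis

lemma nn_integral_reflect:
  fixes f :: "real \<Rightarrow> ennreal"
  assumes [measurable]: "f \<in> borel_measurable borel"
  shows "(\<integral>\<^sup>+z\<in>{-l..l}. f (- z) \<partial>lborel) = (\<integral>\<^sup>+z\<in>{-l..l}. f z \<partial>lborel)"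
proof -
  have "(\<integral>\<^sup>+z\<in>{-l..l}. f z \<partial>lborel) = (\<integral>\<^sup>+z. f (0 + (-1) * z) * indicator {-l..l} (0 + (-1) * z) \<partial>lborel)"
    by (subst nn_integral_real_affine[where c = "-1" and t = 0]) auto
  also have "\<dots> = (\<integral>\<^sup>+z\<in>{-l..l}. f (- z) \<partial>lborel)"
    by (intro nn_integral_cong) (auto simp: indicator_def)
  finally show ?thesis ..
qed

lemma parallelogram:
  fixes w d :: "'b::real_inner"
  shows "(norm (w - d))\<^sup>2 + (norm (w + d))\<^sup>2 = 2 * (norm w)\<^sup>2 + 2 * (norm d)\<^sup>2"
  by (simp add: power2_norm_eq_inner inner_add_left inner_add_right inner_diff_left inner_diff_right)

text \<open>Averaging the energy density of u over z and -z gives that of v plus |\<gamma>|^2 times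
  the squared vertical derivative. Equal energies make the integral of this excess zero, while the
  vertical derivative is nonzero on a nonempty open set.\<close>

lemma gradient_zero_if_eq:
  assumes x0: "x0 \<in> open_cell l" and g: "(branch x0 has_derivative (\<lambda>h. inner \<gamma> h)) (at x0)" and AB: "sym_energy x0 = slice_energy x0"
  shows "\<gamma> = 0"
proof -
  let ?F = "\<lambda>z. fst (D (x0, slice_centre x0 + z))" and ?p = "\<lambda>z. snd (D (x0, slice_centre x0 + z))"
  let ?W = "\<lambda>z. (norm (?F z + ?p z *\<^sub>R \<gamma>))\<^sup>2 + (?p z)\<^sup>2"
  let ?G = "\<lambda>z. (norm (?F z))\<^sup>2 + (?p z)\<^sup>2"
  have nP: "(norm (a, b))\<^sup>2 = (norm a)\<^sup>2 + b\<^sup>2" for a :: 'a and b :: real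
    by (simp add: norm_Pair)
  have nD: "(norm (D q))\<^sup>2 = (norm (fst (D q)))\<^sup>2 + (snd (D q))\<^sup>2" for q
    using nP[of "fst (D q)" "snd (D q)"] by simp
  have [measurable]: "?G \<in> borel_measurable borel" "?W \<in> borel_measurable borel" "(\<lambda>z. (?p z)\<^sup>2 * (norm \<gamma>)\<^sup>2) \<in> borel_measurable borel"
    by (intro borel_measurable_continuous_onI continuous_intros contD')+
  have A: "sym_energy x0 = (\<integral>\<^sup>+z\<in>{-l..l}. ennreal (?W z) \<partial>lborel)"
    unfolding sym_energy_def grad_eq[OF v_gradient[OF x0 g]] nP ..
  have B: "slice_energy x0 = (\<integral>\<^sup>+z\<in>{-l..l}. ennreal (?G z) \<partial>lborel)" unfolding slice_energy_recentre[of x0 "slice_centre x0"] nD ..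
  have B': "slice_energy x0 = (\<integral>\<^sup>+z\<in>{-l..l}. ennreal (?G (- z)) \<partial>lborel)"
    unfolding B by (rule nn_integral_reflect[symmetric]) measurable
  \<comment> \<open>Parallelogram law with w the horizontal gradient of v and d the vertical
    derivative times \<gamma>: the horizontal gradients of u are w - d and w + d.\<close>
  have id: "?G z + ?G (- z) = 2 * ?W z + 2 * ((?p z)\<^sup>2 * (norm \<gamma>)\<^sup>2)" for z
  proof -
    have F: "?F (- z) = ?F z + (2 * ?p z) *\<^sub>R \<gamma>" using D_reflect[OF x0 g, of z] by simp
    have p: "?p (- z) = - ?p z" using snd_D_odd[OF slice_centre[OF x0], of z] by simp
    have "(norm (?F z))\<^sup>2 + (norm (?F z + (2 * ?p z) *\<^sub>R \<gamma>))\<^sup>2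
      = 2 * (norm (?F z + ?p z *\<^sub>R \<gamma>))\<^sup>2 + 2 * ((?p z)\<^sup>2 * (norm \<gamma>)\<^sup>2)"
      using parallelogram[of "?F z + ?p z *\<^sub>R \<gamma>" "?p z *\<^sub>R \<gamma>"]
      by (simp add: power_mult_distrib add.assoc scaleR_left_distrib[symmetric])
    then show ?thesis unfolding F p by simp
  qed
  have "slice_energy x0 + slice_energy x0 = (\<integral>\<^sup>+z\<in>{-l..l}. ennreal (?G z) \<partial>lborel) + (\<integral>\<^sup>+z\<in>{-l..l}. ennreal (?G (- z)) \<partial>lborel)"
    using B B' by simp
  also have "\<dots> = (\<integral>\<^sup>+z. ennreal (?G z) * indicator {-l..l} z + ennreal (?G (- z)) * indicator {-l..l} z \<partial>lborel)"
    by (rule nn_integral_add[symmetric]) measurable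
  also have "\<dots> = (\<integral>\<^sup>+z. (ennreal (?W z) * indicator {-l..l} z + ennreal (?W z) * indicator {-l..l} z) + 2 * (ennreal ((?p z)\<^sup>2 * (norm \<gamma>)\<^sup>2) * indicator {-l..l} z) \<partial>lborel)"
  proof (rule nn_integral_cong)
    fix z
    have "ennreal (?G z) + ennreal (?G (- z)) = ennreal (?G z + ?G (- z))" by (rule ennreal_plus[symmetric]) auto
    also have "\<dots> = ennreal (?W z + ?W z + 2 * ((?p z)\<^sup>2 * (norm \<gamma>)\<^sup>2))" unfolding id by simp
    also have "\<dots> = ennreal (?W z + ?W z) + ennreal (2 * ((?p z)\<^sup>2 * (norm \<gamma>)\<^sup>2))" by (rule ennreal_plus) auto
    also have "ennreal (?W z + ?W z) = ennreal (?W z) + ennreal (?W z)" by (rule ennreal_plus) auto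
    also have "ennreal (2 * ((?p z)\<^sup>2 * (norm \<gamma>)\<^sup>2)) = 2 * ennreal ((?p z)\<^sup>2 * (norm \<gamma>)\<^sup>2)" by (simp add: ennreal_mult')
    finally show "ennreal (?G z) * indicator {-l..l} z + ennreal (?G (- z)) * indicator {-l..l} z
      = (ennreal (?W z) * indicator {-l..l} z + ennreal (?W z) * indicator {-l..l} z) + 2 * (ennreal ((?p z)\<^sup>2 * (norm \<gamma>)\<^sup>2) * indicator {-l..l} z)"
      by (cases "z \<in> {-l..l}") simp_all
  qed
  also have "\<dots> = (sym_energy x0 + sym_energy x0) + 2 * (\<integral>\<^sup>+z\<in>{-l..l}. ennreal ((?p z)\<^sup>2 * (norm \<gamma>)\<^sup>2) \<partial>lborel)"
    unfolding A by (subst nn_integral_add, measurable)+ (subst nn_integral_cmult, measurable)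
  finally have "2 * (\<integral>\<^sup>+z\<in>{-l..l}. ennreal ((?p z)\<^sup>2 * (norm \<gamma>)\<^sup>2) \<partial>lborel) = 0"
    using slice_energy_finite[of x0] unfolding AB by (auto simp: ennreal_add_eq_top)
  then have "(\<integral>\<^sup>+z\<in>{-l..l}. ennreal ((?p z)\<^sup>2 * (norm \<gamma>)\<^sup>2) \<partial>lborel) = 0" by simp
  then have ae: "AE z in lborel. ennreal ((?p z)\<^sup>2 * (norm \<gamma>)\<^sup>2) * indicator {-l..l} z = 0"
    by (subst (asm) nn_integral_0_iff_AE) auto
  show "\<gamma> = 0"
  proof (rule ccontr)
    assume ne: "\<gamma> \<noteq> 0"
    let ?U = "{-l<..<l} \<inter> {z. ?p z \<noteq> 0}"
    have "open ?U" by (intro open_Int open_Collect_neq continuous_intros contD' open_greaterThanLessThan)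
    moreover have "?U \<noteq> {}" using regular_point[OF x0] by blast
    moreover have "AE z in lborel. z \<notin> ?U" using ae by eventually_elim (auto simp: indicator_def ne split: if_splits)
    then have "?U \<in> null_sets lborel" using \<open>open ?U\<close> by (subst AE_iff_null_sets) auto
    then have "negligible ?U" using null_sets_completionI negligible_iff_null_sets by blast
    ultimately show False using open_not_negligible by blast
  qed
qed

text \<open>For almost every slice \<gamma> = 0, and \<open>D_reflect\<close> then says that D is
  even about the centre. Being closed, this condition holds on every slice about some centre, which
  by uniqueness differs from \<open>slice_centre\<close> by a multiple of 2l.\<close>

lemma even_gradient: assumes x0: "x0 \<in> open_cell l" shows "fst (D (x0, slice_centre x0 + z)) = fst (D (x0, slice_centre x0 - z))"
proof -
  let ?E = "\<lambda>x c. \<forall>z. fst (D (x, c + z)) = fst (D (x, c - z))"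
  have Dshift: "D (x, c + 2 * l * of_int k) = D (x, c)" for x c k
    using periodic_int[of "\<lambda>y. D (x, y)" "2 * l"] D_per by simp
  have E_shift: "?E x (c + 2 * l * of_int k)" if "?E x c" for x c k
  proof
    fix z
    show "fst (D (x, c + 2 * l * of_int k + z)) = fst (D (x, c + 2 * l * of_int k - z))"
    proof -
      have e: "c + 2 * l * of_int k + z = (c + z) + 2 * l * of_int k" "c + 2 * l * of_int k - z = (c - z) + 2 * l * of_int k"
        by simp_all
      show ?thesis unfolding e Dshift using that by blast
    qed
  qed
  have rep: "\<exists>k::int. circle_rep l c = c + 2 * l * of_int k" for c
  proof -
    obtain k :: int where "c = circle_rep l c + 2 * l * of_int k" using circle_rep_eq by blast
    then have "circle_rep l c = c + 2 * l * of_int (- k)" unfolding of_int_minus mult_minus_right by linarith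
    then show ?thesis by blast
  qed
  let ?T = "{p. centre l (\<lambda>y. u (fst p, y)) (snd p)} \<inter> {p. \<forall>z. fst (D (fst p, snd p + z)) = fst (D (fst p, snd p - z))}"
  have "\<exists>c\<in>{-l..l}. (x0, c) \<in> ?T"
  proof (rule AE_open_cell_imp_all[OF closed_Int[OF closed_centres closed_even] _ _ x0, where P = ?E])
    show "AE x in lborel. x \<in> open_cell l \<longrightarrow> (\<exists>c. centre l (\<lambda>y. u (x, y)) c \<and> ?E x c)"
      using AE_centre
    proof eventually_elim
      case (elim x)
      show ?case
      proof
        assume x: "x \<in> open_cell l"
        then have "sym_energy x = slice_energy x" using elim open_cell_props(3) by blast
        moreover obtain \<gamma> where g: "(branch x has_derivative (\<lambda>h. inner \<gamma> h)) (at x)" using centre_gradient[OF x] by blast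
        ultimately have "\<gamma> = 0" by (intro gradient_zero_if_eq[OF x])
        then have "?E x (slice_centre x)" using D_reflect[OF x g] by simp
        then show "\<exists>c. centre l (\<lambda>y. u (x, y)) c \<and> ?E x c" using slice_centre[OF x] by blast
      qed
    qed
    show "(x, circle_rep l c) \<in> ?T" if "centre l (\<lambda>y. u (x, y)) c" "?E x c" for x c
    proof -
      obtain k where k: "circle_rep l c = c + 2 * l * of_int k" using rep by blast
      have "?E x (circle_rep l c)" unfolding k by (rule E_shift[OF that(2)])
      then show ?thesis using centre_in_W(2)[OF that(1)] by simp
    qed
  qed
  then obtain c where c: "centre l (\<lambda>y. u (x0, y)) c" "?E x0 c" by auto
  obtain k where k: "circle_rep l (slice_centre x0 - c) = (slice_centre x0 - c) + 2 * l * of_int k" using rep by blast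
  obtain y z where ne: "u (x0, y) \<noteq> u (x0, z)" using u_nonconst open_cell_props(3) x0 by blast
  have "centre l (\<lambda>y. u (x0, y)) (slice_centre x0 + 2 * l * of_int k)" using per slice_centre[OF x0] by (intro centre_shift) auto
  then have "centre l (\<lambda>y. u (x0, y)) (c + circle_rep l (slice_centre x0 - c))" unfolding k by (simp add: algebra_simps)
  then have "circle_rep l (slice_centre x0 - c) = 0"
    by (intro centre_unique[of "\<lambda>y. u (x0, y)" l c _ y z]) (use per c ne abs_circle_rep_le[OF l] in auto)
  then have "slice_centre x0 = c + 2 * l * of_int (- k)" using k unfolding of_int_minus mult_minus_right by linarith
  then show ?thesis using E_shift[OF c(2), of "- k"] by simp
qed

lemma branch_derivative_zero: assumes x0: "x0 \<in> open_cell l" shows "(branch x0 has_derivative (\<lambda>h. 0)) (at x0)"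
proof -
  obtain s where "snd (D (x0, slice_centre x0 + s)) \<noteq> 0" using regular_point[OF x0] by blast
  from branch_has_derivative[OF x0 this] show ?thesis using even_gradient[OF x0, of s] by simp
qed

text \<open>\<open>slice_centre\<close> may jump by multiples of 2l, but cos and sin of pi c / l do
  not see the jumps and have the same values on each local branch. So they are differentiable with
  derivative 0, hence constant on the convex open cell, and together they determine c modulo
  2l.\<close>

lemma common_centre: "\<exists>c\<in>{-l..l}. \<forall>x\<in>cell l. centre l (\<lambda>y. u (x, y)) c"
proof -
  obtain x1 :: 'a where x1: "x1 \<in> open_cell l" using open_cell_nonempty[OF l] by blast
  have trig: "cos (pi * slice_centre x / l) = cos (pi * branch x0 x / l)" "sin (pi * slice_centre x / l) = sin (pi * branch x0 x / l)" for x x0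
  proof -
    obtain k :: int where k: "slice_centre x = branch x0 x + 2 * l * of_int k" using branch_slice_centre by blast
    have "pi * slice_centre x / l = pi * branch x0 x / l + 2 * pi * of_int k" unfolding k using l by (simp add: field_simps)
    then show "cos (pi * slice_centre x / l) = cos (pi * branch x0 x / l)" "sin (pi * slice_centre x / l) = sin (pi * branch x0 x / l)"
      using sin_cos_eq_iff by blast+
  qed
  have "((\<lambda>x. cos (pi * slice_centre x / l)) has_derivative (\<lambda>h. 0)) (at x0 within open_cell l)"
    "((\<lambda>x. sin (pi * slice_centre x / l)) has_derivative (\<lambda>h. 0)) (at x0 within open_cell l)" if x0: "x0 \<in> open_cell l" for x0
  proof -
    note d = has_derivative_at_withinI[OF branch_derivative_zero[OF x0]]
    show "((\<lambda>x. cos (pi * slice_centre x / l)) has_derivative (\<lambda>h. 0)) (at x0 within open_cell l)" unfolding trig[of _ x0]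
      by (rule has_derivative_eq_rhs, (rule derivative_intros d | simp)+) (use l in \<open>auto simp: fun_eq_iff\<close>)
    show "((\<lambda>x. sin (pi * slice_centre x / l)) has_derivative (\<lambda>h. 0)) (at x0 within open_cell l)" unfolding trig[of _ x0]
      by (rule has_derivative_eq_rhs, (rule derivative_intros d | simp)+) (use l in \<open>auto simp: fun_eq_iff\<close>)
  qed
  then obtain a b where ab: "\<And>x. x \<in> open_cell l \<Longrightarrow> cos (pi * slice_centre x / l) = a" "\<And>x. x \<in> open_cell l \<Longrightarrow> sin (pi * slice_centre x / l) = b"
    using has_derivative_zero_constant[OF open_cell_props(2), of l "\<lambda>x. cos (pi * slice_centre x / l)"]
      has_derivative_zero_constant[OF open_cell_props(2), of l "\<lambda>x. sin (pi * slice_centre x / l)"] by metis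
  define c where "c = circle_rep l (slice_centre x1)"
  have cS: "centre l (\<lambda>y. u (x, y)) c" if x: "x \<in> open_cell l" for x
  proof -
    have "sin (pi * slice_centre x1 / l) = sin (pi * slice_centre x / l) \<and> cos (pi * slice_centre x1 / l) = cos (pi * slice_centre x / l)" using ab x x1 by simp
    then obtain k where "pi * slice_centre x1 / l = pi * slice_centre x / l + 2 * pi * of_int k" using sin_cos_eq_iff by blast
    then have "pi * slice_centre x1 = pi * (slice_centre x + 2 * l * of_int k)" using l by (simp add: field_simps)
    then have "slice_centre x1 = slice_centre x + 2 * l * of_int k" by simp
    moreover have "centre l (\<lambda>y. u (x, y)) (slice_centre x + 2 * l * of_int k)" using per slice_centre[OF x] by (intro centre_shift) auto
    ultimately have "centre l (\<lambda>y. u (x, y)) (slice_centre x1)" by simp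
    then show ?thesis unfolding c_def by (rule centre_in_W(2))
  qed
  have "closed ((\<lambda>x. (x, c)) -` {p. centre l (\<lambda>y. u (fst p, y)) (snd p)})"
    by (intro continuous_closed_vimage closed_centres) (auto intro!: continuous_intros)
  moreover have "open_cell l \<subseteq> (\<lambda>x. (x, c)) -` {p. centre l (\<lambda>y. u (fst p, y)) (snd p)}" using cS by auto
  ultimately have "closure (open_cell l) \<subseteq> (\<lambda>x. (x, c)) -` {p. centre l (\<lambda>y. u (fst p, y)) (snd p)}" by (rule closure_minimal[rotated])
  then have "\<forall>x\<in>cell l. centre l (\<lambda>y. u (x, y)) c" unfolding closure_open_cell[OF l] by auto
  moreover have "c \<in> {-l..l}" using abs_circle_rep_le[OF l, of "slice_centre x1"] by (auto simp: c_def)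
  ultimately show ?thesis by blast
qed

lemma translate: "\<exists>\<beta>\<in>{-l..l}. \<forall>x y. (x, y) \<in> cell l \<longrightarrow> u (x, y) = steiner l u (x, y - \<beta>)"
proof -
  obtain c where c: "c \<in> {-l..l}" "\<And>x. x \<in> cell l \<Longrightarrow> centre l (\<lambda>y. u (x, y)) c" using common_centre by blast
  have "u (x, y) = steiner l u (x, y - c)" if "(x, y) \<in> cell l" for x y
    using v_centre[OF c(2), of x "y - c"] that by (simp add: cell_Pair v_def)
  then show ?thesis using c(1) by blast
qed

end

theorem theorem1p2:
  fixes l :: real and u :: "(real ^ 'n) \<times> real \<Rightarrow> real"
  assumes "l > 0"
    and "C1_torus l u"
    and "\<forall>x' \<in> cell l. slice_min l u x' < slice_max l u x'"
    and "{(x', y). (x', y) \<in> cell l \<and> deriv (\<lambda>s. u (x', s)) y = 0 \<and>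
            slice_min l u x' < u (x', y) \<and> u (x', y) < slice_max l u x'} \<in> null_sets lebesgue"
    and "dirichlet l u = dirichlet l (steiner l u)"
  shows "\<exists>\<beta> \<in> {-l..l}. \<forall>x' y. (x', y) \<in> cell l \<longrightarrow> u (x', y) = steiner l u (x', y - \<beta>)"
proof -
  obtain D where D: "\<And>p. GDERIV u p :> D p" "continuous_on UNIV D" and per: "torus_periodic l u"
    using assms(2) unfolding C1_torus_def by blast
  interpret equality_case l u D
  proof
    show "u (x, y + 2 * l) = u (x, y)" for x y
      using per[unfolded torus_periodic_def, rule_format, of "(0, 1)" "(x, y)"] by (simp add: Basis_prod_def)
  qed (use assms D in auto)
  show ?thesis by (rule translate)
qed

end
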